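(* Let $q\ge 4$ with $q\equiv 2$ or $4\pmod 6$. Then there exists a Steiner quadruple system on $B_q$ that satisfies the step property with respect to some total order on $B_q$.
   Context: $B_q=\{0,\dots,q-1\}$. A Steiner quadruple system $SQS(q)$ on $B_q$ is a set of 4-element subsets (quadruples) of $B_q$ such that every 3-element subset of $B_q$ is contained in exactly one quadruple. Step property: given a total order $L_0<L_1<\cdots<L_{q-1}$ on $B_q=\{L_0,\dots,L_{q-1}\}$ ($q$ even), the $SQS(q)$ satisfies the step property with respect to this order if for every $t\in\{0,\dots,q/2-1\}$ and every quadruple of the system of the form $\{L_{2t},L_{2t+1},L_a,L_b\}$, either $a<2t$ and $b<2t$, or $a>2t+1$ and $b>2t+1$. *)

theory Defs
  imports Main
begin

definition B :: "nat \<Rightarrow> nat set" where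
  "B q = {0..<q}"

definition is_SQS :: "nat \<Rightarrow> nat set set \<Rightarrow> bool" where
  "is_SQS q S \<longleftrightarrow>
     (\<forall>Q\<in>S. Q \<subseteq> B q \<and> card Q = 4) \<and>
     (\<forall>T. T \<subseteq> B q \<and> card T = 3 \<longrightarrow> (\<exists>!Q. Q \<in> S \<and> T \<subseteq> Q))"

text \<open>A total order L_0 < L_1 < ... < L_(q-1) on B q is encoded by the bijection
  L : {0..<q} -> B q, i |-> L_i.  Step property with respect to that order.\<close>
definition step_property :: "nat \<Rightarrow> nat set set \<Rightarrow> (nat \<Rightarrow> nat) \<Rightarrow> bool" where
  "step_property q S L \<longleftrightarrow>
     (\<forall>t < q div 2. \<forall>a < q. \<forall>b < q.
        {L (2*t), L (2*t+1), L a, L b} \<in> S \<longrightarrow>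
          ((a < 2*t \<and> b < 2*t) \<or> (a > 2*t+1 \<and> b > 2*t+1)))"

end

theory Submission
  imports Defs
begin

text \<open>
  Levels are consecutive pairs of positions; the step property says that no block has two points
  on one level, one point strictly below and one strictly above it. The proof is Hanani's recursion
  for quadruple systems, arranged so that levels survive. Its building blocks are candelabra
  systems: a stem of \<open>s\<close> points and groups of \<open>g\<close> points, with blocks that cover once each triple not
  contained in the stem plus a single group. Filling the groups, in order, with a smaller system that
  has the step property keeps it, provided a block through two points of one level of a group has
  its other two points in earlier groups or in later groups.

  A system on \<open>n\<close> points turns a candelabra system with three groups into one with \<open>n - 1\<close> groups:
  blow up every point but one. With direct constructions for three groups
  (\<open>g \<equiv> s\<close> modulo 6), for four groups with stem 2, and two sporadic ones (\<open>g = 3\<close> with stem 1 and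
  \<open>g = 12\<close> with stem 2), this yields the orders \<open>2n\<close>, \<open>3n - 2\<close>, \<open>3n - 4\<close>, \<open>3n - 8\<close>, \<open>4n - 6\<close> and
  \<open>12n - 10\<close>, which together reach every \<open>q \<equiv> 2, 4\<close> modulo 6 starting from 2, 4 and 14.
\<close>

section \<open>Exact covers of triples\<close>

text \<open>The dangerous block has two points on a level of one group, one point in an earlier
  group or the stem, and one in a later group. Three-group systems exclude it by a condition that
  ignores the order of the groups, \<open>level_strong\<close>: the two remaining points lie in one
  common group or both in the stem. Permuting the points inside a group makes this possible, because
  suitable pairs of points occur in no other kind of block and these pairs are taken as levels.
  Groups of three points do not split into levels at all; there a level joins two groups, and the
  step property of the blown-up system keeps the blocks on one side. In the direct constructions
  uniqueness is not examined block against block: each triple is shown to be covered, and the number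
  of blocks is at most a quarter of the number of triples.\<close>

definition triples :: "'a set \<Rightarrow> 'a set set" where
  "triples X = {T. T \<subseteq> X \<and> card T = 3}"

text \<open>Blocks must not contain triples outside \<open>TT\<close>: this is what allows covers of
  disjoint families of triples to be united.\<close>

definition exact_cover :: "'a set set \<Rightarrow> 'a set set \<Rightarrow> bool" where
  "exact_cover C TT \<longleftrightarrow> (\<forall>Q\<in>C. card Q = 4 \<and> triples Q \<subseteq> TT) \<and>
     (\<forall>T\<in>TT. card T = 3 \<and> (\<exists>!Q. Q \<in> C \<and> T \<subseteq> Q))"

lemma finite_triples: "finite X \<Longrightarrow> finite (triples X)"
  by (rule finite_subset[of _ "Pow X"]) (auto simp: triples_def)

lemma card_triples: "finite X \<Longrightarrow> card (triples X) = card X choose 3"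
  by (simp add: triples_def n_subsets)

lemma card_4_distinct:
  "card {a,b,c,d} = 4 \<Longrightarrow> a \<noteq> b \<and> a \<noteq> c \<and> a \<noteq> d \<and> b \<noteq> c \<and> b \<noteq> d \<and> c \<noteq> d"
  by (auto simp: card_insert_if split: if_splits)

text \<open>A block of at most four points that contributes four triples has exactly four
  points.\<close>

lemma choose_3_le_4: "n \<le> 4 \<Longrightarrow> n choose 3 \<le> (4::nat) \<and> (n choose 3 = 4 \<longrightarrow> n = 4)"
proof -
  assume "n \<le> 4"
  then have "n = 0 \<or> n = 1 \<or> n = 2 \<or> n = 3 \<or> n = 4" by linarith
  then show ?thesis by (auto simp: numeral_eq_Suc)
qed

text \<open>With few enough blocks, covering everything at least once forces exactness.\<close>

lemma exact_cover_if_card: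
  assumes C: "finite C" "\<And>Q. Q \<in> C \<Longrightarrow> finite Q \<and> card Q \<le> 4"
    and TT: "\<And>T. T \<in> TT \<Longrightarrow> card T = 3 \<and> (\<exists>Q\<in>C. T \<subseteq> Q)"
    and le: "4 * card C \<le> card TT"
  shows "exact_cover C TT"
proof -
  let ?U = "\<Union>Q\<in>C. triples Q"
  have c4: "card (triples Q) \<le> 4" if "Q \<in> C" for Q
    using C(2)[OF that] by (simp add: card_triples choose_3_le_4)
  have finU: "finite ?U" using C by (auto intro: finite_triples)
  have sub: "TT \<subseteq> ?U" using TT by (fastforce simp: triples_def)
  have 1: "card TT \<le> card ?U" using sub finU by (rule card_mono[rotated])
  have 2: "card ?U \<le> (\<Sum>Q\<in>C. card (triples Q))" by (rule card_UN_le[OF C(1)])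
  have 3: "(\<Sum>Q\<in>C. card (triples Q)) \<le> (\<Sum>Q\<in>C. 4)" by (rule sum_mono[OF c4])
  have 4: "(\<Sum>Q\<in>C. 4::nat) = 4 * card C" by simp
  have eqU: "TT = ?U" using card_subset_eq[OF finU sub] 1 2 3 4 le by linarith
  have eqs: "(\<Sum>Q\<in>C. card (triples Q)) = (\<Sum>Q\<in>C. 4)" using 1 2 3 4 le by linarith
  have card4: "card (triples Q) = 4" if "Q \<in> C" for Q
  proof (rule ccontr)
    assume "card (triples Q) \<noteq> 4"
    then have "(\<Sum>Q\<in>C. card (triples Q)) < (\<Sum>Q\<in>C. 4)"
      using c4 that C(1) by (intro sum_strict_mono_ex1) (auto simp: order.strict_iff_order)
    then show False using eqs by simp
  qed
  have uniq: "Q = Q'" if "Q \<in> C" "Q' \<in> C" "T \<subseteq> Q" "T \<subseteq> Q'" "card T = 3" for Q Q' T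
  proof (rule ccontr)
    assume ne: "Q \<noteq> Q'"
    have T: "T \<in> triples Q" "T \<in> triples Q'" using that by (auto simp: triples_def)
    have "?U = (\<Union>Q\<in>C-{Q}. triples Q) \<union> (triples Q - {T})" using that T ne by auto
    then have "card ?U \<le> card (\<Union>Q\<in>C-{Q}. triples Q) + card (triples Q - {T})"
      by (metis card_Un_le)
    also have "card (\<Union>Q\<in>C-{Q}. triples Q) \<le> (\<Sum>Q\<in>C-{Q}. card (triples Q))"
      using C(1) by (intro card_UN_le) auto
    also have "(\<Sum>Q\<in>C-{Q}. card (triples Q)) = (\<Sum>Q\<in>C-{Q}. 4)" using card4 by simp
    also have "\<dots> = 4 * card C - 4" using that C(1) by simp
    also have "card (triples Q - {T}) = 3"
      using T card4[OF that(1)] C(2)[OF that(1)] by (simp add: finite_triples)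
    finally have U: "card ?U \<le> 4 * card C - 4 + 3" by simp
    have "card C > 0" using that(1) C(1) by (auto simp: card_gt_0_iff)
    then have "card ?U < 4 * card C" using U by linarith
    then show False using 1 le by linarith
  qed
  show ?thesis unfolding exact_cover_def
  proof (intro conjI ballI)
    fix Q assume Q: "Q \<in> C"
    show "card Q = 4" using card4[OF Q] C(2)[OF Q] by (simp add: card_triples choose_3_le_4)
    show "triples Q \<subseteq> TT" using eqU Q by auto
  next
    fix T assume T: "T \<in> TT"
    then show "card T = 3" using TT by auto
    show "\<exists>!Q. Q \<in> C \<and> T \<subseteq> Q" using TT[OF T] uniq by metis
  qed
qed

lemma in_triple_of_card_4:
  assumes "card Q = 4" "x \<in> Q"
  shows "\<exists>T\<in>triples Q. x \<in> T"
proof -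
  have "card (Q - {x}) = 3" using assms by simp
  then obtain a b c where abc: "Q - {x} = {a,b,c}" "a \<noteq> b" "b \<noteq> c" "a \<noteq> c"
    by (metis card_3_iff)
  then have "x \<noteq> a" "x \<noteq> b" "a \<in> Q" "b \<in> Q" by auto
  then have "{x,a,b} \<in> triples Q" using abc assms by (auto simp: triples_def)
  then show ?thesis by blast
qed

lemma exact_cover_subset:
  assumes "exact_cover C TT" "\<And>T. T \<in> TT \<Longrightarrow> T \<subseteq> X" "Q \<in> C"
  shows "Q \<subseteq> X"
proof
  fix x assume "x \<in> Q"
  then obtain T where "T \<in> triples Q" "x \<in> T"
    using in_triple_of_card_4 assms by (metis exact_cover_def)
  then show "x \<in> X" using assms unfolding exact_cover_def by blast
qed

lemma image_triples:
  assumes "inj_on h X"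
  shows "(`) h ` triples X = triples (h ` X)"
proof (intro equalityI subsetI)
  fix T assume "T \<in> (`) h ` triples X"
  then show "T \<in> triples (h ` X)" using assms
    by (auto simp: triples_def card_image inj_on_subset)
next
  fix T assume T: "T \<in> triples (h ` X)"
  then obtain U where U: "U \<subseteq> X" "T = h ` U" by (auto simp: triples_def subset_image_iff)
  then have "card U = 3" using T assms by (auto simp: triples_def card_image inj_on_subset)
  then show "T \<in> (`) h ` triples X" using U by (auto simp: triples_def)
qed

lemma exact_cover_image:
  assumes ec: "exact_cover C TT" and inj: "inj_on h X" and TT: "\<And>T. T \<in> TT \<Longrightarrow> T \<subseteq> X"
  shows "exact_cover ((`) h ` C) ((`) h ` TT)"
proof -
  have CX: "Q \<subseteq> X" if "Q \<in> C" for Q using exact_cover_subset[OF ec TT that] .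
  have card: "card (h ` A) = card A" if "A \<subseteq> X" for A
    using card_image inj inj_on_subset that by blast
  have 1: "card (h ` Q) = 4 \<and> triples (h ` Q) \<subseteq> (`) h ` TT" if Q: "Q \<in> C" for Q
  proof
    show "card (h ` Q) = 4" using card[OF CX[OF Q]] ec Q by (simp add: exact_cover_def)
    show "triples (h ` Q) \<subseteq> (`) h ` TT"
    proof
      fix T assume "T \<in> triples (h ` Q)"
      then obtain T' where T': "T' \<subseteq> Q" "T = h ` T'" "card T = 3"
        by (auto simp: triples_def subset_image_iff)
      then have "T' \<in> triples Q" using card[of T'] CX[OF Q] by (auto simp: triples_def)
      then show "T \<in> (`) h ` TT" using ec Q T' unfolding exact_cover_def by blast
    qed
  qed
  have 2: "card (h ` T) = 3 \<and> (\<exists>!Q. Q \<in> (`) h ` C \<and> h ` T \<subseteq> Q)" if T: "T \<in> TT" for T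
  proof
    show "card (h ` T) = 3" using card[OF TT[OF T]] ec T by (simp add: exact_cover_def)
    obtain Q where Q: "Q \<in> C" "T \<subseteq> Q" using ec T unfolding exact_cover_def by blast
    show "\<exists>!Q. Q \<in> (`) h ` C \<and> h ` T \<subseteq> Q"
    proof (rule ex1I[of _ "h ` Q"])
      show "h ` Q \<in> (`) h ` C \<and> h ` T \<subseteq> h ` Q" using Q by auto
      fix R assume "R \<in> (`) h ` C \<and> h ` T \<subseteq> R"
      then obtain Q' where Q': "Q' \<in> C" "R = h ` Q'" "h ` T \<subseteq> h ` Q'" by auto
      then have "T \<subseteq> Q'" 
        using inj_on_image_mem_iff[OF inj _ CX[OF Q'(1)]] TT[OF T] by blast
      then have "Q' = Q" using ec T Q Q' unfolding exact_cover_def by blast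
      then show "R = h ` Q" using Q' by simp
    qed
  qed
  show ?thesis unfolding exact_cover_def using 1 2 by auto
qed

text \<open>A block of \<open>C j\<close> that contains a triple of \<open>TT i\<close> puts this
  triple into \<open>TT j\<close> as well, so disjointness gives \<open>i = j\<close>.\<close>

lemma exact_cover_UN:
  assumes ec: "\<And>i. i \<in> I \<Longrightarrow> exact_cover (C i) (TT i)"
    and disj: "\<And>i j T. i \<in> I \<Longrightarrow> j \<in> I \<Longrightarrow> T \<in> TT i \<Longrightarrow> T \<in> TT j \<Longrightarrow> i = j"
  shows "exact_cover (\<Union>i\<in>I. C i) (\<Union>i\<in>I. TT i)"
  unfolding exact_cover_def
proof (intro conjI ballI)
  fix Q assume "Q \<in> (\<Union>i\<in>I. C i)"
  then show "card Q = 4" "triples Q \<subseteq> (\<Union>i\<in>I. TT i)" using ec unfolding exact_cover_def by blast+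
next
  fix T assume "T \<in> (\<Union>i\<in>I. TT i)"
  then obtain i where i: "i \<in> I" "T \<in> TT i" by blast
  show c3: "card T = 3" using ec[OF i(1)] i(2) unfolding exact_cover_def by blast
  obtain Q where Q: "Q \<in> C i" "T \<subseteq> Q" using ec[OF i(1)] i(2) unfolding exact_cover_def by blast
  show "\<exists>!Q. Q \<in> (\<Union>i\<in>I. C i) \<and> T \<subseteq> Q"
  proof (rule ex1I[of _ Q])
    show "Q \<in> (\<Union>i\<in>I. C i) \<and> T \<subseteq> Q" using Q i by blast
    fix R assume "R \<in> (\<Union>i\<in>I. C i) \<and> T \<subseteq> R"
    then obtain j where j: "j \<in> I" "R \<in> C j" "T \<subseteq> R" by blast
    then have "T \<in> TT j" using ec[OF j(1)] c3 unfolding exact_cover_def triples_def by blast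
    then have "i = j" using disj i j by blast
    then show "R = Q" using ec[OF i(1)] i(2) Q j unfolding exact_cover_def by blast
  qed
qed

lemma exact_cover_Un:
  assumes "exact_cover C TT" "exact_cover C' TT'" "TT \<inter> TT' = {}"
  shows "exact_cover (C \<union> C') (TT \<union> TT')"
proof -
  have "exact_cover (\<Union>b\<in>UNIV. if b then C else C') (\<Union>b\<in>UNIV. if b then TT else TT')"
    by (rule exact_cover_UN) (use assms in \<open>auto split: if_splits\<close>)
  then show ?thesis by (simp add: UNIV_bool Un_commute)
qed

section \<open>The step property on arbitrary point types\<close>

definition stepped :: "nat \<Rightarrow> 'a set set \<Rightarrow> (nat \<Rightarrow> 'a) \<Rightarrow> bool" where
  "stepped q C L \<longleftrightarrow>
     (\<forall>t < q div 2. \<forall>a < q. \<forall>b < q.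
        {L (2*t), L (2*t+1), L a, L b} \<in> C \<longrightarrow>
          ((a < 2*t \<and> b < 2*t) \<or> (a > 2*t+1 \<and> b > 2*t+1)))"

definition steppable :: "nat \<Rightarrow> bool" where
  "steppable q \<longleftrightarrow> (\<exists>S. exact_cover S (triples {0..<q}) \<and> stepped q S id)"

lemma is_SQS_if_exact_cover:
  assumes "exact_cover S (triples {0..<q})"
  shows "is_SQS q S"
proof -
  have "Q \<subseteq> {0..<q}" if "Q \<in> S" for Q
    using exact_cover_subset[OF assms _ that] by (auto simp: triples_def)
  then show ?thesis
    using assms unfolding exact_cover_def is_SQS_def B_def triples_def by auto
qed

text \<open>Naming each point by its position turns any order into the identity. The constructions
  can therefore live on pairs of a group index and a coordinate.\<close>

lemma steppableI:
  assumes L: "bij_betw L {0..<q} X" and ec: "exact_cover C (triples X)" and st: "stepped q C L"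
  shows "steppable q"
proof -
  let ?h = "the_inv_into {0..<q} L"
  have h: "bij_betw ?h X {0..<q}" using L by (rule bij_betw_the_inv_into)
  have hL: "?h (L i) = i" if "i < q" for i
    using L that by (simp add: bij_betw_def the_inv_into_f_f)
  have Lh: "L (?h x) = x" if "x \<in> X" for x
    using L that by (simp add: bij_betw_def f_the_inv_into_f)
  have inj: "inj_on ?h X" using h by (simp add: bij_betw_def)
  have CX: "Q \<subseteq> X" if "Q \<in> C" for Q
    using exact_cover_subset[OF ec _ that] by (auto simp: triples_def)
  have TT: "(`) ?h ` triples X = triples {0..<q}"
    using image_triples[OF inj] h by (simp add: bij_betw_def)
  have ec': "exact_cover ((`) ?h ` C) (triples {0..<q})"
    using exact_cover_image[OF ec inj] TT by (auto simp: triples_def)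
  have "stepped q ((`) ?h ` C) id" unfolding stepped_def
  proof (intro allI impI)
    fix t a b assume *: "t < q div 2" "a < q" "b < q" "{id (2*t), id (2*t+1), id a, id b} \<in> (`) ?h ` C"
    then obtain Q where Q: "Q \<in> C" "{2*t, 2*t+1, a, b} = ?h ` Q" by auto
    have "Q = L ` ?h ` Q" using CX[OF Q(1)] Lh by (force simp: image_iff)
    also have "\<dots> = {L (2*t), L (2*t+1), L a, L b}" unfolding Q(2)[symmetric] by simp
    finally have "{L (2*t), L (2*t+1), L a, L b} \<in> C" using Q by simp
    then show "a < 2*t \<and> b < 2*t \<or> a > 2*t+1 \<and> b > 2*t+1" using st * unfolding stepped_def by blast
  qed
  then show ?thesis using ec' unfolding steppable_def by blast
qed

section \<open>Candelabra systems\<close>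

text \<open>The point \<open>(i, a)\<close> is the \<open>a\<close>-th point of group \<open>i\<close>; the index 0 is reserved for the stem.\<close>

definition pts :: "nat set \<Rightarrow> nat \<Rightarrow> nat \<Rightarrow> (nat \<times> nat) set" where
  "pts I g s = {0} \<times> {..<s} \<union> I \<times> {..<g}"

definition ctriples :: "nat set \<Rightarrow> nat \<Rightarrow> nat \<Rightarrow> (nat \<times> nat) set set" where
  "ctriples I g s = {T \<in> triples (pts I g s). \<forall>i. \<not> T \<subseteq> pts {i} g s}"

lemma card_3_sorted:
  fixes f :: "'a \<Rightarrow> nat"
  assumes "card T = 3"
  obtains x y z where "T = {x,y,z}" "x \<noteq> y" "y \<noteq> z" "x \<noteq> z" "f x \<le> f y" "f y \<le> f z"
proof -
  obtain a b c where T: "T = {a,b,c}" "a \<noteq> b" "b \<noteq> c" "a \<noteq> c"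
    using assms by (metis card_3_iff)
  have "f a \<le> f b \<and> f b \<le> f c \<or> f a \<le> f c \<and> f c \<le> f b \<or> f b \<le> f a \<and> f a \<le> f c \<or>
        f b \<le> f c \<and> f c \<le> f a \<or> f c \<le> f a \<and> f a \<le> f b \<or> f c \<le> f b \<and> f b \<le> f a"
    by linarith
  then show ?thesis
  proof (elim disjE)
  qed (use T that in \<open>auto simp: insert_commute\<close>)
qed

text \<open>The three points are sorted by group index, which puts stem points first. Two stem
  points, or all three points over a single group, would place the triple inside the stem plus one
  group; three patterns remain.\<close>

lemma ctriples_cases [consumes 2, case_names stem two three]:
  assumes T: "T \<in> ctriples I g s" and I: "0 \<notin> I"
  obtains (stem) l i j a b where "T = {(0,l),(i,a),(j,b)}" "l < s" "i \<in> I" "j \<in> I" "i < j" "a < g" "b < g"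
  | (two) i j a a' b where "T = {(i,a),(i,a'),(j,b)}" "i \<in> I" "j \<in> I" "i \<noteq> j" "a < g" "a' < g" "a \<noteq> a'" "b < g"
  | (three) i j k a b c where "T = {(i,a),(j,b),(k,c)}" "i \<in> I" "j \<in> I" "k \<in> I" "i < j" "j < k" "a < g" "b < g" "c < g"
proof -
  have sub: "T \<subseteq> pts I g s" and c3: "card T = 3" and n: "\<And>i. \<not> T \<subseteq> pts {i} g s"
    using T by (auto simp: ctriples_def triples_def)
  obtain x y z where xyz: "T = {x,y,z}" "x \<noteq> y" "y \<noteq> z" "x \<noteq> z" "fst x \<le> fst y" "fst y \<le> fst z"
    using card_3_sorted[OF c3, of fst] .
  obtain i a j b k c where e: "x = (i,a)" "y = (j,b)" "z = (k,c)" by (metis surj_pair)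
  have le: "i \<le> j" "j \<le> k" using xyz e by auto
  have m: "(i,a) \<in> pts I g s" "(j,b) \<in> pts I g s" "(k,c) \<in> pts I g s" using sub xyz e by auto
  have "T \<subseteq> pts {k} g s" if "i = 0 \<or> i = k" "j = 0 \<or> j = k"
    unfolding xyz(1) e using that m I by (auto simp: pts_def)
  then have ne: "\<not> (j = 0)" "\<not> (i = 0 \<and> j = k)" "\<not> (i = j \<and> j = k)"
    using n[of k] le by auto
  consider "i = 0" "0 < j" "j < k" | "0 < i" "i = j" "j < k" | "0 < i" "i < j" "j = k" | "0 < i" "i < j" "j < k"
    using le ne by linarith
  then show ?thesis
  proof cases
    case 1 then show ?thesis using m I xyz(2,3) e by (intro stem[of a j b k c]) (auto simp: pts_def xyz(1))
  next
    case 2 then show ?thesis using m I xyz(2,3) e by (intro two[of i a b k c]) (auto simp: pts_def xyz(1))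
  next
    case 3 then show ?thesis using m I xyz(2,3) e by (intro two[of j b c i a]) (auto simp: pts_def xyz(1))
  next
    case 4 then show ?thesis using m I xyz(2,3) e by (intro three[of i a j b k c]) (auto simp: pts_def xyz(1))
  qed
qed

lemma ctriples_stemI:
  "l < s \<Longrightarrow> i \<in> I \<Longrightarrow> j \<in> I \<Longrightarrow> i \<noteq> j \<Longrightarrow> 0 \<notin> I \<Longrightarrow>
    a < g \<Longrightarrow> b < g \<Longrightarrow> {(0,l),(i,a),(j,b)} \<in> ctriples I g s"
  by (auto simp: ctriples_def triples_def pts_def card_insert_if)

lemma ctriples_twoI:
  "i \<in> I \<Longrightarrow> j \<in> I \<Longrightarrow> i \<noteq> j \<Longrightarrow> 0 \<notin> I \<Longrightarrow>
    a < g \<Longrightarrow> a' < g \<Longrightarrow> a \<noteq> a' \<Longrightarrow> b < g \<Longrightarrow> {(i,a),(i,a'),(j,b)} \<in> ctriples I g s"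
  by (auto simp: ctriples_def triples_def pts_def card_insert_if)

lemma ctriples_threeI:
  "i \<in> I \<Longrightarrow> j \<in> I \<Longrightarrow> k \<in> I \<Longrightarrow> i < j \<Longrightarrow> j < k \<Longrightarrow> 0 \<notin> I \<Longrightarrow>
    a < g \<Longrightarrow> b < g \<Longrightarrow> c < g \<Longrightarrow> {(i,a),(j,b),(k,c)} \<in> ctriples I g s"
  by (auto simp: ctriples_def triples_def pts_def card_insert_if)

lemma finite_pts: "finite I \<Longrightarrow> finite (pts I g s)"
  by (simp add: pts_def)

lemma card_pts: "finite I \<Longrightarrow> 0 \<notin> I \<Longrightarrow> card (pts I g s) = s + card I * g"
  unfolding pts_def by (subst card_Un_disjoint) (auto simp: card_cartesian_product)

lemma pts_empty: "pts {} g s = {0} \<times> {..<s}"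
  by (simp add: pts_def)

text \<open>The stem belongs to the set filled in for every group, so its triples are split off and
  counted once.\<close>

lemma triples_pts:
  assumes "0 \<notin> I"
  shows "triples (pts I g s) = ctriples I g s \<union> (triples (pts {} g s) \<union>
    (\<Union>i\<in>I. triples (pts {i} g s) - triples (pts {} g s)))" (is "?l = ?r")
proof (intro equalityI subsetI)
  fix T assume T: "T \<in> ?l"
  show "T \<in> ?r"
  proof (cases "\<exists>i. T \<subseteq> pts {i} g s")
    case True
    then obtain i where i: "T \<subseteq> pts {i} g s" ..
    have "T \<subseteq> pts {} g s \<or> i \<in> I" using i T assms by (fastforce simp: triples_def pts_def)
    then show ?thesis using i T by (auto simp: triples_def)
  next
    case False then show ?thesis using T by (auto simp: ctriples_def)
  qed
next
  fix T assume "T \<in> ?r"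
  then show "T \<in> ?l" by (auto simp: ctriples_def triples_def pts_def)
qed

lemma ctriples_disjoint:
  "ctriples I g s \<inter> (triples (pts {} g s) \<union>
    (\<Union>i\<in>I. triples (pts {i} g s) - triples (pts {} g s))) = {}"
proof -
  have "pts {} g s \<subseteq> pts {0} g s" by (auto simp: pts_def)
  then show ?thesis unfolding ctriples_def triples_def by blast
qed

lemma triples_group_inj:
  assumes "T \<in> triples (pts {i} g s) - triples (pts {} g s)"
    and "T \<in> triples (pts {j} g s) - triples (pts {} g s)"
  shows "i = j"
  using assms by (force simp: triples_def pts_def)

section \<open>Counting the triples of a candelabra system\<close>

text \<open>All triples are counted through \<open>triples_pts\<close>; the equation is arranged as
  sums to avoid truncated subtraction.\<close>

lemma card_ctriples:
  assumes I: "finite I" "0 \<notin> I"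
  shows "card (ctriples I g s) + card I * ((g + s) choose 3) + (s choose 3)
    = ((card I * g + s) choose 3) + card I * (s choose 3)"
proof -
  let ?S = "triples (pts {} g s)" and ?D = "\<lambda>i. triples (pts {i} g s) - triples (pts {} g s)"
  have fin: "finite (triples (pts J g s))" if "finite J" for J using that by (simp add: finite_triples finite_pts)
  have cS: "card ?S = s choose 3" by (simp add: card_triples pts_empty)
  have SD: "?S \<subseteq> triples (pts {i} g s)" for i by (auto simp: triples_def pts_def)
  have cD: "card (?D i) + (s choose 3) = (g + s) choose 3" if "i \<in> I" for i
  proof -
    have "i \<noteq> 0" using that I by metis
    then have "card (triples (pts {i} g s)) = (g + s) choose 3"
      using card_pts[of "{i}" g s] by (simp add: card_triples finite_pts add.commute)
    moreover have "card (?D i) = card (triples (pts {i} g s)) - card ?S"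
      using SD fin by (intro card_Diff_subset) auto
    moreover have "card ?S \<le> card (triples (pts {i} g s))" using SD fin by (intro card_mono) auto
    ultimately show ?thesis using cS by linarith
  qed
  have "card (\<Union>i\<in>I. ?D i) = (\<Sum>i\<in>I. card (?D i))"
    using I fin triples_group_inj by (intro card_UN_disjoint) blast+
  then have "card (\<Union>i\<in>I. ?D i) + card I * (s choose 3) = (\<Sum>i\<in>I. card (?D i) + (s choose 3))"
    by (simp add: sum.distrib)
  also have "\<dots> = card I * ((g + s) choose 3)" using cD by simp
  finally have U: "card (\<Union>i\<in>I. ?D i) + card I * (s choose 3) = card I * ((g + s) choose 3)" .
  have "card (triples (pts I g s)) = card (ctriples I g s) + card (?S \<union> (\<Union>i\<in>I. ?D i))"
    unfolding triples_pts[OF I(2)] using I fin ctriples_disjoint[of I g s]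
    by (intro card_Un_disjoint) (auto simp: ctriples_def intro: finite_subset[OF _ fin[OF I(1)]])
  also have "card (?S \<union> (\<Union>i\<in>I. ?D i)) = card ?S + card (\<Union>i\<in>I. ?D i)"
    using I fin by (intro card_Un_disjoint) auto
  finally have "(card I * g + s) choose 3 = card (ctriples I g s) + ((s choose 3) + card (\<Union>i\<in>I. ?D i))"
    using cS by (simp add: card_triples finite_pts card_pts I add.commute)
  then show ?thesis using U by linarith
qed

lemma image_triples_diff:
  assumes "inj_on h X" "Z \<subseteq> X"
  shows "(`) h ` (triples X - triples Z) = triples (h ` X) - triples (h ` Z)"
proof -
  have "inj_on ((`) h) (triples X)"
    by (rule inj_on_image, rule inj_on_subset[OF assms(1)]) (auto simp: triples_def)
  moreover have "triples Z \<subseteq> triples X" using assms(2) by (auto simp: triples_def)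
  ultimately have "(`) h ` (triples X - triples Z) = (`) h ` triples X - (`) h ` triples Z"
    by (intro inj_on_image_set_diff[of _ "triples X"]) auto
  then show ?thesis using image_triples assms by (metis inj_on_subset)
qed

section \<open>Filling the groups\<close>

text \<open>The first \<open>s\<close> points of the filling system become the stem, identically for
  every group; the others run through group \<open>i\<close> in the order given by
  \<open>p\<close>.\<close>

definition embed :: "(nat \<Rightarrow> nat) \<Rightarrow> nat \<Rightarrow> nat \<Rightarrow> nat \<Rightarrow> nat \<times> nat" where
  "embed p s i x = (if x < s then (0, x) else (i, p (x - s)))"

lemma embed_image_stem: "embed p s i ` {0..<s} = pts {} g s"
  by (auto simp: embed_def pts_def image_iff)

lemma embed_image:
  assumes "bij_betw p {0..<g} {0..<g}"
  shows "embed p s i ` {0..<g+s} = pts {i} g s"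
proof (intro equalityI subsetI)
  fix x assume "x \<in> embed p s i ` {0..<g+s}"
  then show "x \<in> pts {i} g s" using assms by (force simp: embed_def pts_def bij_betw_def split: if_splits)
next
  fix x assume "x \<in> pts {i} g s"
  then consider l where "x = (0,l)" "l < s" | a where "x = (i,a)" "a < g" by (auto simp: pts_def)
  then show "x \<in> embed p s i ` {0..<g+s}"
  proof cases
    case 1 then show ?thesis by (auto simp: embed_def image_iff intro!: bexI[of _ l])
  next
    case 2
    then have "a \<in> p ` {0..<g}" using assms by (simp add: bij_betw_def)
    then obtain b where "b < g" "p b = a" by auto
    then have "embed p s i (b + s) = x" "b + s < g + s" using 2 by (auto simp: embed_def)
    then show ?thesis by (metis atLeast0LessThan imageI lessThan_iff)
  qed
qed

lemma embed_inj:
  assumes "bij_betw p {0..<g} {0..<g}" "i \<noteq> 0"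
  shows "inj_on (embed p s i) {0..<g+s}"
proof (rule inj_onI)
  fix x y assume *: "x \<in> {0..<g+s}" "y \<in> {0..<g+s}" "embed p s i x = embed p s i y"
  have "inj_on p {0..<g}" using assms by (simp add: bij_betw_def)
  then have "x \<ge> s \<Longrightarrow> y \<ge> s \<Longrightarrow> p (x - s) = p (y - s) \<Longrightarrow> x - s = y - s"
    using * by (auto dest!: inj_onD)
  then show "x = y" using * assms(2) by (auto simp: embed_def split: if_splits)
qed

text \<open>\<open>closed\<close> says that \<open>Z\<close> carries a subsystem. Then any single
  triple of a block decides whether the whole block lies in \<open>Z\<close>, and the cover splits
  in two.\<close>

lemma exact_cover_restrict:
  assumes A: "exact_cover A (triples X)" and Z: "Z \<subseteq> X"
    and closed: "\<And>Q T. Q \<in> A \<Longrightarrow> T \<in> triples Q \<Longrightarrow> T \<subseteq> Z \<Longrightarrow> Q \<subseteq> Z"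
  shows "exact_cover {Q\<in>A. Q \<subseteq> Z} (triples Z)"
    and "exact_cover {Q\<in>A. \<not> Q \<subseteq> Z} (triples X - triples Z)"
proof -
  have un: "\<exists>!Q. Q \<in> A \<and> T \<subseteq> Q" if "T \<in> triples X" for T
    using A that unfolding exact_cover_def by blast
  have sub: "triples Z \<subseteq> triples X" using Z by (auto simp: triples_def)
  have cl: "Q \<subseteq> Z \<longleftrightarrow> T \<subseteq> Z" if "Q \<in> A" "T \<subseteq> Q" "card T = 3" for Q T
    using closed[OF that(1)] that by (auto simp: triples_def)
  have c: "card Q = 4 \<and> triples Q \<subseteq> triples X" if "Q \<in> A" for Q
    using A that unfolding exact_cover_def by blast
  show "exact_cover {Q\<in>A. Q \<subseteq> Z} (triples Z)" unfolding exact_cover_def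
  proof (intro conjI ballI)
    fix T assume T: "T \<in> triples Z"
    then show "card T = 3" by (simp add: triples_def)
    have "T \<in> triples X" "T \<subseteq> Z" "card T = 3" using T sub by (auto simp: triples_def)
    then show "\<exists>!Q. Q \<in> {Q\<in>A. Q \<subseteq> Z} \<and> T \<subseteq> Q" using un[of T] cl by (metis (no_types, lifting) mem_Collect_eq)
  qed (use c in \<open>auto simp: triples_def\<close>)
  show "exact_cover {Q\<in>A. \<not> Q \<subseteq> Z} (triples X - triples Z)" unfolding exact_cover_def
  proof (intro conjI ballI)
    fix T assume T: "T \<in> triples X - triples Z"
    then show "card T = 3" by (simp add: triples_def)
    have "T \<in> triples X" "\<not> T \<subseteq> Z" "card T = 3" using T sub by (auto simp: triples_def)
    then show "\<exists>!Q. Q \<in> {Q\<in>A. \<not> Q \<subseteq> Z} \<and> T \<subseteq> Q" using un[of T] cl by (metis (no_types, lifting) mem_Collect_eq)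
  next
    fix Q assume Q: "Q \<in> {Q\<in>A. \<not> Q \<subseteq> Z}"
    then show "card Q = 4" using c by blast
    show "triples Q \<subseteq> triples X - triples Z" using c[of Q] cl[of Q] Q by (auto simp: triples_def)
  qed
qed

definition filled :: "nat set \<Rightarrow> (nat \<Rightarrow> nat) \<Rightarrow> nat \<Rightarrow> (nat \<times> nat) set set \<Rightarrow> nat set set \<Rightarrow> (nat \<times> nat) set set" where
  "filled I p s C A = C \<union> (\<Union>i\<in>I. (`) (embed p s i) ` A)"

text \<open>All copies of \<open>A\<close> have the same blocks inside the stem. The other blocks of
  the copies cover pairwise disjoint families of triples, one for each group.\<close>

lemma exact_cover_filled:
  assumes C: "exact_cover C (ctriples I g s)" and I: "0 \<notin> I" "I \<noteq> {}"
    and A: "exact_cover A (triples {0..<g+s})" and p: "bij_betw p {0..<g} {0..<g}"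
    and closed: "\<And>Q T. Q \<in> A \<Longrightarrow> T \<in> triples Q \<Longrightarrow> T \<subseteq> {0..<s} \<Longrightarrow> Q \<subseteq> {0..<s}"
  shows "exact_cover (filled I p s C A) (triples (pts I g s))"
proof -
  let ?A0 = "{Q\<in>A. Q \<subseteq> {0..<s}}" and ?A1 = "{Q\<in>A. \<not> Q \<subseteq> {0..<s}}"
  note r = exact_cover_restrict[OF A _ closed]
  have A0: "exact_cover ?A0 (triples {0..<s})" by (rule r) auto
  have A1: "exact_cover ?A1 (triples {0..<g+s} - triples {0..<s})" by (rule r) auto
  have e0: "embed p s i ` {0..<s} = pts {} g s" for i by (rule embed_image_stem)
  have i0: "i \<noteq> 0" if "i \<in> I" for i using I that by metis
  have E1: "exact_cover ((`) (embed p s i) ` ?A1) (triples (pts {i} g s) - triples (pts {} g s))"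
    if "i \<in> I" for i
  proof -
    note inj = embed_inj[OF p i0[OF that], of s]
    have "exact_cover ((`) (embed p s i) ` ?A1) ((`) (embed p s i) ` (triples {0..<g+s} - triples {0..<s}))"
      by (rule exact_cover_image[OF A1 inj]) (auto simp: triples_def)
    then show ?thesis using image_triples_diff[OF inj, of "{0..<s}"] by (simp add: embed_image[OF p] e0)
  qed
  have E0: "exact_cover ((`) (embed p s i) ` ?A0) (triples (pts {} g s))" if "i \<in> I" for i
  proof -
    have inj: "inj_on (embed p s i) {0..<s}" by (rule inj_on_subset[OF embed_inj[OF p i0[OF that]]]) auto
    have "exact_cover ((`) (embed p s i) ` ?A0) ((`) (embed p s i) ` triples {0..<s})"
      by (rule exact_cover_image[OF A0 inj]) (auto simp: triples_def)
    then show ?thesis using image_triples[OF inj] by (simp add: e0)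
  qed
  have E0eq: "(`) (embed p s i) ` ?A0 = (`) (Pair 0) ` ?A0" for i
    by (rule image_cong[OF refl]) (auto simp: embed_def image_iff subset_eq)
  obtain i0 where "i0 \<in> I" using I by blast
  have "exact_cover (C \<union> ((`) (Pair 0) ` ?A0 \<union> (\<Union>i\<in>I. (`) (embed p s i) ` ?A1))) (triples (pts I g s))"
    unfolding triples_pts[OF I(1)]
  proof (intro exact_cover_Un exact_cover_UN C E1)
    show "exact_cover ((`) (Pair 0) ` ?A0) (triples (pts {} g s))" using E0[OF \<open>i0 \<in> I\<close>] E0eq by simp
  qed (use ctriples_disjoint[of I g s] triples_group_inj in blast)+
  moreover have "C \<union> ((`) (Pair 0) ` ?A0 \<union> (\<Union>i\<in>I. (`) (embed p s i) ` ?A1)) = filled I p s C A"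
  proof -
    have "(\<Union>i\<in>I. (`) (embed p s i) ` A) = (\<Union>i\<in>I. (`) (embed p s i) ` ?A0 \<union> (`) (embed p s i) ` ?A1)"
      by blast
    also have "\<dots> = (`) (Pair 0) ` ?A0 \<union> (\<Union>i\<in>I. (`) (embed p s i) ` ?A1)"
      unfolding E0eq using I(2) by blast
    finally show ?thesis by (simp add: filled_def)
  qed
  ultimately show ?thesis by simp
qed

text \<open>
  The permutation \<open>p\<close> of a group decides which of its points share a level: \<open>p (2 * j)\<close> and
  \<open>p (2 * j + 1)\<close>.
\<close>

definition fill_order :: "(nat \<Rightarrow> nat) \<Rightarrow> nat \<Rightarrow> nat \<Rightarrow> nat \<Rightarrow> nat \<times> nat" where
  "fill_order p g s x = (if x < s then (0, x) else ((x - s) div g + 1, p ((x - s) mod g)))"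

lemma fill_order_bij:
  assumes g: "g > 0" and p: "bij_betw p {0..<g} {0..<g}"
  shows "bij_betw (fill_order p g s) {0..<s+u*g} (pts {1..u} g s)"
proof -
  have pinj: "inj_on p {0..<g}" and pim: "p ` {0..<g} = {0..<g}" using p by (auto simp: bij_betw_def)
  have inj: "inj_on (fill_order p g s) {0..<s+u*g}"
  proof (rule inj_onI)
    fix x y assume *: "fill_order p g s x = fill_order p g s y"
    show "x = y"
    proof (cases "x < s \<or> y < s")
      case True then show ?thesis using * by (auto simp: fill_order_def split: if_splits)
    next
      case False
      then have d: "(x - s) div g = (y - s) div g" "p ((x - s) mod g) = p ((y - s) mod g)"
        using * by (auto simp: fill_order_def)
      then have "(x - s) mod g = (y - s) mod g" using pinj g by (auto dest!: inj_onD)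
      then have "x - s = y - s" using d by (metis div_mult_mod_eq)
      then show ?thesis using False by linarith
    qed
  qed
  have "fill_order p g s x \<in> pts {1..u} g s" if "x < s+u*g" for x
  proof (cases "x < s")
    case True then show ?thesis by (simp add: fill_order_def pts_def)
  next
    case False
    then have "x - s < u * g" using that by linarith
    then have "(x - s) div g < u" using g by (simp add: div_less_iff_less_mult)
    moreover have "p ((x - s) mod g) \<in> {0..<g}" using pim g by (metis atLeastLessThan_iff imageI mod_less_divisor zero_le)
    ultimately show ?thesis using False by (simp add: fill_order_def pts_def)
  qed
  then have sub: "fill_order p g s ` {0..<s+u*g} \<subseteq> pts {1..u} g s" by auto
  have "card (fill_order p g s ` {0..<s+u*g}) = s + u*g" using card_image[OF inj] by simp
  also have "\<dots> = card (pts {1..u} g s)" by (subst card_pts) auto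
  finally have "fill_order p g s ` {0..<s+u*g} = pts {1..u} g s"
    using card_subset_eq[OF _ sub] by (simp add: finite_pts)
  then show ?thesis using inj by (simp add: bij_betw_def)
qed

section \<open>Levels in a filled system\<close>

text \<open>Stem points have first coordinate 0 and so count as lying below every group, in
  accordance with \<open>fill_order\<close>.\<close>

definition level_ok :: "(nat \<Rightarrow> nat) \<Rightarrow> nat \<Rightarrow> (nat \<times> nat) set set \<Rightarrow> bool" where
  "level_ok p g C \<longleftrightarrow> (\<forall>i j x y. i \<noteq> 0 \<and> j < g div 2 \<and> {(i, p (2*j)), (i, p (2*j+1)), x, y} \<in> C \<longrightarrow>
     (fst x < i \<and> fst y < i) \<or> (fst x > i \<and> fst y > i))"

lemma candelabra_not_in_group:
  assumes C: "exact_cover C (ctriples I g s)" and Q: "{x,y,z,w} \<in> C" "card {x,y,z} = 3"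
  shows "\<not> {x,y,z} \<subseteq> pts {i} g s"
proof -
  have "{x,y,z} \<in> triples {x,y,z,w}" using Q by (auto simp: triples_def)
  then have "{x,y,z} \<in> ctriples I g s" using C Q unfolding exact_cover_def by blast
  then show ?thesis unfolding ctriples_def by blast
qed

text \<open>Since \<open>s\<close> and \<open>g\<close> are even, every level lies inside the stem
  or inside one group. Blocks of \<open>C\<close> are then governed by \<open>level_ok\<close>. A
  copy of \<open>A\<close> keeps its step property because its points appear in the final order as
  they do in \<open>A\<close>, and its levels remain levels.\<close>

lemma steppable_filled:
  assumes C: "exact_cover C (ctriples {1..u} g s)" and u: "u \<ge> 1" and g: "g > 0" "even g" and s: "even s"
    and p: "bij_betw p {0..<g} {0..<g}"
    and A: "exact_cover A (triples {0..<g+s})" "stepped (g+s) A id"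
    and closed: "\<And>Q T. Q \<in> A \<Longrightarrow> T \<in> triples Q \<Longrightarrow> T \<subseteq> {0..<s} \<Longrightarrow> Q \<subseteq> {0..<s}"
    and ok: "level_ok p g C"
  shows "steppable (s + u * g)"
proof (rule steppableI)
  let ?L = "fill_order p g s" and ?q = "s + u * g"
  \<comment> \<open>The final position of the point that is number \<open>x\<close> in the
    \<open>i\<close>-th copy of \<open>A\<close>.\<close>
  define pos where "pos i x = (if x < s then x else x + (i - 1) * g)" for i x :: nat
  show bij: "bij_betw ?L {0..<?q} (pts {1..u} g s)" using fill_order_bij g p by blast
  show "exact_cover (filled {1..u} p s C A) (triples (pts {1..u} g s))"
    using exact_cover_filled[OF C _ _ A(1) p closed] u by simp
  have AX: "Q \<subseteq> {0..<g+s}" if "Q \<in> A" for Q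
    using exact_cover_subset[OF A(1) _ that] by (auto simp: triples_def)
  have inj: "x = y" if "?L x = ?L y" "x < ?q" "y < ?q" for x y
    using bij that by (auto simp: bij_betw_def dest!: inj_onD)
  have Lin: "?L x \<in> pts {1..u} g s" if "x < ?q" for x
    using bij that by (auto simp: bij_betw_def)
  have emb: "embed p s i x = ?L (pos i x)" if "i \<in> {1..u}" "x < g + s" for i x
  proof (cases "x < s")
    case False
    then obtain y where "x = s + y" by (metis le_iff_add leI)
    then show ?thesis using that by (simp add: pos_def embed_def fill_order_def)
  qed (simp add: pos_def embed_def fill_order_def)
  have posq: "pos i x < ?q" if "i \<in> {1..u}" "x < g + s" for i x
  proof (cases "x < s")
    case False
    have "g + (i - 1) * g = i * g" using that by (cases i) auto
    also have "\<dots> \<le> u * g" using that by auto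
    finally show ?thesis using that False by (simp add: pos_def)
  qed (simp add: pos_def)
  have mono: "pos i x < pos i y" if "x < y" for i x y using that by (auto simp: pos_def)
  \<comment> \<open>As \<open>s\<close> is even, \<open>2*m\<close> and \<open>2*m+1\<close> are
    both below \<open>s\<close> or both at least \<open>s\<close>.\<close>
  have posSuc: "pos i (2*m+1) = pos i (2*m) + 1" for i m
  proof -
    have "2*m+1 < s \<longleftrightarrow> 2*m < s" using s by presburger
    then show ?thesis by (simp add: pos_def)
  qed
  have poseven: "even (pos i x) \<longleftrightarrow> even x" for i x using g by (simp add: pos_def)
  show "stepped ?q (filled {1..u} p s C A) ?L" unfolding stepped_def
  proof (intro allI impI)
    fix t a b
    assume t: "t < ?q div 2" and a: "a < ?q" and b: "b < ?q"
      and Q: "{?L (2*t), ?L (2*t+1), ?L a, ?L b} \<in> filled {1..u} p s C A"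
    have t': "2*t < ?q" "2*t+1 < ?q" using t by auto
    consider "{?L (2*t), ?L (2*t+1), ?L a, ?L b} \<in> C" |
      i R where "i \<in> {1..u}" "R \<in> A" "{?L (2*t), ?L (2*t+1), ?L a, ?L b} = embed p s i ` R"
      using Q unfolding filled_def by blast
    then show "a < 2*t \<and> b < 2*t \<or> a > 2*t+1 \<and> b > 2*t+1"
    proof cases
      case 1
      have c4: "card {?L (2*t), ?L (2*t+1), ?L a, ?L b} = 4" using C 1 unfolding exact_cover_def by blast
      then have c3: "card {?L (2*t), ?L (2*t+1), ?L a} = 3"
        by (auto simp: card_insert_if split: if_splits)
      have nin: "\<not> {?L (2*t), ?L (2*t+1), ?L a} \<subseteq> pts {i} g s" for i
        using candelabra_not_in_group[OF C 1 c3] .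
      \<comment> \<open>Two stem points and any third point lie in the stem plus one group, so no
        block of \<open>C\<close> contains a level of the stem.\<close>
      have ge: "2*t \<ge> s"
      proof (rule ccontr)
        assume "\<not> 2*t \<ge> s"
        then have "2*t < s" "2*t+1 < s" using s by presburger+
        then have "?L (2*t) = (0,2*t)" "?L (2*t+1) = (0,2*t+1)" by (auto simp: fill_order_def)
        then show False using nin[of "fst (?L a)"] Lin[OF a] \<open>2*t < s\<close> \<open>2*t+1 < s\<close>
          by (auto simp: pts_def)
      qed
      define i where "i = (2*t - s) div g + 1"
      have i1: "i \<ge> 1" by (simp add: i_def)
      define j where "j = ((2*t - s) mod g) div 2"
      have ev: "even ((2*t - s) mod g)" using s g by (simp add: dvd_mod_iff dvd_mod)
      have j2: "(2*t - s) mod g = 2*j" using ev by (simp add: j_def)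
      have jl: "j < g div 2" using mod_less_divisor[OF g(1), of "2*t-s"] j2 g(2) by (auto elim!: evenE)
      have dm: "2*t - s = (i - 1) * g + 2*j" using j2 by (metis i_def add_diff_cancel_right' div_mult_mod_eq)
      have L1: "?L (2*t) = (i, p (2*j))" using ge j2 by (simp add: fill_order_def i_def)
      have lt: "2*j+1 < g" using jl g(2) by (auto elim!: evenE)
      have dm1: "2*t+1 - s = (i - 1) * g + (2*j+1)" using dm ge by linarith
      have dv: "(m * g + r) div g = m" "(m * g + r) mod g = r" if "r < g" for m r using that by auto
      have "(2*t+1-s) div g = i - 1" "(2*t+1-s) mod g = 2*j+1" unfolding dm1 using dv[OF lt] by blast+
      then have L2: "?L (2*t+1) = (i, p (2*j+1))" using ge by (simp add: fill_order_def i_def)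
      have fst_lt: "x < 2*t" if "fst (?L x) < i" for x
      proof (cases "x < s")
        case False
        then have "(x - s) div g < (2*t - s) div g" using that by (simp add: fill_order_def i_def)
        then have "x - s < 2*t - s" by (meson div_le_mono leI not_le)
        then show ?thesis by linarith
      qed (use ge in linarith)
      have fst_gt: "x > 2*t+1" if "fst (?L x) > i" for x
      proof -
        have xs: "\<not> x < s" using that by (auto simp: fill_order_def)
        then have "fst (?L x) = (x - s) div g + 1" by (simp add: fill_order_def)
        then have "(x - s) div g > (2*t+1-s) div g"
          using that \<open>(2*t+1-s) div g = i - 1\<close> i1 by linarith
        then have "x - s > 2*t+1 - s" by (meson div_le_mono leI not_le)
        then show ?thesis by linarith
      qed
      have "(fst (?L a) < i \<and> fst (?L b) < i) \<or> (fst (?L a) > i \<and> fst (?L b) > i)"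
        using ok 1 jl unfolding level_ok_def L1 L2 using i1 by (metis not_one_le_zero)
      then show ?thesis using fst_lt fst_gt by blast
    next
      case 2
      have R: "R \<subseteq> {0..<g+s}" using AX 2 by blast
      have emR: "embed p s i ` R = ?L ` pos i ` R" unfolding image_image
        by (rule image_cong[OF refl]) (use R emb 2 in auto)
      have pre: "\<exists>x\<in>R. z = pos i x" if z: "?L z \<in> embed p s i ` R" "z < ?q" for z
      proof -
        obtain x where x: "x \<in> R" "?L z = ?L (pos i x)" using z(1) unfolding emR by blast
        then have "z = pos i x" using inj[OF x(2) z(2)] posq 2(1) R by auto
        then show ?thesis using x by blast
      qed
      obtain x1 x2 x3 x4 where x: "x1 \<in> R" "x2 \<in> R" "x3 \<in> R" "x4 \<in> R"
        "2*t = pos i x1" "2*t+1 = pos i x2" "a = pos i x3" "b = pos i x4"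
        using pre t' a b 2(3) by (metis insertI1 insertI2)
      \<comment> \<open>Positions keep their parity and adjacency, so this level of the final order
        comes from a level of \<open>A\<close>.\<close>
      have "even x1" using poseven[of i x1] x(5) by (metis dvd_triv_left)
      then obtain m where m: "x1 = 2*m" by (rule evenE)
      have "pos i x2 = pos i (2*m+1)" using posSuc x m by metis
      then have m2: "x2 = 2*m+1" using mono by (metis less_irrefl linorder_neqE_nat)
      have xn: "x1 < g+s" "x2 < g+s" "x3 < g+s" "x4 < g+s" using x(1-4) R by auto
      have "embed p s i ` R = embed p s i ` {x1,x2,x3,x4}"
        using 2(3) x emb[OF 2(1)] xn by simp
      moreover have "i \<noteq> 0" using 2(1) by auto
      ultimately have "R = {x1,x2,x3,x4}"
        using inj_on_image_eq_iff[OF embed_inj[OF p, of i s] R, of "{x1,x2,x3,x4}"] xn by simp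
      then have "{id (2*m), id (2*m+1), id x3, id x4} \<in> A" using 2(2) m m2 by simp
      moreover have "m < (g+s) div 2" using xn m m2 by linarith
      ultimately have "x3 < 2*m \<and> x4 < 2*m \<or> x3 > 2*m+1 \<and> x4 > 2*m+1"
        using A(2) xn unfolding stepped_def by blast
      then show ?thesis using mono[of _ _ i] x m m2 by metis
    qed
  qed
qed

text \<open>So four initial points can serve as a stem that is itself a block.\<close>

lemma first_block:
  assumes A: "exact_cover A (triples {0..<n})" "stepped n A id" and n: "n \<ge> 4"
  shows "{0..<4} \<in> A"
proof -
  \<comment> \<open>The block through 0 and the level \<open>{2,3}\<close> has a point below this
    level, so its fourth point is below 2 as well and must be 1.\<close>
  have "{0,2,3} \<in> triples {0..<n}" using n by (auto simp: triples_def)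
  then obtain Q where Q: "Q \<in> A" "{0,2,3} \<subseteq> Q" using A(1) unfolding exact_cover_def by blast
  have c: "card Q = 4" and QX: "Q \<subseteq> {0..<n}"
    using A(1) Q exact_cover_subset[OF A(1) _ Q(1)] by (auto simp: exact_cover_def triples_def)
  then have "card (Q - {0,2,3}) = 1" using Q(2) by (subst card_Diff_subset) auto
  then obtain w where w: "Q - {0,2,3} = {w}" by (metis card_1_singletonE)
  then have Qe: "Q = {2,3,0,w}" using Q(2) by blast
  have "w \<in> Q - {0,2,3}" using w by blast
  then have wn: "w \<noteq> 0" "w < n" using QX by auto
  have "1 < n div 2" using n by linarith
  then have "w < 2"
    using A(2)[unfolded stepped_def, rule_format, of 1 0 w] Q(1) Qe wn n by simp
  then have "w = 1" using wn by linarith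
  then have "Q = {0..<4}" using Qe by auto
  then show ?thesis using Q by simp
qed

section \<open>Blowing up a quadruple system\<close>

definition transversals :: "nat set \<Rightarrow> nat \<Rightarrow> (nat \<times> nat) set set" where
  "transversals X w = {(\<lambda>x. (x, f x)) ` X | f. (\<forall>x\<in>X. f x < w) \<and> w dvd (\<Sum>x\<in>X. f x)}"

lemma transversalsI:
  "\<forall>x\<in>X. f x < w \<Longrightarrow> w dvd (\<Sum>x\<in>X. f x) \<Longrightarrow> (\<lambda>x. (x, f x)) ` X \<in> transversals X w"
  by (auto simp: transversals_def)

text \<open>Any three coordinates determine the fourth as the residue that makes the sum divisible
  by \<open>w\<close>.\<close>

lemma exact_cover_transversals:
  assumes X: "card X = 4" and w: "w > 0"
  shows "exact_cover (transversals X w) {T. T \<subseteq> X \<times> {..<w} \<and> card T = 3 \<and> inj_on fst T}"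
  unfolding exact_cover_def
proof (intro conjI ballI)
  fix Q assume "Q \<in> transversals X w"
  then obtain f where f: "Q = (\<lambda>x. (x, f x)) ` X" "\<forall>x\<in>X. f x < w" by (auto simp: transversals_def)
  show "card Q = 4" unfolding f(1) using X by (subst card_image) (auto simp: inj_on_def)
  show "triples Q \<subseteq> {T. T \<subseteq> X \<times> {..<w} \<and> card T = 3 \<and> inj_on fst T}"
  proof
    fix T assume "T \<in> triples Q"
    then have T: "T \<subseteq> Q" "card T = 3" by (auto simp: triples_def)
    have "inj_on fst Q" unfolding f(1) by (auto simp: inj_on_def)
    then have "inj_on fst T" using T(1) by (rule inj_on_subset)
    moreover have "Q \<subseteq> X \<times> {..<w}" using f by auto
    ultimately show "T \<in> {T. T \<subseteq> X \<times> {..<w} \<and> card T = 3 \<and> inj_on fst T}" using T by blast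
  qed
next
  fix T assume "T \<in> {T. T \<subseteq> X \<times> {..<w} \<and> card T = 3 \<and> inj_on fst T}"
  then have T: "T \<subseteq> X \<times> {..<w}" "card T = 3" "inj_on fst T" by auto
  then show "card T = 3" by simp
  obtain x y z where xyz: "T = {x,y,z}" "x \<noteq> y" "y \<noteq> z" "x \<noteq> z" using T(2) by (metis card_3_iff)
  obtain i a j b k c where p: "x = (i,a)" "y = (j,b)" "z = (k,c)" by (metis surj_pair)
  then have e: "T = {(i,a),(j,b),(k,c)}" using xyz by simp
  have "fst x \<noteq> fst y" "fst y \<noteq> fst z" "fst x \<noteq> fst z"
    using inj_onD[OF T(3)] xyz by blast+
  then have d: "i \<noteq> j" "j \<noteq> k" "i \<noteq> k" using p by auto
  have m: "i \<in> X" "j \<in> X" "k \<in> X" "a < w" "b < w" "c < w" using T(1) e by auto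
  have "card (X - {i,j,k}) = 1" using X m d by (subst card_Diff_subset) auto
  then obtain l where l: "X - {i,j,k} = {l}" by (metis card_1_singletonE)
  then have Xe: "X = {i,j,k,l}" and ld: "l \<noteq> i" "l \<noteq> j" "l \<noteq> k" using m by auto
  \<comment> \<open>The outer \<open>mod w\<close> replaces \<open>w\<close> by 0 when the three
    coordinates already sum to a multiple of \<open>w\<close>.\<close>
  define r where "r = (w - (a+b+c) mod w) mod w"
  have r: "r < w" using w by (simp add: r_def)
  have rd: "w dvd a + b + c + r"
  proof -
    have "(a+b+c + r) mod w = ((a+b+c) mod w + (w - (a+b+c) mod w)) mod w"
      unfolding r_def by (simp only: mod_add_left_eq mod_add_right_eq)
    also have "(a+b+c) mod w + (w - (a+b+c) mod w) = w" using w by simp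
    finally show ?thesis by (simp add: mod_eq_0_iff_dvd)
  qed
  have ru: "r' = r" if "w dvd a + b + c + r'" "r' < w" for r'
  proof -
    have "w dvd r' - r" "w dvd r - r'" using dvd_diff_nat[OF that(1) rd] dvd_diff_nat[OF rd that(1)] by simp_all
    then have "\<not> 0 < r' - r" "\<not> 0 < r - r'"
      using dvd_imp_le[of w "r' - r"] dvd_imp_le[of w "r - r'"] that(2) r by linarith+
    then show ?thesis by linarith
  qed
  show "\<exists>!Q. Q \<in> transversals X w \<and> T \<subseteq> Q"
  proof (rule ex1I[of _ "{(i,a),(j,b),(k,c),(l,r)}"])
    let ?f = "\<lambda>x. if x = i then a else if x = j then b else if x = k then c else r"
    have im: "(\<lambda>x. (x, ?f x)) ` X = {(i,a),(j,b),(k,c),(l,r)}" unfolding Xe using d ld by auto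
    have sm: "(\<Sum>x\<in>X. ?f x) = a + b + c + r" unfolding Xe using d ld by (simp add: add.assoc)
    have lt: "\<forall>x\<in>X. ?f x < w" using m r by auto
    have "(\<lambda>x. (x, ?f x)) ` X \<in> transversals X w"
      by (rule transversalsI[OF lt rd[folded sm]])
    then show "{(i,a),(j,b),(k,c),(l,r)} \<in> transversals X w \<and> T \<subseteq> {(i,a),(j,b),(k,c),(l,r)}"
      unfolding im using e by blast
    fix Q assume Q: "Q \<in> transversals X w \<and> T \<subseteq> Q"
    then obtain f where f: "Q = (\<lambda>x. (x, f x)) ` X" "\<forall>x\<in>X. f x < w" "w dvd (\<Sum>x\<in>X. f x)"
      unfolding transversals_def by blast
    have v: "f i = a" "f j = b" "f k = c" using Q e f(1) by auto
    have "(\<Sum>x\<in>X. f x) = a + b + c + f l" unfolding Xe using d ld v by (simp add: add.assoc)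
    then have "f l = r" using ru f Xe by simp
    then show "Q = {(i,a),(j,b),(k,c),(l,r)}" using f(1) Xe v by simp
  qed
qed

lemma image_ctriples:
  assumes e: "inj_on e (insert 0 I)" "e 0 = 0" and I: "0 \<notin> I"
  shows "(`) (map_prod e id) ` ctriples I g s = ctriples (e ` I) g s"
proof (intro equalityI subsetI)
  have e0: "0 \<notin> e ` I" using e I by (auto simp: inj_on_def)
  have ne: "e i \<noteq> e j" if "i \<in> I" "j \<in> I" "i \<noteq> j" for i j using e that by (auto simp: inj_on_def)
  {
    fix T assume "T \<in> (`) (map_prod e id) ` ctriples I g s"
    then obtain U where U: "U \<in> ctriples I g s" "T = map_prod e id ` U" by auto
    show "T \<in> ctriples (e ` I) g s" using U(1) I
    proof (cases rule: ctriples_cases)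
      case (stem l i j a b)
      then show ?thesis using U(2) e e0 ne[of i j] by (auto intro!: ctriples_stemI)
    next
      case (two i j a a' b)
      then show ?thesis using U(2) e e0 ne[of i j] by (auto intro!: ctriples_twoI)
    next
      case (three i j k a b c)
      then have "e i \<noteq> e j" "e j \<noteq> e k" "e i \<noteq> e k" using ne by auto
      then show ?thesis using U(2) three e0 e
        by (auto simp: ctriples_def triples_def pts_def card_insert_if)
    qed
  next
    fix T assume T: "T \<in> ctriples (e ` I) g s"
    show "T \<in> (`) (map_prod e id) ` ctriples I g s" using T e0
    proof (cases rule: ctriples_cases)
      case (stem l i j a b)
      then obtain i' j' where ij: "i = e i'" "j = e j'" "i' \<in> I" "j' \<in> I" by auto
      then have "{(0,l),(i',a),(j',b)} \<in> ctriples I g s" using stem I by (intro ctriples_stemI) auto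
      moreover have "T = map_prod e id ` {(0,l),(i',a),(j',b)}" using ij stem e by simp
      ultimately show ?thesis by blast
    next
      case (two i j a a' b)
      then obtain i' j' where ij: "i = e i'" "j = e j'" "i' \<in> I" "j' \<in> I" by auto
      then have "{(i',a),(i',a'),(j',b)} \<in> ctriples I g s" using two I by (intro ctriples_twoI) auto
      moreover have "T = map_prod e id ` {(i',a),(i',a'),(j',b)}" using ij two e by simp
      ultimately show ?thesis by blast
    next
      case (three i j k a b c)
      then obtain i' j' k' where ij: "i = e i'" "j = e j'" "k = e k'" "i' \<in> I" "j' \<in> I" "k' \<in> I" by auto
      then have "{(i',a),(j',b),(k',c)} \<in> ctriples I g s"
        using three I by (auto simp: ctriples_def triples_def pts_def card_insert_if)
      moreover have "T = map_prod e id ` {(i',a),(j',b),(k',c)}" using ij three e by simp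
      ultimately show ?thesis by blast
    qed
  }
qed

text \<open>
  Hartman's fundamental construction. The point 0 of the quadruple system disappears into the stem,
  and \<open>sorted_list_of_set\<close> places the groups 0, 1, 2, 3 of \<open>C\<close> on the points of a block through 0,
  keeping the stem in place.
\<close>

definition spread :: "nat set set \<Rightarrow> nat \<Rightarrow> (nat \<times> nat) set set \<Rightarrow> (nat \<times> nat) set set" where
  "spread A w C = (\<Union>X\<in>A. if 0 \<in> X then (`) (map_prod ((!) (sorted_list_of_set X)) id) ` C
     else transversals X w)"

lemma sorted_list_of_block:
  assumes "card X = 4" "0 \<in> (X :: nat set)"
  obtains x y z where "X = {0,x,y,z}" "0 < x" "x < y" "y < z" "sorted_list_of_set X = [0,x,y,z]"
proof -
  have "card (X - {0}) = 3" using assms by simp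
  then obtain x y z where xyz: "X - {0} = {x,y,z}" "x \<noteq> y" "y \<noteq> z" "x \<noteq> z" "x \<le> y" "y \<le> z"
    using card_3_sorted[of "X - {0}" id] by auto
  have X: "X = {0,x,y,z}" using xyz(1) assms(2) by blast
  have "x \<in> X - {0}" using xyz(1) by blast
  then have o: "0 < x" "x < y" "y < z" using xyz(2-) by auto
  have "sorted_list_of_set X = [0,x,y,z]"
    using sorted_list_of_set.idem_if_sorted_distinct[of "[0,x,y,z]"] o by (simp add: X)
  then show ?thesis using that X o by blast
qed

lemma nth_sorted_block:
  fixes X :: "nat set"
  assumes "card X = 4" "0 \<in> X"
  defines "e \<equiv> (!) (sorted_list_of_set X)"
  shows "inj_on e (insert 0 {1..3})" "e 0 = 0" "e ` {1..3} = X - {0}"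
proof -
  obtain x y z where x: "X = {0,x,y,z}" "0 < x" "x < y" "y < z" "sorted_list_of_set X = [0,x,y,z]"
    using sorted_list_of_block[OF assms(1,2)] .
  have s: "{1..3} = {1,2,3::nat}" by auto
  show "inj_on e (insert 0 {1..3})" "e 0 = 0" "e ` {1..3} = X - {0}"
    unfolding e_def x(5) s using x by (auto simp: inj_on_def)
qed

text \<open>Every triple to be covered singles out a triple of the small system: its three group
  indices, or, if it meets only two groups, these two indices together with 0. The unique block of
  \<open>A\<close> through that triple is the one responsible.\<close>

lemma exact_cover_spread:
  assumes A: "exact_cover A (triples {0..<n})" and C: "exact_cover C (ctriples {1..3} w s)" and w: "w > 0"
  shows "exact_cover (spread A w C) (ctriples {1..<n} w s)"
proof -
  \<comment> \<open>The triples for which the block \<open>X\<close> is responsible.\<close>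
  define TT where "TT X = (if 0 \<in> X then ctriples (X - {0}) w s
    else {T. T \<subseteq> X \<times> {..<w} \<and> card T = 3 \<and> inj_on fst T})" for X
  have AX: "card X = 4" "X \<subseteq> {0..<n}" if "X \<in> A" for X
    using A exact_cover_subset[OF A _ that] that by (auto simp: exact_cover_def triples_def)
  have un: "X = Y" if "X \<in> A" "Y \<in> A" "T \<subseteq> X" "T \<subseteq> Y" "card T = 3" for X Y T
  proof -
    have "T \<in> triples {0..<n}" using that(3,5) AX(2)[OF that(1)] by (auto simp: triples_def)
    then show ?thesis using A that unfolding exact_cover_def by blast
  qed
  have ex: "\<exists>X\<in>A. T \<subseteq> X" if "T \<subseteq> {0..<n}" "card T = 3" for T
  proof -
    have "T \<in> triples {0..<n}" using that by (simp add: triples_def)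
    then show ?thesis using A unfolding exact_cover_def by blast
  qed
  have "exact_cover (spread A w C) (\<Union>X\<in>A. TT X)" unfolding spread_def
  proof (rule exact_cover_UN)
    fix X assume X: "X \<in> A"
    show "exact_cover (if 0 \<in> X then (`) (map_prod ((!) (sorted_list_of_set X)) id) ` C
     else transversals X w) (TT X)"
    proof (cases "0 \<in> X")
      case True
      let ?e = "(!) (sorted_list_of_set X)"
      note e = nth_sorted_block[OF AX(1)[OF X] True]
      have "inj_on (map_prod ?e id) (insert 0 {1..3} \<times> UNIV)"
        by (rule map_prod_inj_on[OF e(1)]) simp
      then have "exact_cover ((`) (map_prod ?e id) ` C) ((`) (map_prod ?e id) ` ctriples {1..3} w s)"
        by (rule exact_cover_image[OF C]) (auto simp: ctriples_def triples_def pts_def)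
      also have "(`) (map_prod ?e id) ` ctriples {1..3} w s = TT X"
        using image_ctriples[OF e(1,2)] True e(3) by (simp add: TT_def)
      finally show ?thesis using True by (simp only: if_True)
    next
      case False then show ?thesis using exact_cover_transversals[OF AX(1)[OF X] w] by (simp add: TT_def)
    qed
  next
    fix X Y T assume *: "X \<in> A" "Y \<in> A" "T \<in> TT X" "T \<in> TT Y"
    show "X = Y"
    proof (cases "0 \<in> X \<and> 0 \<in> Y")
      case True
      then have T: "T \<in> ctriples (X - {0}) w s" "T \<in> ctriples (Y - {0}) w s" using * by (auto simp: TT_def)
      have nz: "0 \<notin> X - {0}" by simp
      show ?thesis using T(1) nz
      proof (cases rule: ctriples_cases)
        case (stem l i j a b)
        have "i \<in> Y" "j \<in> Y" using T(2) stem by (auto simp: ctriples_def triples_def pts_def)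
        then show ?thesis using un[OF *(1,2), of "{0,i,j}"] True stem by auto
      next
        case (two i j a a' b)
        have "i \<in> Y" "j \<in> Y" using T(2) two by (auto simp: ctriples_def triples_def pts_def)
        then show ?thesis using un[OF *(1,2), of "{0,i,j}"] True two by auto
      next
        case (three i j k a b c)
        have "i \<in> Y" "j \<in> Y" "k \<in> Y" using T(2) three by (auto simp: ctriples_def triples_def pts_def)
        then show ?thesis using un[OF *(1,2), of "{i,j,k}"] three by auto
      qed
    next
      case False
      then have T: "card T = 3" "inj_on fst T" "0 \<notin> fst ` T" using * by (auto simp: TT_def)
      have "fst ` T \<subseteq> X" "fst ` T \<subseteq> Y" using * T(3)
        by (force simp: TT_def ctriples_def triples_def pts_def split: if_splits)+
      then show ?thesis using un[OF *(1,2), of "fst ` T"] T by (simp add: card_image)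
    qed
  qed
  moreover have "(\<Union>X\<in>A. TT X) = ctriples {1..<n} w s"
  proof (intro equalityI subsetI)
    fix T assume "T \<in> (\<Union>X\<in>A. TT X)"
    then obtain X where X: "X \<in> A" "T \<in> TT X" by blast
    note AX = AX[OF X(1)]
    show "T \<in> ctriples {1..<n} w s"
    proof (cases "0 \<in> X")
      case True
      then have "T \<subseteq> pts (X - {0}) w s" "T \<in> ctriples (X - {0}) w s"
        using X(2) by (auto simp: TT_def ctriples_def triples_def)
      moreover have "pts (X - {0}) w s \<subseteq> pts {1..<n} w s" using AX by (fastforce simp: pts_def)
      ultimately show ?thesis by (auto simp: ctriples_def triples_def)
    next
      case False
      then have T: "T \<subseteq> X \<times> {..<w}" "card T = 3" "inj_on fst T" using X(2) by (auto simp: TT_def)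
      have "x \<in> {1..<n}" if "x \<in> X" for x using that AX(2) False by (cases x) auto
      then have "T \<subseteq> pts {1..<n} w s" using T(1) unfolding pts_def by blast
      moreover have "\<not> T \<subseteq> pts {i} w s" for i
      proof
        assume "T \<subseteq> pts {i} w s"
        then have "z \<in> X \<times> {..<w} \<and> z \<in> pts {i} w s" if "z \<in> T" for z using that T(1) by blast
        then have "fst ` T \<subseteq> {i}" using False by (force simp: pts_def)
        then have "card (fst ` T) \<le> 1" using card_mono[of "{i}"] by simp
        then show False using T by (simp add: card_image)
      qed
      ultimately show ?thesis using T by (auto simp: ctriples_def triples_def)
    qed
  next
    fix T assume T: "T \<in> ctriples {1..<n} w s"
    have nz: "0 \<notin> {1..<n}" by simp
    show "T \<in> (\<Union>X\<in>A. TT X)" using T nz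
    proof (cases rule: ctriples_cases)
      case (stem l i j a b)
      then obtain X where X: "X \<in> A" "{0,i,j} \<subseteq> X" using ex[of "{0,i,j}"] by auto
      then have "T \<in> TT X" using stem unfolding TT_def by (auto intro!: ctriples_stemI)
      then show ?thesis using X by blast
    next
      case (two i j a a' b)
      then obtain X where X: "X \<in> A" "{0,i,j} \<subseteq> X" using ex[of "{0,i,j}"] by auto
      then have "T \<in> TT X" using two unfolding TT_def by (auto intro!: ctriples_twoI)
      then show ?thesis using X by blast
    next
      case (three i j k a b c)
      then obtain X where X: "X \<in> A" "{i,j,k} \<subseteq> X" using ex[of "{i,j,k}"] by auto
      then have "T \<in> TT X" using three unfolding TT_def by (auto intro!: ctriples_threeI simp: inj_on_def)
      then show ?thesis using X by blast
    qed
  qed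
  ultimately show ?thesis by simp
qed

text \<open>A transversal has no two points in one group, so only the copies of \<open>C\<close>
  matter. Relabelling groups preserves the fact that the other two points share a group index, and
  this index is not \<open>i\<close>, so they are on the same side.\<close>

lemma level_ok_spread:
  assumes A: "exact_cover A (triples {0..<n})" and C: "exact_cover C (ctriples {1..3} g s)" and g: "g > 0"
    and p: "bij_betw p {0..<g} {0..<g}"
    and ok: "\<And>i j x y. i \<noteq> 0 \<Longrightarrow> j < g div 2 \<Longrightarrow> {(i, p (2*j)), (i, p (2*j+1)), x, y} \<in> C \<Longrightarrow> fst x = fst y"
  shows "level_ok p g (spread A g C)"
  unfolding level_ok_def
proof (intro allI impI, elim conjE)
  fix i j :: nat and x y :: "nat \<times> nat"
  let ?Q = "{(i, p (2*j)), (i, p (2*j+1)), x, y}"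
  assume i: "i \<noteq> 0" and j: "j < g div 2" and Q: "?Q \<in> spread A g C"
  have j2: "2*j < g" "2*j+1 < g" using j by auto
  have pne: "p (2*j) \<noteq> p (2*j+1)"
    using inj_onD[OF bij_betw_imp_inj_on[OF p], of "2*j" "2*j+1"] j2 by auto
  have plt: "p (2*j) < g" "p (2*j+1) < g" using bij_betwE[OF p] j2 by auto
  have EC: "exact_cover (spread A g C) (ctriples {1..<n} g s)" using exact_cover_spread[OF A C g] .
  from Q obtain X where X: "X \<in> A" "?Q \<in> (if 0 \<in> X then (`) (map_prod ((!) (sorted_list_of_set X)) id) ` C
     else transversals X g)" unfolding spread_def by (rule UN_E)
  have "fst x = fst y"
  proof (cases "0 \<in> X")
    case True
    let ?e = "(!) (sorted_list_of_set X)"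
    have "card X = 4" using A X by (auto simp: exact_cover_def)
    note e = nth_sorted_block[OF this True]
    obtain R where R: "R \<in> C" "?Q = map_prod ?e id ` R" using X(2) True by auto
    have Rp: "R \<subseteq> insert 0 {1..3} \<times> UNIV"
      using exact_cover_subset[OF C _ R(1), of "pts {1..3} g s"] by (auto simp: ctriples_def triples_def pts_def)
    have im: "(i, p (2*j)) \<in> map_prod ?e id ` R" "(i, p (2*j+1)) \<in> map_prod ?e id ` R"
      "x \<in> map_prod ?e id ` R" "y \<in> map_prod ?e id ` R"
      unfolding R(2)[symmetric] by simp_all
    obtain i1 a1 where r1: "(i1,a1) \<in> R" "(i, p (2*j)) = map_prod ?e id (i1,a1)"
      using im(1) by (metis imageE surj_pair)
    obtain i2 a2 where r2: "(i2,a2) \<in> R" "(i, p (2*j+1)) = map_prod ?e id (i2,a2)"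
      using im(2) by (metis imageE surj_pair)
    obtain x' where r3: "x = map_prod ?e id x'" "x' \<in> R" using im(3) by (rule imageE)
    obtain y' where r4: "y = map_prod ?e id y'" "y' \<in> R" using im(4) by (rule imageE)
    note r = r1(1) r2(1) r3(2) r4(2) r1(2) r2(2) r3(1) r4(1)
    have a: "?e i1 = i" "?e i2 = i" "a1 = p (2*j)" "a2 = p (2*j+1)" using r(5,6) by auto
    have "i1 \<in> insert 0 {1..3}" "i2 \<in> insert 0 {1..3}" using r(1,2) Rp by auto
    then have i12: "i2 = i1" using inj_onD[OF e(1)] a by metis
    have injM: "inj_on (map_prod ?e id) (insert 0 {1..3} \<times> UNIV)"
      by (rule map_prod_inj_on[OF e(1)]) simp
    have sub: "{(i1,a1),(i2,a2),x',y'} \<subseteq> insert 0 {1..3} \<times> UNIV" using Rp r(1-4) by blast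
    have "map_prod ?e id ` R = map_prod ?e id ` {(i1,a1),(i2,a2),x',y'}"
      using R(2) r by simp
    then have "R = {(i1,a1),(i2,a2),x',y'}"
      using inj_on_image_eq_iff[OF injM Rp sub] by blast
    then have "{(i1,p (2*j)),(i1,p (2*j+1)),x',y'} \<in> C" using R(1) a i12 by simp
    moreover have "i1 \<noteq> 0" using a e(2) i by metis
    ultimately have "fst x' = fst y'" using ok j by blast
    then show ?thesis using r by (simp add: map_prod_def split: prod.splits)
  next
    case False
    then have "?Q \<in> transversals X g" using X by simp
    then obtain f where "?Q = (\<lambda>x. (x, f x)) ` X" unfolding transversals_def by blast
    then have "(i, p (2*j)) \<in> (\<lambda>x. (x, f x)) ` X" "(i, p (2*j+1)) \<in> (\<lambda>x. (x, f x)) ` X" by blast+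
    then show ?thesis using pne by auto
  qed
  \<comment> \<open>Otherwise three points of the block would lie in group \<open>i\<close>.\<close>
  moreover have "fst x \<noteq> i"
  proof
    assume xi: "fst x = i"
    have c4: "card ?Q = 4" using EC Q unfolding exact_cover_def by blast
    then have c3: "card {(i, p (2*j)), (i, p (2*j+1)), x} = 3" by (auto simp: card_insert_if split: if_splits)
    have "x \<in> pts {1..<n} g s" using exact_cover_subset[OF EC _ Q, of "pts {1..<n} g s"] by (auto simp: ctriples_def triples_def)
    then have "snd x < g" using xi i by (auto simp: pts_def)
    then show False using candelabra_not_in_group[OF EC Q c3, of i] xi plt by (cases x) (auto simp: pts_def)
  qed
  ultimately show "fst x < i \<and> fst y < i \<or> i < fst x \<and> i < fst y" by auto
qed

section \<open>One-factorizations\<close>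

text \<open>A perfect matching is represented by the fixed-point-free involution that sends each
  point to its partner.\<close>

definition matching :: "'a set \<Rightarrow> ('a \<Rightarrow> 'a) \<Rightarrow> bool" where
  "matching X m \<longleftrightarrow> (\<forall>x\<in>X. m x \<in> X \<and> m (m x) = x \<and> m x \<noteq> x)"

lemma card_matching:
  assumes "finite X" "matching X m"
  shows "2 * card ((\<lambda>x. {x, m x}) ` X) = card X"
proof -
  let ?E = "(\<lambda>x. {x, m x}) ` X"
  have "\<Union>?E = X" using assms(2) by (auto simp: matching_def)
  moreover have "2 * card ?E = card (\<Union>?E)"
  proof (rule card_partition)
    fix c c' assume "c \<in> ?E" "c' \<in> ?E" "c \<noteq> c'"
    then obtain x y where "c = {x, m x}" "c' = {y, m y}" "x \<in> X" "y \<in> X" by auto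
    moreover from this have "m (m x) = x" "m (m y) = y" using assms(2) by (auto simp: matching_def)
    ultimately have c: "c = {x, m x}" "c' = {y, m y}" "m (m x) = x" "m (m y) = y" by auto
    show "c \<inter> c' = {}"
    proof (rule ccontr)
      assume "c \<inter> c' \<noteq> {}"
      then have "x = y \<or> x = m y \<or> m x = y \<or> m x = m y" unfolding c(1,2) by blast
      then have "x = y \<or> x = m y" using c(3,4) by metis
      then show False using \<open>c \<noteq> c'\<close> c by auto
    qed
  qed (use assms \<open>\<Union>?E = X\<close> in \<open>auto simp: matching_def\<close>)
  ultimately show ?thesis by simp
qed

text \<open>The round-robin schedule: \<open>h = m - 1\<close> is odd, the point \<open>h\<close> is
  at infinity, and the other points are residues modulo \<open>h\<close>. The edge of
  \<open>x\<close> and \<open>y\<close> has colour \<open>x + y\<close>, the edge of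
  \<open>x\<close> and infinity has colour \<open>2 * x\<close>.\<close>

lemma one_factorization:
  fixes m :: nat
  assumes "even m" "m > 0"
  shows "\<exists>f. (\<forall>c<m-1. matching {..<m} (f c)) \<and> (\<forall>x<m. \<forall>y<m. x \<noteq> y \<longrightarrow> (\<exists>c<m-1. f c x = y))"
proof -
  define h where "h = m - 1"
  have h: "odd h" "m = h + 1" using assms by (auto simp: h_def)
  define f where "f c x = (if x = h then (if even c then c div 2 else (c + h) div 2)
    else if 2*x = c \<or> 2*x = c + h then h else if x \<le> c then c - x else c + h - x)" for c x :: nat
  have 1: "matching {..<m} (f c)" if "c < h" for c
    unfolding matching_def
  proof
    fix x assume "x \<in> {..<m}"
    then have "x \<le> h" using h by auto
    show "f c x \<in> {..<m} \<and> f c (f c x) = x \<and> f c x \<noteq> x"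
    proof (cases "x = h")
      case True
      then show ?thesis using that h by (auto simp: f_def elim!: evenE oddE)
    next
      case False
      then have x: "x < h" using \<open>x \<le> h\<close> by simp
      show ?thesis
      proof (cases "2*x = c \<or> 2*x = c + h")
        case True
        then have "f c x = h" using x by (simp add: f_def)
        moreover have "f c h = x"
        proof (cases "even c")
          case e: True
          then have "2*x \<noteq> c + h" using h(1) by (metis dvd_triv_left even_add)
          then have "c = 2*x" using True by simp
          then show ?thesis by (simp add: f_def)
        next
          case o: False
          then have "2*x = c + h" using True by auto
          then have "(c + h) div 2 = x" by simp
          then show ?thesis using o by (simp add: f_def)
        qed
        ultimately show ?thesis using x h by auto
      next
        case False
        then show ?thesis using x h that by (auto simp: f_def)
      qed
    qed
  qed
  have 2: "\<exists>c<h. f c x = y" if xy: "x < m" "y < m" "x \<noteq> y" for x y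
  proof -
    consider "y = h" "x < h" | "x = h" "y < h" | "x < h" "y < h" using xy h by linarith
    then show ?thesis
    proof cases
      case 1
      then show ?thesis by (intro exI[of _ "if 2*x < h then 2*x else 2*x - h"]) (auto simp: f_def)
    next
      case 2
      then show ?thesis using h
        by (intro exI[of _ "if 2*y < h then 2*y else 2*y - h"]) (auto simp: f_def elim!: oddE)
    next
      case 3
      then show ?thesis using xy(3)
        by (intro exI[of _ "if x + y < h then x + y else x + y - h"]) (auto simp: f_def)
    qed
  qed
  show ?thesis using 1 2 unfolding h_def by blast
qed

text \<open>The edges left out are those of odd cyclic distance below \<open>2*p\<close>. With
  \<open>m = g div 2\<close>, the odd distances kept give \<open>m - 2*p\<close> matchings. The even
  distances need \<open>m - 1\<close> more if \<open>m\<close> is even; if \<open>m\<close> is odd,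
  they are combined with distance \<open>m\<close>. Both cases total
  \<open>g - 1 - 2*p\<close>.\<close>

lemma partial_one_factorization:
  fixes g p :: nat
  assumes g: "even g" "4*p + 2 \<le> g"
  shows "\<exists>f. (\<forall>c<g-1-2*p. matching {..<g} (f c)) \<and>
    (\<forall>x<g. \<forall>y<g. x < y \<longrightarrow> even (y - x) \<or> (2*p < y - x \<and> y - x + 2*p < g) \<longrightarrow> (\<exists>c<g-1-2*p. f c x = y \<and> f c y = x))"
proof -
  obtain m where m: "g = 2*m" using g by (auto elim: evenE)
  \<comment> \<open>For each odd difference \<open>d\<close>, join every even \<open>x\<close> to
    the odd point \<open>x + d\<close> modulo \<open>g\<close>.\<close>
  define N where "N e x = (let d = 2*p+1+2*e in if even x then (if x + d < g then x + d else x + d - g)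
    else (if d \<le> x then x - d else x + g - d))" for e x :: nat
  have N: "matching {..<g} (N e)" if "e < m - 2*p" for e
    unfolding matching_def
  proof
    fix x assume x: "x \<in> {..<g}"
    define d where "d = 2*p+1+2*e"
    have d: "odd d" "d < g" "0 < d" using that m by (auto simp: d_def)
    show "N e x \<in> {..<g} \<and> N e (N e x) = x \<and> N e x \<noteq> x"
      using x d g(1) unfolding N_def Let_def d_def[symmetric] by auto
  qed
  have Nc: "\<exists>e<m-2*p. N e x = y \<and> N e y = x \<and> (2*p+1+2*e = m \<longrightarrow> y = x + m)"
    if "x < y" "y < g" "odd (y - x)" "2*p < y - x" "y - x + 2*p < g" for x y
  proof -
    \<comment> \<open>The difference is measured from the even endpoint to the odd one, modulo
      \<open>g\<close>.\<close>
    define d where "d = (if even x then y - x else g - (y - x))"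
    have "odd d" using that g(1) by (auto simp: d_def)
    moreover have "2*p + 1 \<le> d" "d + 2*p < g" using that by (auto simp: d_def)
    ultimately obtain e where e: "d = 2*p+1+2*e" using m
      by (metis add.commute even_add dvd_triv_left le_iff_add evenE odd_one)
    have em: "e < m - 2*p" using e \<open>d + 2*p < g\<close> m by linarith
    have "N e x = y \<and> N e y = x" unfolding N_def Let_def e[symmetric] using that g(1) by (auto simp: d_def)
    moreover have "d = m \<longrightarrow> y = x + m" using that m by (auto simp: d_def)
    ultimately show ?thesis using em e by auto
  qed
  show ?thesis
  proof (cases "even m")
    case True
    obtain f where f: "\<And>c. c < m - 1 \<Longrightarrow> matching {..<m} (f c)"
        "\<And>x y. x < m \<Longrightarrow> y < m \<Longrightarrow> x \<noteq> y \<Longrightarrow> \<exists>c<m-1. f c x = y"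
    proof -
      have "m > 0" using m g by linarith
      from one_factorization[OF True this] show ?thesis using that by blast
    qed
    \<comment> \<open>The even points and the odd points form two sets of even size
      \<open>m\<close>; both use the same one-factorization.\<close>
    define F where "F c x = (if c < m - 1 then 2 * f c (x div 2) + x mod 2 else N (c - (m - 1)) x)" for c x
    have "matching {..<g} (F c)" if "c < g - 1 - 2*p" for c
    proof (cases "c < m - 1")
      case True
      have "2 * f c (x div 2) + x mod 2 < g \<and> 2 * f c (f c (x div 2)) + x mod 2 = x \<and> 2 * f c (x div 2) + x mod 2 \<noteq> x"
        if "x < g" for x
      proof -
        have "f c (x div 2) < m \<and> f c (f c (x div 2)) = x div 2 \<and> f c (x div 2) \<noteq> x div 2"
          using f(1)[OF True] that m unfolding matching_def by auto
        moreover have "2 * (x div 2) + x mod 2 = x" by simp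
        moreover have "x mod 2 < 2" by simp
        ultimately show ?thesis using m by (intro conjI notI) linarith+
      qed
      then show ?thesis using True by (auto simp: matching_def F_def)
    next
      case False
      then have "c - (m - 1) < m - 2*p" using that m by linarith
      then show ?thesis using N False by (simp add: F_def[abs_def] matching_def)
    qed
    moreover have "\<exists>c<g-1-2*p. F c x = y \<and> F c y = x"
      if xy: "x < g" "y < g" "x < y" and d: "even (y - x) \<or> (2*p < y - x \<and> y - x + 2*p < g)" for x y
    proof (cases "even (y - x)")
      case True
      then have par: "x mod 2 = y mod 2" using xy by presburger
      then have "x div 2 \<noteq> y div 2" using xy by (metis div_mult_mod_eq less_irrefl)
      moreover have "x div 2 < m" "y div 2 < m" using xy m by auto
      ultimately obtain c where c: "c < m - 1" "f c (x div 2) = y div 2" using f(2) by blast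
      then have "f c (y div 2) = x div 2" using f(1)[OF c(1)] \<open>x div 2 < m\<close> unfolding matching_def by (metis lessThan_iff)
      then have "F c x = y \<and> F c y = x" using c par by (simp add: F_def, metis mult_div_mod_eq par)
      then show ?thesis using c m g by (intro exI[of _ c]) auto
    next
      case False
      then obtain e where e: "e < m - 2*p" "N e x = y" "N e y = x" using Nc[of x y] xy d by blast
      then show ?thesis using m g by (intro exI[of _ "m - 1 + e"]) (auto simp: F_def)
    qed
    ultimately show ?thesis by blast
  next
    case False
    \<comment> \<open>For odd \<open>m\<close> the even points alone have no perfect matching. The
      reflection \<open>x\<close> to \<open>2*c - x\<close> modulo \<open>g\<close> covers even
      distances, and its two fixed points \<open>c\<close> and \<open>c + m\<close> are joined,
      which uses up the odd distance \<open>m\<close>.\<close>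
    define R where "R c x = (if x = c then c + m else if x = c + m then c else if x \<le> 2*c then 2*c - x else 2*c + g - x)" for c x
    have R: "matching {..<g} (R c)" if "c < m" for c
      using that m by (auto simp: R_def matching_def)
    have Rc: "\<exists>c<m. R c x = y \<and> R c y = x" if "x < y" "y < g" "even (y - x) \<or> y = x + m" for x y
    proof (cases "y = x + m")
      case True then show ?thesis using that m by (intro exI[of _ x]) (auto simp: R_def)
    next
      case False
      then have "even (y - x)" using that by blast
      then have "even (x + y)" using that(1) by (simp add: add.commute)
      then obtain k where k: "x + y = 2*k" by (rule evenE)
      then show ?thesis using that m
        by (intro exI[of _ "if k < m then k else k - m"]) (auto simp: R_def)
    qed
    define e0 where "e0 = (m - 2*p - 1) div 2"
    have "2*p+1 \<le> m" using m g by linarith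
    moreover from this have "even (m - 2*p - 1)" using False by simp
    ultimately have e0: "2*p+1+2*e0 = m" by (simp add: e0_def)
    \<comment> \<open>Difference \<open>m\<close>, that is \<open>e0\<close>, is already covered by
      the reflections.\<close>
    define skip where "skip e = (if e < e0 then e else e + 1)" for e
    define F where "F c x = (if c < m then R c x else N (skip (c - m)) x)" for c x
    have "matching {..<g} (F c)" if "c < g - 1 - 2*p" for c
    proof (cases "c < m")
      case True then show ?thesis using R by (simp add: F_def[abs_def])
    next
      case c: False
      then have "skip (c - m) < m - 2*p" using that m e0 by (auto simp: skip_def)
      then show ?thesis using N c by (simp add: F_def[abs_def])
    qed
    moreover have "\<exists>c<g-1-2*p. F c x = y \<and> F c y = x"
      if xy: "x < g" "y < g" "x < y" and d: "even (y - x) \<or> (2*p < y - x \<and> y - x + 2*p < g)" for x y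
    proof (cases "even (y - x) \<or> y = x + m")
      case True
      then obtain c where "c < m" "R c x = y" "R c y = x" using Rc xy by blast
      then show ?thesis using m g by (intro exI[of _ c]) (auto simp: F_def)
    next
      case no: False
      then obtain e where e: "e < m - 2*p" "N e x = y" "N e y = x" "e \<noteq> e0"
        using Nc[of x y] xy d e0 by blast
      then have "skip (if e < e0 then e else e - 1) = e" by (auto simp: skip_def)
      then show ?thesis using e m g e0
        by (intro exI[of _ "m + (if e < e0 then e else e - 1)"]) (auto simp: F_def)
    qed
    ultimately show ?thesis by blast
  qed
qed

section \<open>Three groups\<close>

definition md :: "nat \<Rightarrow> int \<Rightarrow> nat" where
  "md g z = nat (z mod int g)"

lemma md_less: "g > 0 \<Longrightarrow> md g z < g"
  by (simp add: md_def nat_less_iff)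

lemma md_eq: "a < g \<Longrightarrow> int g dvd z - int a \<Longrightarrow> md g z = a"
  by (simp add: md_def flip: mod_eq_dvd_iff)

lemma dvd_md: "g > 0 \<Longrightarrow> int g dvd z - int (md g z)"
  by (simp add: md_def flip: mod_eq_dvd_iff)

lemma int_choose_3: "6 * int (n choose 3) = int n * (int n - 1) * (int n - 2)"
proof (induction n)
  case (Suc n)
  have "2 * int (n choose 2) = int n * (int n - 1)"
    by (induction n) (auto simp: numeral_2_eq_2 algebra_simps)
  then show ?case using Suc by (simp add: numeral_3_eq_3 numeral_2_eq_2 algebra_simps)
qed simp

lemma int_card_ctriples:
  "6 * int (card (ctriples {1..u} g s)) + int u * (int (g+s) * (int (g+s) - 1) * (int (g+s) - 2)) + int s * (int s - 1) * (int s - 2)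
    = int (u*g+s) * (int (u*g+s) - 1) * (int (u*g+s) - 2) + int u * (int s * (int s - 1) * (int s - 2))"
proof -
  have "int (card (ctriples {1..u} g s)) + int u * int ((g + s) choose 3) + int (s choose 3)
    = int ((u * g + s) choose 3) + int u * int (s choose 3)"
    using card_ctriples[of "{1..u}" g s] by (simp flip: of_nat_add of_nat_mult)
  then have "6 * int (card (ctriples {1..u} g s)) + int u * (6 * int ((g + s) choose 3)) + 6 * int (s choose 3)
    = 6 * int ((u * g + s) choose 3) + int u * (6 * int (s choose 3))" by (simp add: algebra_simps)
  then show ?thesis unfolding int_choose_3 .
qed

text \<open>By type: \<open>3*s*g^2\<close> triples with a stem point, \<open>3*g^2*(g-1)\<close>
  with two points in one group, and \<open>g^3\<close> across the three groups.\<close>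

lemma card_ctriples_3:
  "int (card (ctriples {1..3} g s)) = 4 * int g ^ 3 - 3 * int g ^ 2 + 3 * int s * int g ^ 2"
  using int_card_ctriples[of 3 g s] by (simp add: algebra_simps power2_eq_square power3_eq_cube)

lemma card_ctriples_4:
  "int (card (ctriples {1..4} g s)) = 10 * int g ^ 3 - 6 * int g ^ 2 + 6 * int s * int g ^ 2"
  using int_card_ctriples[of 4 g s] by (simp add: algebra_simps power2_eq_square power3_eq_cube)

lemma exact_cover_ctriples_if_card:
  assumes "finite C" "\<And>Q. Q \<in> C \<Longrightarrow> finite Q \<and> card Q \<le> 4"
    and "\<And>T. T \<in> ctriples I g s \<Longrightarrow> \<exists>Q\<in>C. T \<subseteq> Q"
    and "4 * card C \<le> card (ctriples I g s)"
  shows "exact_cover C (ctriples I g s)"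
  using assms by (intro exact_cover_if_card) (auto simp: ctriples_def triples_def)

section \<open>Blocks from coloured edges\<close>

definition edges :: "nat \<Rightarrow> (nat \<Rightarrow> nat) \<Rightarrow> nat set set" where
  "edges g m = (\<lambda>x. {x, m x}) ` {..<g}"

text \<open>As in the classical doubling of quadruple systems, a block joins two edges of the same
  colour, one in each of two groups.\<close>

definition square_blocks :: "nat \<Rightarrow> nat \<Rightarrow> nat \<Rightarrow> nat \<Rightarrow> (nat \<Rightarrow> nat \<Rightarrow> nat) \<Rightarrow> (nat \<times> nat) set set" where
  "square_blocks g r i j f = (\<Union>c<r. (\<lambda>(e,e'). {i} \<times> e \<union> {j} \<times> e') ` (edges g (f c) \<times> edges g (f c)))"

lemma square_blocksE:
  assumes "Q \<in> square_blocks g r i j f"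
  obtains c x y where "c < r" "x < g" "y < g" "Q = {(i,x),(i,f c x),(j,y),(j,f c y)}"
  using assms by (auto simp: square_blocks_def edges_def)

lemma square_blocksI:
  assumes "c < r" "x < g" "y < g"
  shows "{(i,x),(i,f c x),(j,y),(j,f c y)} \<in> square_blocks g r i j f"
proof -
  have "{(i,x),(i,f c x),(j,y),(j,f c y)} = (\<lambda>(e,e'). {i} \<times> e \<union> {j} \<times> e') ({x, f c x}, {y, f c y})" by auto
  then show ?thesis using assms unfolding square_blocks_def edges_def by blast
qed

lemma finite_square_blocks: "finite (square_blocks g r i j f)"
  by (simp add: square_blocks_def edges_def)

text \<open>Every colour has \<open>g div 2\<close> edges in each of the two groups.\<close>

lemma card_square_blocks:
  assumes "\<And>c. c < r \<Longrightarrow> matching {..<g} (f c)"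
  shows "4 * card (square_blocks g r i j f) \<le> r * g ^ 2"
proof -
  have e: "2 * card (edges g (f c)) = g" if "c < r" for c
    using card_matching[OF _ assms[OF that]] by (simp add: edges_def)
  have "card (square_blocks g r i j f) \<le> (\<Sum>c<r. card ((\<lambda>(e,e'). {i} \<times> e \<union> {j} \<times> e') ` (edges g (f c) \<times> edges g (f c))))"
    unfolding square_blocks_def by (rule card_UN_le) simp
  also have "\<dots> \<le> (\<Sum>c<r. card (edges g (f c)) * card (edges g (f c)))"
  proof (rule sum_mono)
    fix c
    show "card ((\<lambda>(e,e'). {i} \<times> e \<union> {j} \<times> e') ` (edges g (f c) \<times> edges g (f c))) \<le> card (edges g (f c)) * card (edges g (f c))"
      using card_image_le[of "edges g (f c) \<times> edges g (f c)" "\<lambda>(e,e'). {i} \<times> e \<union> {j} \<times> e'"]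
      by (simp add: card_cartesian_product edges_def)
  qed
  finally have "4 * card (square_blocks g r i j f) \<le> 4 * (\<Sum>c<r. card (edges g (f c)) * card (edges g (f c)))"
    by (rule mult_le_mono2)
  also have "\<dots> = (\<Sum>c<r. (2 * card (edges g (f c))) * (2 * card (edges g (f c))))"
    by (simp add: sum_distrib_left mult.assoc mult.left_commute)
  also have "\<dots> = r * g ^ 2" using e by (simp add: power2_eq_square)
  finally show ?thesis .
qed

lemma square_blocks_cover:
  assumes "c < r" "x < g" "y < g"
  shows "\<exists>Q\<in>square_blocks g r i j f. {(i,x),(i,f c x),(j,y)} \<subseteq> Q" "\<exists>Q\<in>square_blocks g r j i f. {(i,x),(i,f c x),(j,y)} \<subseteq> Q"
proof -
  show "\<exists>Q\<in>square_blocks g r i j f. {(i,x),(i,f c x),(j,y)} \<subseteq> Q"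
    by (rule bexI[OF _ square_blocksI[OF assms]]) auto
  show "\<exists>Q\<in>square_blocks g r j i f. {(i,x),(i,f c x),(j,y)} \<subseteq> Q"
    by (rule bexI[OF _ square_blocksI[OF assms(1,3,2)]]) auto
qed

text \<open>Unlike \<open>level_ok\<close>, this survives the relabelling of groups performed by
  \<open>spread\<close>.\<close>

definition level_strong :: "(nat \<Rightarrow> nat) \<Rightarrow> nat \<Rightarrow> (nat \<times> nat) set set \<Rightarrow> bool" where
  "level_strong p g C \<longleftrightarrow> (\<forall>i j x y. i \<noteq> 0 \<longrightarrow> j < g div 2 \<longrightarrow>
     {(i, p (2*j)), (i, p (2*j+1)), x, y} \<in> C \<longrightarrow> fst x = fst y)"

lemma square_blocks_strong:
  assumes "{(i,a),(i,a'),x,y} \<in> square_blocks g r k l f" "k \<noteq> l" "card {(i,a),(i,a'),x,y} = 4"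
  shows "fst x = fst y"
proof -
  have d: "a \<noteq> a'" "x \<noteq> (i,a)" "x \<noteq> (i,a')" "y \<noteq> (i,a)" "y \<noteq> (i,a')"
    using card_4_distinct[OF assms(3)] by auto
  obtain u v u' v' where Q: "{(i,a),(i,a'),x,y} = {(k,u),(k,u'),(l,v),(l,v')}"
    using assms(1) by (rule square_blocksE) auto
  have m: "(i,a) \<in> {(k,u),(k,u'),(l,v),(l,v')}" "(i,a') \<in> {(k,u),(k,u'),(l,v),(l,v')}"
    "x \<in> {(k,u),(k,u'),(l,v),(l,v')}" "y \<in> {(k,u),(k,u'),(l,v),(l,v')}"
    unfolding Q[symmetric] by simp_all
  then consider "i = k" "{u,u'} = {a,a'}" | "i = l" "{v,v'} = {a,a'}"
    using d(1) assms(2) by auto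
  then show ?thesis
  proof cases
    case 1
    then have "(k,u) \<in> {(i,a),(i,a')}" "(k,u') \<in> {(i,a),(i,a')}" by auto
    then have "x \<in> {(l,v),(l,v')}" "y \<in> {(l,v),(l,v')}" using m(3,4) d by auto
    then show ?thesis by auto
  next
    case 2
    then have "(l,v) \<in> {(i,a),(i,a')}" "(l,v') \<in> {(i,a),(i,a')}" by auto
    then have "x \<in> {(k,u),(k,u')}" "y \<in> {(k,u),(k,u')}" using m(3,4) d by auto
    then show ?thesis by auto
  qed
qed

text \<open>
  A transversal triple with coordinate sum \<open>6p + l\<close> is completed by the stem point \<open>l\<close>. The other sums
  form three intervals of length \<open>2p\<close>, one for each group \<open>i\<close>; inside an interval opposite sums are paired,
  which completes the triple by a second point of group \<open>i\<close> at an odd distance below \<open>2p\<close>. All remaining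
  pairs of a group are matched with those of the next group along the colours of a
  one-factorization. Points at cyclic distance \<open>2p + 1\<close> share a level.
\<close>

lemma tripling:
  assumes g: "g = 6*p + s" and s: "even s" "s \<ge> 2"
  shows "\<exists>C q. exact_cover C (ctriples {1..3} g s) \<and> bij_betw q {0..<g} {0..<g} \<and> level_strong q g C"
proof -
  have g0: "g > 0" "even g" "4*p+2 \<le> g" using g s by auto
  define r where "r = g - 1 - 2*p"
  obtain f where f: "\<And>c. c < r \<Longrightarrow> matching {..<g} (f c)"
    and fc: "\<And>x y. x < y \<Longrightarrow> y < g \<Longrightarrow> even (y - x) \<or> (2*p < y - x \<and> y - x + 2*p < g) \<Longrightarrow> \<exists>c<r. f c x = y \<and> f c y = x"
  proof -
    from partial_one_factorization[OF g0(2,3)] obtain f where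
      1: "\<forall>c<g-1-2*p. matching {..<g} (f c)" and
      2: "\<forall>x<g. \<forall>y<g. x < y \<longrightarrow> even (y - x) \<or> (2*p < y - x \<and> y - x + 2*p < g) \<longrightarrow> (\<exists>c<g-1-2*p. f c x = y \<and> f c y = x)"
      by blast
    show ?thesis
    proof (rule that[of f])
      fix x y assume "x < y" "y < g" "even (y - x) \<or> (2*p < y - x \<and> y - x + 2*p < g)"
      then show "\<exists>c<r. f c x = y \<and> f c y = x" using 2[rule_format, of x y] unfolding r_def by simp
    qed (use 1 in \<open>simp add: r_def\<close>)
  qed
  define S where "S = (\<lambda>(l,a,b). {(0::nat,l),(1,a),(2,b),(3, md g (int (6*p+l) - int a - int b))}) ` ({..<s} \<times> {..<g} \<times> {..<g})"
  \<comment> \<open>Completing either point of group \<open>i\<close> by \<open>b\<close> and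
    \<open>c\<close> gives the coordinate sums \<open>2*p*(i-1) + p - 1 - d\<close> and
    \<open>2*p*(i-1) + p + d\<close>, which are opposite in the \<open>i\<close>-th interval. The
    two points differ by \<open>2*d + 1\<close>.\<close>
  define D where "D i j k = (\<lambda>(d,b,c). {(i, md g (int (2*p*(i-1)+p) - 1 - int d - int b - int c)),
      (i, md g (int (2*p*(i-1)+p) + int d - int b - int c)), (j,b), (k,c)}) ` ({..<p} \<times> {..<g} \<times> {..<g})" for i j k :: nat
  let ?q = "square_blocks g r"
  define C where "C = S \<union> (D 1 2 3 \<union> D 2 3 1 \<union> D 3 1 2) \<union> (?q 1 2 f \<union> ?q 2 3 f \<union> ?q 3 1 f)"
  have finS: "finite S" and finD: "finite (D i j k)" for i j k by (auto simp: S_def D_def)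
  have finC: "finite C" unfolding C_def using finS finD finite_square_blocks by auto
  have c4: "finite Q \<and> card Q \<le> 4" if "Q \<in> C" for Q
  proof -
    have *: "finite {a,b,c,d} \<and> card {a,b,c,d} \<le> 4" for a b c d :: "nat \<times> nat"
      by (auto simp: card_insert_if)
    show ?thesis using that unfolding C_def S_def D_def by (auto elim!: square_blocksE simp: *)
  qed
  have cS: "card S \<le> s * g^2"
    unfolding S_def by (rule order_trans[OF card_image_le]) (auto simp: card_cartesian_product power2_eq_square)
  have cD: "card (D i j k) \<le> p * g^2" for i j k
    unfolding D_def by (rule order_trans[OF card_image_le]) (auto simp: card_cartesian_product power2_eq_square)
  have cQ: "4 * card (?q i j f) \<le> r * g^2" for i j by (rule card_square_blocks[OF f])
  have "card C \<le> card S + (card (D 1 2 3) + card (D 2 3 1) + card (D 3 1 2)) + (card (?q 1 2 f) + card (?q 2 3 f) + card (?q 3 1 f))"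
    unfolding C_def by (intro order_trans[OF card_Un_le] add_mono order_refl)
  then have "4 * card C \<le> 4 * (s * g^2) + 12 * (p * g^2) + 3 * (r * g^2)"
    using cS cD[of 1 2 3] cD[of 2 3 1] cD[of 3 1 2] cQ[of 1 2] cQ[of 2 3] cQ[of 3 1] by linarith
  then have "int (4 * card C) \<le> int (4 * (s * g^2) + 12 * (p * g^2) + 3 * (r * g^2))" by (simp only: of_nat_le_iff)
  also have "\<dots> = 4 * int s * int g ^ 2 + 12 * int p * int g^2 + 3 * int r * int g ^ 2" by simp
  also have "int r = int g - 1 - 2 * int p" using g0 by (simp add: r_def)
  also have "4 * int s * int g ^ 2 + 12 * int p * int g^2 + 3 * (int g - 1 - 2 * int p) * int g ^ 2
     = int (card (ctriples {1..3} g s))"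
  proof -
    \<comment> \<open>With this relation the block count
      \<open>4*s + 12*p + 3*(g - 1 - 2*p)\<close>, in units of \<open>g^2\<close>, becomes
      \<open>4*g - 3 + 3*s\<close>.\<close>
    have "6 * int p = int g - int s" using g by simp
    then have "6 * int p * int g ^ 2 = (int g - int s) * int g ^ 2" by simp
    then show ?thesis unfolding card_ctriples_3 by (simp add: algebra_simps power3_eq_cube power2_eq_square)
  qed
  finally have card: "4 * card C \<le> card (ctriples {1..3} g s)" by (simp only: of_nat_le_iff)
  have stemcov: "\<exists>Q\<in>C. {(0,l),(1,a),(2,b),(3,c)} \<subseteq> Q"
    if "l < s" "a < g" "b < g" "c < g" "int g dvd int (6*p+l) - int a - int b - int c" for l a b c
  proof -
    have "c = md g (int (6*p+l) - int a - int b)" using that by (intro md_eq[symmetric]) auto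
    then have "{(0,l),(1,a),(2,b),(3,c)} \<in> S" unfolding S_def using that by (intro image_eqI[of _ _ "(l,a,b)"]) auto
    then have "{(0,l),(1,a),(2,b),(3,c)} \<in> C" unfolding C_def by blast
    then show ?thesis by (rule rev_bexI) auto
  qed
  have Dcov: "{(i,x),(i,y),(j,b),(k,c)} \<in> D i j k"
    if "d < p" "x < g" "y < g" "b < g" "c < g" "int g dvd int (2*p*(i-1)+p) - 1 - int d - int b - int c - int x"
       "int g dvd int (2*p*(i-1)+p) + int d - int b - int c - int y" for i j k d x y b c
    using that md_eq[of x g] md_eq[of y g] unfolding D_def by (intro image_eqI[of _ _ "(d,b,c)"]) auto
  have Dcov2: "\<exists>Q\<in>D i j k. {(i,x),(i,y),(j,b)} \<subseteq> Q" "\<exists>Q\<in>D i j k. {(i,x),(i,y),(k,b)} \<subseteq> Q"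
    if "d < p" "x < g" "y < g" "b < g" "int g dvd int y - int x - 1 - 2 * int d" for i j k d x y b
  proof -
    let ?z = "int (2*p*(i-1)+p) - 1 - int d - int b - int x"
    define c where "c = md g ?z"
    have c: "c < g" "int g dvd ?z - int c" using md_less dvd_md g0 by (auto simp: c_def)
    have eq: "?z - int c - (int y - int x - 1 - 2 * int d) = int (2*p*(i-1)+p) + int d - int b - int c - int y" by simp
    have 2: "int g dvd int (2*p*(i-1)+p) + int d - int b - int c - int y"
      using dvd_diff[OF c(2) that(5)] by (simp only: eq)
    have 1: "int g dvd int (2*p*(i-1)+p) - 1 - int d - int b - int c - int x"
      using c(2) by (simp add: algebra_simps)
    show "\<exists>Q\<in>D i j k. {(i,x),(i,y),(j,b)} \<subseteq> Q" 
      by (rule rev_bexI[OF Dcov[OF that(1-4) c(1) 1 2]]) auto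
    have "{(i,x),(i,y),(j,c),(k,b)} \<in> D i j k"
      using that(1-4) c(1) 1 2 by (intro Dcov[of d]) (auto simp: algebra_simps)
    then show "\<exists>Q\<in>D i j k. {(i,x),(i,y),(k,b)} \<subseteq> Q" by (rule rev_bexI) auto
  qed
  have twocov: "\<exists>Q\<in>C. {(i,a),(i,a'),(j,b)} \<subseteq> Q"
    if ij: "i \<in> {1..3}" "j \<in> {1..3}" "i \<noteq> j" and ab: "a < a'" "a' < g" "b < g" for i j a a' b
  proof -
    have cyc: "(i,j) \<in> {(1,2),(2,3),(3,1),(2,1),(3,2),(1,3)}"
    proof -
      have "i = 1 \<or> i = 2 \<or> i = 3" "j = 1 \<or> j = 2 \<or> j = 3" using ij by auto
      then show ?thesis using ij(3) by (elim disjE) simp_all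
    qed
    show ?thesis
    proof (cases "even (a' - a) \<or> (2*p < a' - a \<and> a' - a + 2*p < g)")
      case True
      then obtain c where c: "c < r" "f c a = a'" using fc ab by blast
      then have "\<exists>Q\<in>?q i j f. {(i,a),(i,a'),(j,b)} \<subseteq> Q" "\<exists>Q\<in>?q j i f. {(i,a),(i,a'),(j,b)} \<subseteq> Q"
        using square_blocks_cover[OF c(1) less_trans[OF ab(1,2)] ab(3), where i=i and j=j and f=f] by (simp_all only: c(2))
      moreover have "?q i j f \<subseteq> C \<or> ?q j i f \<subseteq> C" using cyc unfolding C_def by auto
      ultimately show ?thesis by blast
    next
      case False
      then have o: "odd (a' - a)" "a' - a < 2*p \<or> g - (a' - a) < 2*p"
      proof -
        show o1: "odd (a' - a)" using False by blast
        have "a' - a \<noteq> 2*p" using o1 by (metis dvd_triv_left)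
        moreover have "g \<noteq> a' - a + 2*p" using o1 g0(2) by (metis dvd_triv_left even_add)
        moreover have "\<not> (2*p < a' - a \<and> a' - a + 2*p < g)" using False by blast
        ultimately show "a' - a < 2*p \<or> g - (a' - a) < 2*p" using ab by linarith
      qed
      \<comment> \<open>The pair is oriented so that \<open>y - x\<close> is the short odd distance
        \<open>2*d + 1\<close> modulo \<open>g\<close>.\<close>
      obtain x y d where xy: "d < p" "x < g" "y < g" "{x,y} = {a,a'}" "int g dvd int y - int x - 1 - 2 * int d"
      proof (cases "a' - a < 2*p")
        case True
        then obtain d where "a' - a = 2*d+1" "d < p" using o by (metis oddE less_mult_imp_div_less add_lessD1 nat_mult_less_cancel_disj mult.commute)
        moreover from this have "int a' - int a - 1 - 2 * int d = 0" using ab by linarith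
        ultimately show ?thesis using ab by (intro that[of d a a']) auto
      next
        case no: False
        have "odd (g - (a' - a))" using o g0 ab by simp
        then obtain d where d: "g - (a' - a) = 2*d+1" by (rule oddE)
        then have "d < p" using o no by linarith
        have "int a - int a' - 1 - 2 * int d = - int g" using d ab by linarith
        then show ?thesis using ab \<open>d < p\<close> by (intro that[of d a' a]) auto
      qed
      have "{(i,x),(i,y),(j,b)} = {(i,a),(i,a'),(j,b)}" using xy(4) by (auto simp: doubleton_eq_iff)
      then have cov: "\<exists>Q\<in>D i j k. {(i,a),(i,a'),(j,b)} \<subseteq> Q" "\<exists>Q\<in>D i k j. {(i,a),(i,a'),(j,b)} \<subseteq> Q" for k
        using Dcov2[OF xy(1-3) ab(3) xy(5), of i] by metis+
      obtain k where "D i j k \<subseteq> C \<or> D i k j \<subseteq> C"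
        using cyc unfolding C_def by auto
      then show ?thesis using cov[of k] by (meson subsetD)
    qed
  qed
  have threecov: "\<exists>Q\<in>C. {(1,a),(2,b),(3,c)} \<subseteq> Q" if abc: "a < g" "b < g" "c < g" for a b c
  proof -
    define sg where "sg = md g (int a + int b + int c)"
    have sg: "sg < g" "int g dvd int a + int b + int c - int sg" using md_less dvd_md g0 by (auto simp: sg_def)
    have sub: "\<exists>Q\<in>D i j k. {(i,x),(j,y),(k,z)} \<subseteq> Q"
      if "i \<ge> 1" "2*p*(i-1) \<le> sg" "sg < 2*p*(i-1) + 2*p" and xyz: "x < g" "y < g" "z < g" "int x + int y + int z = int a + int b + int c" for i j k x y z
    \<comment> \<open>In the lower half of the interval \<open>x\<close> is the first point of group
      \<open>i\<close> in a block of \<open>D\<close> and \<open>w\<close> the second; in the upper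
      half the roles are exchanged.\<close>
    proof (cases "sg < 2*p*(i-1) + p")
      case True
      define d where "d = 2*p*(i-1) + p - 1 - sg"
      have d: "d < p" "int d = int (2*p*(i-1)+p) - 1 - int sg" using True that by (auto simp: d_def)
      define w where "w = md g (int (2*p*(i-1)+p) + int d - int y - int z)"
      have w: "w < g" "int g dvd int (2*p*(i-1)+p) + int d - int y - int z - int w" using md_less dvd_md g0 by (auto simp: w_def)
      have "int (2*p*(i-1)+p) - 1 - int d - int y - int z - int x = - (int a + int b + int c - int sg)"
        using d(2) xyz by linarith
      then have "int g dvd int (2*p*(i-1)+p) - 1 - int d - int y - int z - int x" using sg(2) by (simp only: dvd_minus_iff)
      then have "{(i,x),(i,w),(j,y),(k,z)} \<in> D i j k" using d w xyz by (intro Dcov[of d]) auto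
      then show ?thesis by (rule rev_bexI) auto
    next
      case False
      define d where "d = sg - (2*p*(i-1) + p)"
      have d: "d < p" "int d = int sg - int (2*p*(i-1)+p)" using False that by (auto simp: d_def)
      define w where "w = md g (int (2*p*(i-1)+p) - 1 - int d - int y - int z)"
      have w: "w < g" "int g dvd int (2*p*(i-1)+p) - 1 - int d - int y - int z - int w" using md_less dvd_md g0 by (auto simp: w_def)
      have "int (2*p*(i-1)+p) + int d - int y - int z - int x = - (int a + int b + int c - int sg)"
        using d(2) xyz by linarith
      then have "int g dvd int (2*p*(i-1)+p) + int d - int y - int z - int x" using sg(2) by (simp only: dvd_minus_iff)
      then have "{(i,w),(i,x),(j,y),(k,z)} \<in> D i j k" using d w xyz by (intro Dcov[of d]) auto
      then show ?thesis by (rule rev_bexI) auto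
    qed
    consider "sg < 2*p" | "2*p \<le> sg" "sg < 4*p" | "4*p \<le> sg" "sg < 6*p" | "6*p \<le> sg" by linarith
    then show ?thesis
    proof cases
      case 1
      then have "\<exists>Q\<in>D 1 2 3. {(1,a),(2,b),(3,c)} \<subseteq> Q" using abc by (intro sub) auto
      then show ?thesis unfolding C_def by blast
    next
      case 2
      then have "\<exists>Q\<in>D 2 3 1. {(2,b),(3,c),(1,a)} \<subseteq> Q" using abc by (intro sub) auto
      then show ?thesis unfolding C_def by blast
    next
      case 3
      then have "\<exists>Q\<in>D 3 1 2. {(3,c),(1,a),(2,b)} \<subseteq> Q" using abc by (intro sub) auto
      then show ?thesis unfolding C_def by blast
    next
      case 4
      then obtain l where l: "sg = 6*p + l" "l < s" using sg(1) g by (metis le_iff_add nat_add_left_cancel_less)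
      have "int (6*p+l) - int a - int b - int c = - (int a + int b + int c - int sg)" using l by simp
      then have "int g dvd int (6*p+l) - int a - int b - int c" using sg(2) by (simp only: dvd_minus_iff)
      from stemcov[OF l(2) abc this] show ?thesis by blast
    qed
  qed
  have ec: "exact_cover C (ctriples {1..3} g s)"
  proof (rule exact_cover_ctriples_if_card[OF finC c4 _ card])
    fix T assume T: "T \<in> ctriples {1..3} g s"
    have nz: "0 \<notin> {1..3::nat}" by simp
    show "\<exists>Q\<in>C. T \<subseteq> Q" using T nz
    proof (cases rule: ctriples_cases)
      case (stem l i j a b)
      let ?c = "md g (int (6*p+l) - int a - int b)"
      have c: "?c < g" "int g dvd int (6*p+l) - int a - int b - int ?c" using md_less dvd_md g0 by auto
      consider "i = 1" "j = 2" | "i = 1" "j = 3" | "i = 2" "j = 3" using stem by force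
      then show ?thesis
      proof cases
        case 1
        then show ?thesis using stemcov[of l a b ?c] stem c by blast
      next
        case 2
        have "int g dvd int (6*p+l) - int a - int ?c - int b" using c(2) by (simp add: algebra_simps)
        then show ?thesis using stemcov[of l a ?c b] stem c 2 by blast
      next
        case 3
        have "int g dvd int (6*p+l) - int ?c - int a - int b" using c(2) by (simp add: algebra_simps)
        then show ?thesis using stemcov[of l ?c a b] stem c 3 by blast
      qed
    next
      case (two i j a a' b)
      have "{(i,a),(i,a'),(j,b)} = {(i,a'),(i,a),(j,b)}" by blast
      then show ?thesis using twocov[of i j a a' b] twocov[of i j a' a b] two by (metis linorder_neqE_nat)
    next
      case (three i j k a b c)
      then have "i = 1" "j = 2" "k = 3" by auto
      then show ?thesis using threecov three by blast
    qed
  qed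
  \<comment> \<open>Moving only the odd points, by \<open>2*p\<close>, puts \<open>2*j\<close> and
    \<open>2*j + 1 + 2*p\<close> on one level: the smallest odd distance that does not occur in
    \<open>D\<close>.\<close>
  define q where "q a = (if even a then a else (a + 2*p) mod g)" for a
  have qpar: "even (q a) \<longleftrightarrow> even a" for a using g0 by (simp add: q_def dvd_mod_iff)
  have qinj: "inj_on q {0..<g}"
  proof (rule inj_onI)
    fix x y assume *: "x \<in> {0..<g}" "y \<in> {0..<g}" "q x = q y"
    then have "even x \<longleftrightarrow> even y" using qpar by metis
    then consider "x = y" | "(x + 2*p) mod g = (y + 2*p) mod g" using *(3) by (auto simp: q_def)
    then show "x = y"
    proof cases
      case 2
      have "(if x + 2*p < g then x + 2*p else x + 2*p - g) = (x + 2*p) mod g"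
        "(if y + 2*p < g then y + 2*p else y + 2*p - g) = (y + 2*p) mod g"
        using * g0 by (auto simp: mod_if)
      then show ?thesis using 2 * by (auto split: if_splits)
    qed
  qed
  have "q ` {0..<g} \<subseteq> {0..<g}" using g0 by (auto simp: q_def)
  then have qbij: "bij_betw q {0..<g} {0..<g}" using qinj by (simp add: bij_betw_def endo_inj_surj)
  have "level_strong q g C" unfolding level_strong_def
  proof (intro allI impI)
    fix i j x y assume i: "i \<noteq> 0" and j: "j < g div 2" and Q: "{(i, q (2*j)), (i, q (2*j+1)), x, y} \<in> C"
    define u v where "u = q (2*j)" and "v = q (2*j+1)"
    have uv: "u < g" "v < g" "u \<noteq> v"
      using j g0 inj_onD[OF qinj, of "2*j" "2*j+1"] bij_betwE[OF qbij] by (auto simp: u_def v_def)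
    have uvd: "int g dvd int v - int u - 1 - 2 * int p"
    proof -
      have "int v = (2 * int j + 1 + 2 * int p) mod int g" by (simp add: v_def q_def zmod_int algebra_simps)
      then have "int g dvd (2 * int j + 1 + 2 * int p) - int v" by (simp add: mod_eq_dvd_iff[symmetric])
      then have "int g dvd int v - (2 * int j + 1 + 2 * int p)" by (metis dvd_minus_iff minus_diff_eq)
      then show ?thesis by (simp add: u_def q_def algebra_simps)
    qed
    have Q': "{(i,u),(i,v),x,y} \<in> C" using Q by (simp add: u_def v_def)
    have Q4: "card {(i,u),(i,v),x,y} = 4" using ec Q' unfolding exact_cover_def by blast
    \<comment> \<open>Otherwise \<open>g\<close> would divide \<open>2*p - 2*d\<close> or
      \<open>2*p + 2*d + 2\<close>, but both are positive and at most
      \<open>4*p < g\<close>.\<close>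
    have noD: "{(i,u),(i,v),x,y} \<notin> D i' j' k'" if "i' \<noteq> j'" "j' \<noteq> k'" "i' \<noteq> k'" for i' j' k'
    proof
      assume "{(i,u),(i,v),x,y} \<in> D i' j' k'"
      then obtain d b c a a' where D: "d < p" "{(i,u),(i,v),x,y} = {(i',a),(i',a'),(j',b),(k',c)}"
        "a = md g (int (2*p*(i'-1)+p) - 1 - int d - int b - int c)" "a' = md g (int (2*p*(i'-1)+p) + int d - int b - int c)"
        unfolding D_def by auto
      have "int g dvd int (2*p*(i'-1)+p) - 1 - int d - int b - int c - int a" "int g dvd int (2*p*(i'-1)+p) + int d - int b - int c - int a'"
        unfolding D(3,4) by (rule dvd_md[OF g0(1)])+
      from dvd_diff[OF this] have aa: "int g dvd int a' - int a - 1 - 2 * int d" by (simp add: algebra_simps)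
      have "(i,u) \<in> {(i',a),(i',a'),(j',b),(k',c)}" "(i,v) \<in> {(i',a),(i',a'),(j',b),(k',c)}"
        unfolding D(2)[symmetric] by auto
      then have "u = a \<and> v = a' \<or> u = a' \<and> v = a" using uv that by auto
      then show False
      proof
        assume "u = a \<and> v = a'"
        then have "int g dvd 2 * int p - 2 * int d" using dvd_diff[OF aa uvd] by simp
        then show False using D(1) g s by (auto dest!: zdvd_imp_le)
      next
        assume "u = a' \<and> v = a"
        then have "int g dvd - (2 * int p + 2 * int d + 2)" using dvd_add[OF aa uvd] by (simp add: algebra_simps)
        then have "int g dvd 2 * int p + 2 * int d + 2" by (simp only: dvd_minus_iff)
        then show False using D(1) g s by (auto dest!: zdvd_imp_le)
      qed
    qed
    have noS: "{(i,u),(i,v),x,y} \<notin> S"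
    proof
      assume "{(i,u),(i,v),x,y} \<in> S"
      then obtain l a b c where S: "{(i,u),(i,v),x,y} = {(0,l),(1,a),(2,b),(3,c)}" unfolding S_def by auto
      have "(i,u) \<in> {(0,l),(1,a),(2,b),(3,c)}" "(i,v) \<in> {(0,l),(1,a),(2,b),(3,c)}" unfolding S[symmetric] by auto
      then show False using uv by auto
    qed
    have "{(i,u),(i,v),x,y} \<in> ?q 1 2 f \<union> ?q 2 3 f \<union> ?q 3 1 f" using Q' noS noD unfolding C_def by auto
    then show "fst x = fst y" using square_blocks_strong[OF _ _ Q4] by fastforce
  qed
  then show ?thesis using ec qbij by blast
qed

section \<open>Four groups\<close>

definition sum_edges :: "nat \<Rightarrow> int \<Rightarrow> nat set set" where
  "sum_edges g t = {{r, r'} | r r'. r < g \<and> r' < g \<and> r \<noteq> r' \<and> int g dvd int r + int r' + t}"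

text \<open>The pairs are the orbits of the reflection \<open>r\<close> to \<open>- t - r\<close>
  modulo \<open>g\<close>. For even \<open>t\<close> the reflection has two fixed points at distance
  \<open>k\<close>, which costs one pair.\<close>

lemma card_sum_edges:
  assumes g: "g = 2*k" "k > 0"
  shows "2 * card (sum_edges g t) \<le> g" "even t \<Longrightarrow> 2 * card (sum_edges g t) + 2 \<le> g"
proof -
  let ?m = "\<lambda>x. md g (- t - int x)"
  define X where "X = {x. x < g \<and> ?m x \<noteq> x}"
  have g0: "g > 0" using g by simp
  have m: "?m x < g" "int g dvd int x + int (?m x) + t" for x
  proof -
    show "?m x < g" by (rule md_less[OF g0])
    have "int g dvd - (- t - int x - int (?m x))" using dvd_md[OF g0, of "- t - int x"] by (simp only: dvd_minus_iff)
    then show "int g dvd int x + int (?m x) + t" by (simp add: algebra_simps)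
  qed
  have mu: "?m x = y" if "y < g" "int g dvd int x + int y + t" for x y
  proof (rule md_eq[OF that(1)])
    have "int g dvd - (int x + int y + t)" using that(2) by (simp only: dvd_minus_iff)
    then show "int g dvd - t - int x - int y" by (simp add: algebra_simps)
  qed
  have mm: "?m (?m x) = x" if "x < g" for x
    using mu[OF that] m(2)[of x] by (simp add: add.commute)
  have finX: "finite X" by (simp add: X_def)
  have mat: "matching X ?m" unfolding matching_def
  proof
    fix x assume "x \<in> X"
    then have x: "x < g" "?m x \<noteq> x" by (auto simp: X_def)
    then show "?m x \<in> X \<and> ?m (?m x) = x \<and> ?m x \<noteq> x" using mm[OF x(1)] m(1) unfolding X_def by auto
  qed
  have "sum_edges g t \<subseteq> (\<lambda>x. {x, ?m x}) ` X"
  proof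
    fix e assume "e \<in> sum_edges g t"
    then obtain r r' where e: "e = {r, r'}" "r < g" "r' < g" "r \<noteq> r'" "int g dvd int r + int r' + t"
      by (auto simp: sum_edges_def)
    then have "?m r = r'" using mu by blast
    then show "e \<in> (\<lambda>x. {x, ?m x}) ` X" using e by (intro image_eqI[of _ _ r]) (auto simp: X_def)
  qed
  then have "card (sum_edges g t) \<le> card ((\<lambda>x. {x, ?m x}) ` X)" using finX by (intro card_mono) auto
  then have le: "2 * card (sum_edges g t) \<le> card X" using card_matching[OF finX mat] by linarith
  have "card X \<le> card {..<g}" by (intro card_mono) (auto simp: X_def)
  then show "2 * card (sum_edges g t) \<le> g" using le by simp
  assume "even t"
  then obtain h where h: "t = 2*h" by (rule evenE)
  \<comment> \<open>A solution of \<open>2*u = - t\<close> modulo \<open>2*k\<close>; the other one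
    is \<open>u + k\<close>.\<close>
  define u where "u = md k (- h)"
  have u: "u < k" "int k dvd - h - int u" using md_less dvd_md g by (auto simp: u_def)
  then obtain n where n: "- h - int u = int k * n" by (auto elim: dvdE)
  have d1: "int g dvd int u + int u + t"
  proof
    show "int u + int u + t = int g * (- n)" using n h g by (simp add: algebra_simps)
  qed
  have d2: "int g dvd int (u+k) + int (u+k) + t"
  proof
    show "int (u+k) + int (u+k) + t = int g * (1 - n)" using n h g by (simp add: algebra_simps)
  qed
  have "?m u = u" by (rule mu[OF _ d1]) (use u g in simp)
  moreover have "?m (u+k) = u+k" by (rule mu[OF _ d2]) (use u g in simp)
  ultimately have "X \<subseteq> {..<g} - {u, u+k}" by (auto simp: X_def)
  then have "card X \<le> card ({..<g} - {u, u+k})" by (intro card_mono) auto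
  also have "\<dots> = g - 2" using u g by (subst card_Diff_subset) auto
  finally show "2 * card (sum_edges g t) + 2 \<le> g" using le g by linarith
qed

lemma sum_edgesI: "r < g \<Longrightarrow> r' < g \<Longrightarrow> r \<noteq> r' \<Longrightarrow> int g dvd int r + int r' + t \<Longrightarrow> {r, r'} \<in> sum_edges g t"
  by (auto simp: sum_edges_def)

lemma finite_sum_edges: "finite (sum_edges g t)"
  by (rule finite_subset[of _ "Pow {..<g}"]) (auto simp: sum_edges_def)

text \<open>
  \<open>half_pass\<close> consists of the blocks with one point in group \<open>x\<close>, one in group \<open>y\<close>
  and the rest in the stem or twice in one of \<open>z\<close>, \<open>z + 1\<close>. A point \<open>a < 2k\<close> has a residue modulo \<open>k\<close>
  and a bit \<open>a div k\<close>. The bits of \<open>a\<close> and \<open>b\<close> select the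
  group in which the pairs of even sum \<open>- 2(a + b)\<close> are used: they miss exactly two points, which go to
  the two stem points. In the other group the pairs of odd sum \<open>- 2(a + b) - 1\<close> miss nothing. The
  offset \<open>h\<close> makes the stem blocks of the two passes complementary.
\<close>

definition stem_block :: "nat \<Rightarrow> nat \<Rightarrow> nat \<Rightarrow> nat \<Rightarrow> nat \<Rightarrow> nat \<times> nat \<times> nat \<Rightarrow> (nat \<times> nat) set" where
  "stem_block k x y z h = (\<lambda>(l,a,b). {(0,l), (x,a), (y,b),
     (z + (a div k + b div k) mod 2, md k (- int a - int b) + k * ((l + a div k + h) mod 2))})"

definition edge_blocks :: "nat \<Rightarrow> nat \<Rightarrow> nat \<Rightarrow> nat \<Rightarrow> nat \<Rightarrow> nat \<times> nat \<Rightarrow> (nat \<times> nat) set set" where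
  "edge_blocks k x y z t = (\<lambda>(a,b). (\<lambda>e. {(x,a),(y,b)} \<union> {z + (a div k + b div k + t) mod 2} \<times> e)
     ` sum_edges (2*k) (2 * (int a + int b) + int t))"

definition half_pass :: "nat \<Rightarrow> nat \<Rightarrow> nat \<Rightarrow> nat \<Rightarrow> nat \<Rightarrow> (nat \<times> nat) set set" where
  "half_pass k x y z h = stem_block k x y z h ` ({..<2} \<times> {..<2*k} \<times> {..<2*k}) \<union>
     (\<Union>ab\<in>{..<2*k} \<times> {..<2*k}. edge_blocks k x y z 0 ab \<union> edge_blocks k x y z 1 ab)"

lemma edge_blocksE:
  assumes "Q \<in> edge_blocks k x y z t ab"
  obtains a b j r r' where "j < 2" "Q = {(x,a),(y,b),(z+j,r),(z+j,r')}"
proof -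
  obtain a b where ab: "ab = (a,b)" by (metis surj_pair)
  let ?j = "(a div k + b div k + t) mod 2"
  obtain e where e: "e \<in> sum_edges (2*k) (2 * (int a + int b) + int t)" "Q = {(x,a),(y,b)} \<union> {z + ?j} \<times> e"
    using assms unfolding edge_blocks_def ab by auto
  then obtain r r' where "e = {r,r'}" by (auto simp: sum_edges_def)
  then have "Q = {(x,a),(y,b),(z+?j,r),(z+?j,r')}" using e(2) by auto
  then show ?thesis by (intro that[of ?j]) simp_all
qed

lemma half_passE:
  assumes "Q \<in> half_pass k x y z h"
  obtains (stem) l a b j r where "j < 2" "Q = {(0,l),(x,a),(y,b),(z+j,r)}"
  | (edge) a b j r r' where "j < 2" "Q = {(x,a),(y,b),(z+j,r),(z+j,r')}"
proof -
  consider (s) t where "Q = stem_block k x y z h t" | (e) t ab where "Q \<in> edge_blocks k x y z t ab"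
    using assms unfolding half_pass_def by blast
  then show ?thesis
  proof cases
    case s
    obtain l a b where "t = (l,a,b)" by (metis prod_cases3)
    then show ?thesis using s by (intro stem) (auto simp: stem_block_def)
  next
    case e
    then show ?thesis by (rule edge_blocksE) (rule edge)
  qed
qed

lemma finite_half_pass: "finite (half_pass k x y z h)"
  by (auto simp: half_pass_def edge_blocks_def finite_sum_edges)

text \<open>For fixed \<open>a\<close> and \<open>b\<close> there are at most \<open>k - 1\<close>
  pairs of even sum and \<open>k\<close> of odd sum, besides the two stem blocks.\<close>

lemma card_half_pass:
  assumes k: "k > 0"
  shows "4 * card (half_pass k x y z h) \<le> 8 * (2*k)^2 + 4 * ((2*k - 1) * (2*k)^2)"
proof -
  let ?E = "\<lambda>ab. edge_blocks k x y z 0 ab \<union> edge_blocks k x y z 1 ab"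
  let ?S = "stem_block k x y z h ` ({..<2} \<times> {..<2*k} \<times> {..<2*k})" and ?U = "\<Union>ab\<in>{..<2*k} \<times> {..<2*k}. ?E ab"
  have S: "card ?S \<le> 2 * (2*k)^2"
    by (rule order_trans[OF card_image_le]) (auto simp: card_cartesian_product power2_eq_square)
  have AB: "card (?E ab) \<le> 2*k - 1" for ab
  proof -
    obtain a b where ab: "ab = (a,b)" by (metis surj_pair)
    have "card (edge_blocks k x y z t ab) \<le> card (sum_edges (2*k) (2 * (int a + int b) + int t))" for t
      unfolding edge_blocks_def ab prod.case by (rule card_image_le[OF finite_sum_edges])
    from this[of 0] this[of 1]
    have "card (edge_blocks k x y z 0 ab) \<le> card (sum_edges (2*k) (2 * (int a + int b)))"
      "card (edge_blocks k x y z 1 ab) \<le> card (sum_edges (2*k) (2 * (int a + int b) + 1))" by simp_all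
    moreover have "2 * card (sum_edges (2*k) (2 * (int a + int b))) + 2 \<le> 2*k" "2 * card (sum_edges (2*k) (2 * (int a + int b) + 1)) \<le> 2*k"
      using card_sum_edges[of "2*k" k] k by auto
    ultimately show ?thesis using card_Un_le[of "edge_blocks k x y z 0 ab" "edge_blocks k x y z 1 ab"] by linarith
  qed
  have "card ?U \<le> (\<Sum>ab\<in>{..<2*k} \<times> {..<2*k}. card (?E ab))" by (rule card_UN_le) simp
  also have "\<dots> \<le> (\<Sum>ab\<in>{..<2*k} \<times> {..<2*k}. 2*k - 1)" using AB by (rule sum_mono)
  also have "\<dots> = (2*k - 1) * (2*k)^2" by (simp add: card_cartesian_product power2_eq_square)
  finally have U: "card ?U \<le> (2*k - 1) * (2*k)^2" .
  have "card (half_pass k x y z h) \<le> card ?S + card ?U" unfolding half_pass_def by (rule card_Un_le)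
  then show ?thesis using S U by linarith
qed

text \<open>Separates the requirements on the last point into one on its residue modulo
  \<open>k\<close> and one on its bit.\<close>

lemma half_pass_stem:
  assumes "l < 2" "a < 2*k" "b < 2*k" "r < 2*k" "j = (a div k + b div k) mod 2" "int k dvd int a + int b + int r"
    "r div k = (l + a div k + h) mod 2" "k > 0"
  shows "{(0,l),(x,a),(y,b),(z+j,r)} \<in> half_pass k x y z h"
proof -
  have "md k (- int a - int b) = r mod k"
  proof (rule md_eq)
    have "int k dvd - (int a + int b + int r)" using assms(6) by (simp only: dvd_minus_iff)
    moreover have "int k dvd int r - int (r mod k)" by (simp add: zmod_int minus_mod_eq_mult_div)
    ultimately have "int k dvd - (int a + int b + int r) + (int r - int (r mod k))" by (rule dvd_add)
    then show "int k dvd - int a - int b - int (r mod k)" by (simp add: algebra_simps)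
  qed (use assms in auto)
  moreover have "r = r mod k + k * (r div k)" by simp
  ultimately have r: "r = md k (- int a - int b) + k * ((l + a div k + h) mod 2)" using assms(7) by metis
  show ?thesis unfolding half_pass_def
    by (rule UnI1, rule image_eqI[of _ _ "(l,a,b)"]) (use assms r in \<open>auto simp: stem_block_def\<close>)
qed

lemma half_pass_edge:
  assumes "a < 2*k" "b < 2*k" "r < 2*k" "r' < 2*k" "r \<noteq> r'" "t < 2" "j = (a div k + b div k + t) mod 2"
    "int (2*k) dvd int r + int r' + (2 * (int a + int b) + int t)"
  shows "{(x,a),(y,b),(z+j,r),(z+j,r')} \<in> half_pass k x y z h"
proof -
  have "{r,r'} \<in> sum_edges (2*k) (2 * (int a + int b) + int t)" using assms by (intro sum_edgesI) auto
  then have "{(x,a),(y,b)} \<union> {z+j} \<times> {r,r'} \<in> edge_blocks k x y z t (a,b)"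
    unfolding edge_blocks_def assms(7) prod.case by (rule imageI)
  moreover have "{(x,a),(y,b)} \<union> {z+j} \<times> {r,r'} = {(x,a),(y,b),(z+j,r),(z+j,r')}" by auto
  moreover have "t = 0 \<or> t = 1" using assms(6) by auto
  ultimately have m: "{(x,a),(y,b),(z+j,r),(z+j,r')} \<in> edge_blocks k x y z 0 (a,b) \<union> edge_blocks k x y z 1 (a,b)"
    by auto
  show ?thesis unfolding half_pass_def 
    by (rule UnI2, rule UN_I[of "(a,b)"], (use assms(1,2) in simp), rule m)
qed

text \<open>Bit and residue modulo \<open>k\<close> can be prescribed independently; the missing
  points of blocks are found this way.\<close>

lemma choose_half:
  assumes "k > 0" "v < 2"
  obtains b where "b < 2*k" "b div k = v" "int k dvd t - int b"
proof
  let ?b = "md k t + k * v"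
  have m: "md k t < k" "int k dvd t - int (md k t)" using md_less dvd_md assms by auto
  have "v = 0 \<or> v = 1" using assms(2) by auto
  then show "?b < 2*k" using m(1) by auto
  show "?b div k = v" using m(1) assms(1) by simp
  have "int k dvd t - int (md k t) - int k * int v" using m(2) by (rule dvd_diff) simp
  then show "int k dvd t - int ?b" by (simp add: algebra_simps)
qed

lemma div_half_less: "a < 2*k \<Longrightarrow> a div k < (2::nat)"
  by (rule less_mult_imp_div_less)

lemma bit_solve:
  fixes t u v j :: nat
  assumes v: "v = (j + t + u) mod 2" and j: "j < 2"
  shows "j = (u + v + t) mod 2" "j = (v + u + t) mod 2"
proof -
  have "(u + v + t) mod 2 = ((u + t) + v) mod 2" by (simp only: ac_simps)
  also have "\<dots> = ((u + t) + (j + t + u)) mod 2" unfolding v by (simp only: mod_add_right_eq)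
  also have "\<dots> = (j + 2 * (u + t)) mod 2" by (rule arg_cong[where f="\<lambda>n. n mod 2"]) simp
  also have "\<dots> = j" using j by (simp only: mod_mult_self2 mod_less)
  finally show "j = (u + v + t) mod 2" "j = (v + u + t) mod 2" by (simp_all add: add.commute)
qed

lemma bit_sum:
  fixes u v j :: nat
  assumes v: "v = (j + u) mod 2"
  shows "(l + j + u + h) mod 2 = (l + v + h) mod 2"
proof -
  have "(l + v + h) mod 2 = ((l + h) + v) mod 2" by (simp add: add.commute add.left_commute)
  also have "\<dots> = ((l + h) + (j + u)) mod 2" unfolding v by (simp only: mod_add_right_eq)
  finally show ?thesis by (simp add: add.commute add.left_commute)
qed

text \<open>The reason why offsets 0 and 1 are complementary: a bit condition that fails in one pass
  holds in the other, where the two groups have exchanged roles.\<close>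

lemma bit_flip:
  fixes u v l :: nat
  assumes "v \<noteq> (l + u) mod 2" "u < 2" "v < 2"
  shows "u = (l + v + 1) mod 2"
proof -
  have "u = 0 \<or> u = 1" "v = 0 \<or> v = 1" using assms by auto
  then show ?thesis using assms(1) by (elim disjE) (simp_all, presburger+)
qed

lemma bit_cases: "j < 2 \<Longrightarrow> j = t mod 2 \<or> j = (t + 1) mod (2::nat)"
  by presburger

lemma bit_twice:
  fixes t u v :: nat
  assumes "t < 2"
  shows "t = ((t + u + v) mod 2 + u + v) mod 2"
proof -
  have "((t + u + v) mod 2 + u + v) mod 2 = ((t + u + v) mod 2 + (u + v)) mod 2" by (simp only: add.assoc)
  also have "\<dots> = ((t + u + v) + (u + v)) mod 2" by (simp only: mod_add_left_eq)
  also have "\<dots> = (t + 2 * (u + v)) mod 2" by (rule arg_cong[where f="\<lambda>n. n mod 2"]) simp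
  also have "\<dots> = t" using assms by (simp only: mod_mult_self2 mod_less)
  finally show ?thesis by simp
qed

lemma half_pass_cover_stem:
  assumes "l < 2" "a < 2*k" "b < 2*k" "k > 0"
  shows "\<exists>Q\<in>half_pass k x y z h. {(0,l),(x,a),(y,b)} \<subseteq> Q"
proof -
  obtain r where r: "r < 2*k" "r div k = (l + a div k + h) mod 2" "int k dvd (- int a - int b) - int r"
    using choose_half[OF assms(4), of "(l + a div k + h) mod 2" "- int a - int b"] by auto
  have "int k dvd - (- int a - int b - int r)" using r(3) by (simp only: dvd_minus_iff)
  then have "int k dvd int a + int b + int r" by (simp add: algebra_simps)
  from half_pass_stem[OF assms(1-3) r(1) refl this r(2) assms(4)] show ?thesis by (rule rev_bexI) auto
qed

text \<open>The free point \<open>b\<close> absorbs the residue condition and selects the group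
  \<open>z + j\<close>. The condition on the bit of \<open>r\<close> cannot be absorbed, so this
  pass supplies only half of these triples.\<close>

lemma half_pass_cover_stem1:
  assumes "l < 2" "a < 2*k" "r < 2*k" "k > 0" "j < 2" "r div k = (l + a div k + h) mod 2"
  shows "\<exists>Q\<in>half_pass k x y z h. {(0,l),(x,a),(z+j,r)} \<subseteq> Q"
proof -
  obtain b where b: "b < 2*k" "b div k = (j + 0 + a div k) mod 2" "int k dvd (- int a - int r) - int b"
    using choose_half[OF assms(4), of "(j + 0 + a div k) mod 2" "- int a - int r"] by auto
  have "int k dvd - (- int a - int r - int b)" using b(3) by (simp only: dvd_minus_iff)
  then have d: "int k dvd int a + int b + int r" by (simp add: algebra_simps)
  have "j = (a div k + b div k) mod 2" using bit_solve(1)[OF b(2) assms(5)] by simp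
  from half_pass_stem[OF assms(1,2) b(1) assms(3) this d assms(6,4)] show ?thesis by (rule rev_bexI) auto
qed

lemma half_pass_cover_stem2:
  assumes "l < 2" "b < 2*k" "r < 2*k" "k > 0" "j < 2" "r div k = (l + j + b div k + h) mod 2"
  shows "\<exists>Q\<in>half_pass k x y z h. {(0,l),(y,b),(z+j,r)} \<subseteq> Q"
proof -
  obtain a where a: "a < 2*k" "a div k = (j + 0 + b div k) mod 2" "int k dvd (- int b - int r) - int a"
    using choose_half[OF assms(4), of "(j + 0 + b div k) mod 2" "- int b - int r"] by auto
  have "int k dvd - (- int b - int r - int a)" using a(3) by (simp only: dvd_minus_iff)
  then have d: "int k dvd int a + int b + int r" by (simp add: algebra_simps)
  have e: "j = (a div k + b div k) mod 2" using bit_solve(2)[OF a(2) assms(5)] by simp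
  have "r div k = (l + a div k + h) mod 2" unfolding assms(6) using a(2) by (intro bit_sum) simp
  from half_pass_stem[OF assms(1) a(1) assms(2,3) e d this assms(4)] show ?thesis by (rule rev_bexI) auto
qed

text \<open>The reflection that pairs points of group \<open>z + j\<close> fixes \<open>r\<close>
  exactly if even sums are used there and \<open>a + b + r\<close> vanishes modulo \<open>k\<close>.
  Then a stem point completes the triple; otherwise the partner of \<open>r\<close> does.\<close>

lemma half_pass_cover_three:
  assumes "a < 2*k" "b < 2*k" "r < 2*k" "k > 0" "j < 2"
  shows "\<exists>Q\<in>half_pass k x y z h. {(x,a),(y,b),(z+j,r)} \<subseteq> Q"
proof (cases "j = (a div k + b div k) mod 2 \<and> int k dvd int a + int b + int r")
  case True
  have "r div k < 2" using div_half_less assms(3) .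
  then have "r div k = ((r div k + a div k + h) mod 2 + a div k + h) mod 2" by (rule bit_twice)
  from half_pass_stem[OF _ assms(1-3) conjunct1[OF True] conjunct2[OF True] this assms(4)] have
    "{(0,(r div k + a div k + h) mod 2),(x,a),(y,b),(z+j,r)} \<in> half_pass k x y z h" by simp
  then show ?thesis by (rule rev_bexI) auto
next
  case False
  have g0: "2*k > 0" using assms(4) by simp
  obtain t where t: "t < 2" "j = (a div k + b div k + t) mod 2"
    using bit_cases[OF assms(5), of "a div k + b div k"] by (metis add_0_right one_less_numeral_iff semiring_norm(76) zero_less_numeral)
  then have t01: "t = 0 \<or> t = 1" by auto
  define r' where "r' = md (2*k) (- 2 * (int a + int b) - int t - int r)"
  have r': "r' < 2*k" "int (2*k) dvd - 2 * (int a + int b) - int t - int r - int r'"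
    using md_less[OF g0] dvd_md[OF g0] by (auto simp: r'_def simp del: of_nat_mult)
  have "int (2*k) dvd - (- 2 * (int a + int b) - int t - int r - int r')" using r'(2) by (simp only: dvd_minus_iff)
  then have d: "int (2*k) dvd int r + int r' + (2 * (int a + int b) + int t)" by (simp add: algebra_simps)
  have "r \<noteq> r'"
  proof
    assume "r = r'"
    then have d2: "2 * int k dvd 2 * (int a + int b + int r) + int t" using d by (simp add: algebra_simps)
    then have "even (2 * (int a + int b + int r) + int t)" by (rule dvd_mult_left)
    then have "t = 0" using t01 by auto
    then have "2 * int k dvd 2 * (int a + int b + int r)" using d2 by simp
    then have "int k dvd int a + int b + int r" by (subst (asm) dvd_mult_cancel_left) simp
    then show False using False t(2) \<open>t = 0\<close> by simp
  qed
  from half_pass_edge[OF assms(1-3) r'(1) this t d] show ?thesis by (rule rev_bexI) auto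
qed

lemma half_pass_cover_two:
  assumes "a < 2*k" "r < 2*k" "r' < 2*k" "r \<noteq> r'" "k > 0" "j < 2"
  shows "\<exists>Q\<in>half_pass k x y z h. {(z+j,r),(z+j,r'),(x,a)} \<subseteq> Q"
    "\<exists>Q\<in>half_pass k x y z h. {(z+j,r),(z+j,r'),(y,a)} \<subseteq> Q"
proof -
  \<comment> \<open>The parity \<open>t\<close> of \<open>r + r'\<close> tells which kind of pair
    this is. The point \<open>b\<close> then has to satisfy \<open>n + t + a + b = 0\<close> modulo
    \<open>k\<close>, and its bit has to select group \<open>z + j\<close>.\<close>
  define n t where "n = (r + r') div 2" and "t = (r + r') mod 2"
  have t: "t < 2" by (simp add: t_def)
  have "r + r' = 2*n + t" by (simp add: n_def t_def)
  then have nn: "int r + int r' = 2 * int n + int t" by linarith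
  obtain b where b: "b < 2*k" "b div k = (j + t + a div k) mod 2" "int k dvd (- int n - int t - int a) - int b"
    using choose_half[OF assms(5), of "(j + t + a div k) mod 2" "- int n - int t - int a"] by auto
  have "2 * int k dvd 2 * - (- int n - int t - int a - int b)" using b(3) by (simp only: dvd_minus_iff dvd_mult_cancel_left) simp
  then have d: "int (2*k) dvd int r + int r' + (2 * (int a + int b) + int t)"
    "int (2*k) dvd int r + int r' + (2 * (int b + int a) + int t)"
    unfolding nn by (simp_all add: algebra_simps)
  have e: "j = (a div k + b div k + t) mod 2" "j = (b div k + a div k + t) mod 2" by (rule bit_solve[OF b(2) assms(6)])+
  show "\<exists>Q\<in>half_pass k x y z h. {(z+j,r),(z+j,r'),(x,a)} \<subseteq> Q"
    by (rule rev_bexI[OF half_pass_edge[OF assms(1) b(1) assms(2-4) t e(1) d(1)]]) auto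
  show "\<exists>Q\<in>half_pass k x y z h. {(z+j,r),(z+j,r'),(y,a)} \<subseteq> Q"
    by (rule rev_bexI[OF half_pass_edge[OF b(1) assms(1-4) t e(2) d(2)]]) auto
qed

text \<open>Only edge blocks have two points in one group. With \<open>x\<close>, \<open>y\<close>
  both before or both after \<open>z\<close>, \<open>z + 1\<close>, the other two points are on one
  side.\<close>

lemma half_pass_level:
  assumes Q: "{(i,a),(i,a'),u,v} \<in> half_pass k x y z h" and c4: "card {(i,a),(i,a'),u,v} = 4" and i: "i \<noteq> 0"
    and d: "x \<noteq> y" "\<And>j. j < 2 \<Longrightarrow> z + j \<noteq> x \<and> z + j \<noteq> y"
  shows "i \<in> {z, z+1} \<and> fst u \<in> {x,y} \<and> fst v \<in> {x,y}"
proof -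
  have ne: "a \<noteq> a'" "u \<noteq> (i,a)" "u \<noteq> (i,a')" "v \<noteq> (i,a)" "v \<noteq> (i,a')"
    using card_4_distinct[OF c4] by auto
  from Q show ?thesis
  proof (cases rule: half_passE)
    case (stem l c b j r)
    have "(i,a) \<in> {(0,l),(x,c),(y,b),(z+j,r)}" "(i,a') \<in> {(0,l),(x,c),(y,b),(z+j,r)}"
      unfolding stem(2)[symmetric] by simp_all
    then show ?thesis using i d(1) d(2)[OF stem(1)] ne(1) by auto
  next
    case (edge c b j r r')
    let ?R = "{(x,c),(y,b),(z+j,r),(z+j,r')}"
    have m: "(i,a) \<in> ?R" "(i,a') \<in> ?R" "u \<in> ?R" "v \<in> ?R" unfolding edge(2)[symmetric] by simp_all
    have i: "i = z + j" "{r,r'} = {a,a'}" using m(1,2) d(1) d(2)[OF edge(1)] ne(1) by auto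
    have "(z+j,r) \<in> {(i,a),(i,a')}" "(z+j,r') \<in> {(i,a),(i,a')}" using i by auto
    then have "u \<in> {(x,c),(y,b)}" "v \<in> {(x,c),(y,b)}" using m(3,4) ne by auto
    moreover have "j = 0 \<or> j = 1" using edge(1) by auto
    ultimately show ?thesis using i by auto
  qed
qed

text \<open>Groups 1 and 2 precede groups 3 and 4. A block meeting three groups takes its pair from
  one of these halves and its single points from the other, so the order of the groups already
  yields \<open>level_ok\<close> for the identity.\<close>

lemma quadrupling:
  assumes g: "g = 2*k" "k > 0"
  shows "\<exists>C. exact_cover C (ctriples {1..4} g 2) \<and> level_ok id g C"
proof -
  obtain f where f: "\<And>c. c < g - 1 \<Longrightarrow> matching {..<g} (f c)"
    and fc: "\<And>x y. x < g \<Longrightarrow> y < g \<Longrightarrow> x \<noteq> y \<Longrightarrow> \<exists>c<g-1. f c x = y"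
  proof -
    have "even g" "g > 0" using g by auto
    from one_factorization[OF this] show ?thesis using that by blast
  qed
  let ?q = "square_blocks g (g-1)"
  \<comment> \<open>The second pass exchanges the halves and has offset 1.\<close>
  let ?A = "half_pass k 1 2 3 0" and ?B = "half_pass k 3 4 1 1"
  define C where "C = (?A \<union> ?B) \<union> (?q 1 2 f \<union> ?q 3 4 f)"
  have finC: "finite C" unfolding C_def using finite_half_pass finite_square_blocks by auto
  have c4: "finite Q \<and> card Q \<le> 4" if "Q \<in> C" for Q
  proof -
    have *: "finite {a,b,c,d} \<and> card {a,b,c,d} \<le> 4" for a b c d :: "nat \<times> nat"
      by (auto simp: card_insert_if)
    have "\<exists>a b c d. Q = {a,b,c,d}" using that unfolding C_def
      by (elim UnE half_passE square_blocksE) blast+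
    then show ?thesis using * by auto
  qed
  have cQ: "4 * card (?q i j f) \<le> (g-1) * g^2" for i j by (rule card_square_blocks[OF f])
  have "card C \<le> (card ?A + card ?B) + (card (?q 1 2 f) + card (?q 3 4 f))"
    unfolding C_def by (intro order_trans[OF card_Un_le] add_mono order_refl)
  moreover have "4*c \<le> 2 * (8*Y + 4*X) + 2*X" if "c \<le> (a + b) + (d + e)" "4*a \<le> 8*Y + 4*X" "4*b \<le> 8*Y + 4*X" "4*d \<le> X" "4*e \<le> X"
    for a b c d e X Y :: nat
  proof -
    have "4*c \<le> 4*a + 4*b + 4*d + 4*e" using that(1) by simp
    also have "\<dots> \<le> (8*Y + 4*X) + (8*Y + 4*X) + X + X" using that(2-5) by (intro add_mono)
    finally show ?thesis by simp
  qed
  ultimately have "4 * card C \<le> 2 * (8 * g^2 + 4 * ((g - 1) * g^2)) + 2 * ((g-1) * g^2)"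
    using card_half_pass[OF g(2), of 1 2 3 0] card_half_pass[OF g(2), of 3 4 1 1] cQ[of 1 2] cQ[of 3 4]
    unfolding g(1)[symmetric] by blast
  also have "\<dots> = 16 * g^2 + 10 * ((g - 1) * g^2)" by (simp add: algebra_simps)
  finally have "int (4 * card C) \<le> int (16 * g^2 + 10 * ((g - 1) * g^2))" by (simp only: of_nat_le_iff)
  also have "\<dots> = 16 * int g ^ 2 + 10 * ((int g - 1) * int g ^ 2)" using g by simp
  also have "\<dots> = int (card (ctriples {1..4} g 2))"
    unfolding card_ctriples_4 by (simp add: algebra_simps power3_eq_cube power2_eq_square)
  finally have card: "4 * card C \<le> card (ctriples {1..4} g 2)" by (simp only: of_nat_le_iff)
  have A: "\<exists>Q\<in>C. T \<subseteq> Q" if "\<exists>Q\<in>?A. T \<subseteq> Q" for T using that unfolding C_def by auto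
  have B: "\<exists>Q\<in>C. T \<subseteq> Q" if "\<exists>Q\<in>?B. T \<subseteq> Q" for T using that unfolding C_def by auto
  have S1: "\<exists>Q\<in>C. T \<subseteq> Q" if "\<exists>Q\<in>?q 1 2 f. T \<subseteq> Q" for T using that unfolding C_def by auto
  have S2: "\<exists>Q\<in>C. T \<subseteq> Q" if "\<exists>Q\<in>?q 3 4 f. T \<subseteq> Q" for T using that unfolding C_def by auto
  have twocov: "\<exists>Q\<in>C. {(i,a),(i,a'),(j,b)} \<subseteq> Q"
    if ij: "i \<in> {1..4}" "j \<in> {1..4}" "i \<noteq> j" and ab: "a < g" "a' < g" "a \<noteq> a'" "b < g" for i j a a' b
  proof -
    obtain c where c: "c < g - 1" "f c a = a'" using fc ab by blast
    have sq: "\<exists>Q\<in>?q i j f. {(i,a),(i,a'),(j,b)} \<subseteq> Q" "\<exists>Q\<in>?q j i f. {(i,a),(i,a'),(j,b)} \<subseteq> Q"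
      using square_blocks_cover[OF c(1) ab(1,4), where i=i and j=j and f=f] by (simp_all only: c(2))
    have ab': "b < 2*k" "a < 2*k" "a' < 2*k" using ab g by auto
    note hA = half_pass_cover_two[OF ab' ab(3) g(2), of _ 1 2 3 0]
    note hB = half_pass_cover_two[OF ab' ab(3) g(2), of _ 3 4 1 1]
    have i: "i = 1 \<or> i = 2 \<or> i = 3 \<or> i = 4" and j: "j = 1 \<or> j = 2 \<or> j = 3 \<or> j = 4" using ij by auto
    then consider "(i,j) \<in> {(1,2),(2,1)}" | "(i,j) \<in> {(3,4),(4,3)}" | "i = 3" "j = 1" | "i = 3" "j = 2"
      | "i = 4" "j = 1" | "i = 4" "j = 2" | "i = 1" "j = 3" | "i = 1" "j = 4" | "i = 2" "j = 3" | "i = 2" "j = 4"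
      using ij(3) by (elim disjE) simp_all
    then show ?thesis
    proof cases
      case 1 then show ?thesis using sq by (intro S1) auto
    next
      case 2 then show ?thesis using sq by (intro S2) auto
    next
      case 3 then show ?thesis using hA(1)[of 0] by (intro A) simp
    next
      case 4 then show ?thesis using hA(2)[of 0] by (intro A) simp
    next
      case 5 then show ?thesis using hA(1)[of 1] by (intro A) simp
    next
      case 6 then show ?thesis using hA(2)[of 1] by (intro A) simp
    next
      case 7 then show ?thesis using hB(1)[of 0] by (intro B) simp
    next
      case 8 then show ?thesis using hB(2)[of 0] by (intro B) simp
    next
      case 9 then show ?thesis using hB(1)[of 1] by (intro B) (simp add: numeral_2_eq_2)
    next
      case 10 then show ?thesis using hB(2)[of 1] by (intro B) (simp add: numeral_2_eq_2)
    qed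
  qed
  have stemcov: "\<exists>Q\<in>C. {(0,l),(i,a),(j,b)} \<subseteq> Q"
    if ij: "i \<in> {1..4}" "j \<in> {1..4}" "i < j" and lab: "l < 2" "a < g" "b < g" for l i j a b
  proof -
    have ab: "a < 2*k" "b < 2*k" using lab g by auto
    have sw: "{(0,l),(i,a),(j,b)} = {(0,l),(j,b),(i,a)}" by blast
    have bits: "a div k < 2" "b div k < 2" using ab div_half_less by auto
    have i: "i = 1 \<or> i = 2 \<or> i = 3 \<or> i = 4" and j: "j = 1 \<or> j = 2 \<or> j = 3 \<or> j = 4" using ij by auto
    then consider "i = 1" "j = 2" | "i = 3" "j = 4" | "i = 1" "j = 3" | "i = 1" "j = 4" | "i = 2" "j = 3" | "i = 2" "j = 4"
      using ij(3) by (elim disjE) simp_all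
    then show ?thesis
    proof cases
      case 1 then show ?thesis using half_pass_cover_stem[OF lab(1) ab g(2), of 1 2 3 0] by (intro A) simp
    next
      case 2 then show ?thesis using half_pass_cover_stem[OF lab(1) ab g(2), of 3 4 1 1] by (intro B) simp
    next
      case 3
      show ?thesis
      \<comment> \<open>A stem point with one point in each half is reached by the first pass or by
        the second according to this bit; the next three cases follow the same pattern.\<close>
      proof (cases "b div k = (l + a div k + 0) mod 2")
        case True
        then show ?thesis using half_pass_cover_stem1[OF lab(1) ab g(2), of 0 0 1 2 3] 3 by (intro A) simp
      next
        case False
        then have "a div k = (l + b div k + 1) mod 2" using bits by (intro bit_flip) simp_all
        then show ?thesis using half_pass_cover_stem1[OF lab(1) ab(2,1) g(2), of 0 1 3 4 1] 3 unfolding sw by (intro B) simp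
      qed
    next
      case 4
      show ?thesis
      proof (cases "b div k = (l + a div k + 0) mod 2")
        case True
        then show ?thesis using half_pass_cover_stem1[OF lab(1) ab g(2), of 1 0 1 2 3] 4 by (intro A) simp
      next
        case False
        then have "a div k = (l + 0 + b div k + 1) mod 2" using bits by (intro bit_flip) simp_all
        then show ?thesis using half_pass_cover_stem2[OF lab(1) ab(2,1) g(2), of 0 1 3 4 1] 4 unfolding sw by (intro B) simp
      qed
    next
      case 5
      show ?thesis
      proof (cases "b div k = (l + 0 + a div k + 0) mod 2")
        case True
        then show ?thesis using half_pass_cover_stem2[OF lab(1) ab g(2), of 0 0 1 2 3] 5 by (intro A) simp
      next
        case False
        then have "a div k = (l + b div k + 1) mod 2" using bits by (intro bit_flip) simp_all
        then show ?thesis using half_pass_cover_stem1[OF lab(1) ab(2,1) g(2), of 1 1 3 4 1] 5 unfolding sw by (intro B) (simp add: numeral_2_eq_2)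
      qed
    next
      case 6
      show ?thesis
      proof (cases "b div k = (l + 1 + a div k + 0) mod 2")
        case True
        then show ?thesis using half_pass_cover_stem2[OF lab(1) ab g(2), of 1 0 1 2 3] 6 by (intro A) simp
      next
        case False
        then have "a div k = (l + 1 + b div k + 1) mod 2" using bits by (intro bit_flip) simp_all
        then show ?thesis using half_pass_cover_stem2[OF lab(1) ab(2,1) g(2), of 1 1 3 4 1] 6 unfolding sw by (intro B) (simp add: numeral_2_eq_2)
      qed
    qed
  qed
  have threecov: "\<exists>Q\<in>C. {(i,a),(j,b),(m,c)} \<subseteq> Q"
    if ij: "i \<in> {1..4}" "j \<in> {1..4}" "m \<in> {1..4}" "i < j" "j < m" and abc: "a < g" "b < g" "c < g" for i j m a b c
  proof -
    have ab: "a < 2*k" "b < 2*k" "c < 2*k" using abc g by auto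
    have sw: "{(i,a),(j,b),(m,c)} = {(j,b),(m,c),(i,a)}" by blast
    consider "i = 1" "j = 2" "m = 3" | "i = 1" "j = 2" "m = 4" | "i = 1" "j = 3" "m = 4" | "i = 2" "j = 3" "m = 4"
      using ij by fastforce
    then show ?thesis
    proof cases
      case 1 then show ?thesis using half_pass_cover_three[OF ab g(2), of 0 1 2 3 0] by (intro A) simp
    next
      case 2 then show ?thesis using half_pass_cover_three[OF ab g(2), of 1 1 2 3 0] by (intro A) simp
    next
      case 3 then show ?thesis using half_pass_cover_three[OF ab(2,3,1) g(2), of 0 3 4 1 1] unfolding sw by (intro B) simp
    next
      case 4 then show ?thesis using half_pass_cover_three[OF ab(2,3,1) g(2), of 1 3 4 1 1] unfolding sw by (intro B) (simp add: numeral_2_eq_2)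
    qed
  qed
  have ec: "exact_cover C (ctriples {1..4} g 2)"
  proof (rule exact_cover_ctriples_if_card[OF finC c4 _ card])
    fix T assume T: "T \<in> ctriples {1..4} g 2"
    have nz: "0 \<notin> {1..4::nat}" by simp
    show "\<exists>Q\<in>C. T \<subseteq> Q" using T nz
    proof (cases rule: ctriples_cases)
      case (stem l i j a b)
      then show ?thesis using stemcov[of i j l a b] by simp
    next
      case (two i j a a' b)
      then show ?thesis using twocov[of i j a a' b] by simp
    next
      case (three i j m a b c)
      then show ?thesis using threecov[of i j m a b c] by simp
    qed
  qed
  have "level_ok id g C" unfolding level_ok_def
  proof (intro allI impI, elim conjE)
    fix i j x y assume i: "i \<noteq> 0" and j: "j < g div 2" and Q: "{(i, id (2*j)), (i, id (2*j+1)), x, y} \<in> C"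
    define u v where "u = 2*j" and "v = 2*j+1"
    have uv: "u < g" "v < g" using j by (auto simp: u_def v_def)
    have Q': "{(i,u),(i,v),x,y} \<in> C" using Q by (simp add: u_def v_def)
    have Q4: "card {(i,u),(i,v),x,y} = 4" using ec Q' unfolding exact_cover_def by blast
    then have Q3: "card {(i,u),(i,v),x} = 3" using card_4_distinct[OF Q4] by auto
    consider "{(i,u),(i,v),x,y} \<in> ?A" | "{(i,u),(i,v),x,y} \<in> ?B" | "{(i,u),(i,v),x,y} \<in> ?q 1 2 f \<union> ?q 3 4 f"
      using Q' unfolding C_def by blast
    then show "fst x < i \<and> fst y < i \<or> i < fst x \<and> i < fst y"
    proof cases
      case 1
      have "i \<in> {3,3+1} \<and> fst x \<in> {1,2} \<and> fst y \<in> {1,2}" by (rule half_pass_level[OF 1 Q4 i]) auto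
      then show ?thesis by auto
    next
      case 2
      have "i \<in> {1,1+1} \<and> fst x \<in> {3,4} \<and> fst y \<in> {3,4}" by (rule half_pass_level[OF 2 Q4 i]) auto
      then show ?thesis by auto
    next
      case 3
      then have xy: "fst x = fst y" using square_blocks_strong[OF _ _ Q4] by fastforce
      have "x \<in> pts {1..4} g 2" using exact_cover_subset[OF ec _ Q', of "pts {1..4} g 2"] by (auto simp: ctriples_def triples_def)
      moreover have "\<not> {(i,u),(i,v),x} \<subseteq> pts {i} g 2" by (rule candelabra_not_in_group[OF ec Q' Q3])
      ultimately have "fst x \<noteq> i" using i uv by (auto simp: pts_def)
      then show ?thesis using xy by auto
    qed
  qed
  then show ?thesis using ec by blast
qed

section \<open>Fourteen points, and three groups of twelve with stem two\<close>

text \<open>The test runs in stages: blocks are filtered by the first point, then by the second, so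
  the innermost search sees only a short list. \<open>ex\<close> marks the exempt triples.\<close>

definition completed :: "('a \<Rightarrow> 'a \<Rightarrow> 'a \<Rightarrow> bool) \<Rightarrow> 'a \<Rightarrow> 'a \<Rightarrow> 'a list list \<Rightarrow> 'a \<Rightarrow> bool" where
  "completed ex x y M z \<longleftrightarrow> ex x y z \<or> list_ex (\<lambda>Q. z \<in> set Q) M"

definition pair_covered :: "('a \<Rightarrow> 'a \<Rightarrow> 'a \<Rightarrow> bool) \<Rightarrow> 'a list list \<Rightarrow> 'a list \<Rightarrow> 'a \<Rightarrow> 'a \<Rightarrow> bool" where
  "pair_covered ex L zs x y \<longleftrightarrow> list_all (completed ex x y (filter (\<lambda>Q. y \<in> set Q) L)) zs"

definition point_covered :: "('a \<Rightarrow> 'a \<Rightarrow> 'a \<Rightarrow> bool) \<Rightarrow> 'a list list \<Rightarrow> 'a list \<Rightarrow> 'a \<Rightarrow> bool" where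
  "point_covered ex L zs x \<longleftrightarrow> list_all (pair_covered ex (filter (\<lambda>Q. x \<in> set Q) L) zs x) zs"

definition repeated :: "'a \<Rightarrow> 'a \<Rightarrow> 'a \<Rightarrow> bool" where
  "repeated x y z \<longleftrightarrow> x = y \<or> z = x \<or> z = y"

lemma pair_coveredD:
  "pair_covered ex L zs x y \<Longrightarrow> z \<in> set zs \<Longrightarrow> \<not> ex x y z \<Longrightarrow> \<exists>Q\<in>set L. y \<in> set Q \<and> z \<in> set Q"
  by (auto simp: pair_covered_def completed_def list_all_iff list_ex_iff)

lemma point_coveredD:
  assumes "point_covered ex L zs x" "y \<in> set zs" "z \<in> set zs" "\<not> ex x y z"
  shows "\<exists>Q\<in>set L. x \<in> set Q \<and> y \<in> set Q \<and> z \<in> set Q"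
proof -
  have "pair_covered ex (filter (\<lambda>Q. x \<in> set Q) L) zs x y"
    using assms(1,2) by (auto simp: point_covered_def list_all_iff)
  from pair_coveredD[OF this assms(3,4)] show ?thesis by auto
qed

section \<open>A candelabra system on 38 points\<close>

text \<open>The weight 10 is \<open>- 2\<close> modulo 12. The weights of the three groups cancel,
  so coordinate sums across the groups are invariant.\<close>

definition shift :: "nat \<Rightarrow> nat \<times> nat \<Rightarrow> nat \<times> nat" where
  "shift t x = (fst x, (snd x + t * (if fst x = 0 then 0 else if fst x = 3 then 10 else 1)) mod 12)"

text \<open>
  Orbit representatives, found by a SAT solver, of a system invariant under the shift by
  \<open>(1, 1, - 2)\<close>; the short orbits are fixed by the sixth power of the shift. Two points at distance 6
  in a group occur only in blocks that meet another group twice, so they may share a level.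
\<close>

definition long_orbits :: "(nat \<times> nat) list list" where
  "long_orbits = [
   [(0,0),(1,0),(2,0),(3,0)], [(0,0),(1,0),(2,1),(3,11)], [(0,0),(1,0),(2,2),(3,10)],
   [(0,0),(1,0),(2,3),(3,9)], [(0,0),(1,0),(2,4),(3,8)], [(0,0),(1,0),(2,5),(3,7)],
   [(0,0),(1,0),(2,6),(3,6)], [(0,0),(1,0),(2,7),(3,5)], [(0,0),(1,0),(2,8),(3,4)],
   [(0,0),(1,0),(2,9),(3,3)], [(0,0),(1,0),(2,10),(3,2)], [(0,0),(1,0),(2,11),(3,1)],
   [(0,1),(1,0),(2,0),(3,3)], [(0,1),(1,0),(2,1),(3,2)], [(0,1),(1,0),(2,2),(3,1)],
   [(0,1),(1,0),(2,3),(3,0)], [(0,1),(1,0),(2,4),(3,11)], [(0,1),(1,0),(2,5),(3,10)],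
   [(0,1),(1,0),(2,6),(3,9)], [(0,1),(1,0),(2,7),(3,8)], [(0,1),(1,0),(2,8),(3,7)],
   [(0,1),(1,0),(2,9),(3,6)], [(0,1),(1,0),(2,10),(3,5)], [(0,1),(1,0),(2,11),(3,4)],
   [(1,0),(1,1),(2,0),(3,10)], [(1,0),(1,1),(2,1),(2,6)], [(1,0),(1,1),(2,2),(2,3)],
   [(1,0),(1,1),(2,4),(2,5)], [(1,0),(1,1),(2,7),(3,6)], [(1,0),(1,1),(2,8),(3,5)],
   [(1,0),(1,1),(2,9),(2,10)], [(1,0),(1,1),(2,11),(3,11)], [(1,0),(1,1),(3,0),(3,2)],
   [(1,0),(1,1),(3,1),(3,8)], [(1,0),(1,1),(3,3),(3,4)], [(1,0),(1,1),(3,7),(3,9)],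
   [(1,0),(1,2),(2,0),(2,7)], [(1,0),(1,2),(2,1),(2,8)], [(1,0),(1,2),(2,2),(3,9)],
   [(1,0),(1,2),(2,3),(2,5)], [(1,0),(1,2),(2,4),(2,10)], [(1,0),(1,2),(2,6),(3,5)],
   [(1,0),(1,2),(2,9),(2,11)], [(1,0),(1,2),(3,0),(3,4)], [(1,0),(1,2),(3,1),(3,6)],
   [(1,0),(1,2),(3,2),(3,7)], [(1,0),(1,2),(3,3),(3,8)], [(1,0),(1,2),(3,10),(3,11)],
   [(1,0),(1,3),(2,0),(3,4)], [(1,0),(1,3),(2,1),(3,3)], [(1,0),(1,3),(2,2),(3,2)],
   [(1,0),(1,3),(2,3),(3,1)], [(1,0),(1,3),(2,4),(3,0)], [(1,0),(1,3),(2,5),(3,11)],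
   [(1,0),(1,3),(2,6),(3,10)], [(1,0),(1,3),(2,7),(3,9)], [(1,0),(1,3),(2,8),(3,8)],
   [(1,0),(1,3),(2,9),(3,7)], [(1,0),(1,3),(2,10),(3,6)], [(1,0),(1,3),(2,11),(3,5)],
   [(1,0),(1,4),(2,0),(2,4)], [(1,0),(1,4),(2,1),(2,5)], [(1,0),(1,4),(2,2),(3,8)],
   [(1,0),(1,4),(2,3),(2,9)], [(1,0),(1,4),(2,6),(2,10)], [(1,0),(1,4),(2,7),(2,11)],
   [(1,0),(1,4),(2,8),(3,2)], [(1,0),(1,4),(3,0),(3,11)], [(1,0),(1,4),(3,1),(3,5)],
   [(1,0),(1,4),(3,3),(3,7)], [(1,0),(1,4),(3,4),(3,9)], [(1,0),(1,4),(3,6),(3,10)],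
   [(1,0),(1,5),(2,0),(2,10)], [(1,0),(1,5),(2,1),(2,11)], [(1,0),(1,5),(2,2),(2,7)],
   [(1,0),(1,5),(2,3),(2,8)], [(1,0),(1,5),(2,4),(2,9)], [(1,0),(1,5),(2,5),(2,6)],
   [(1,0),(1,5),(3,0),(3,6)], [(1,0),(1,5),(3,1),(3,7)], [(1,0),(1,5),(3,2),(3,10)],
   [(1,0),(1,5),(3,3),(3,5)], [(1,0),(1,5),(3,4),(3,11)], [(1,0),(1,5),(3,8),(3,9)],
   [(1,0),(1,6),(2,2),(2,4)], [(1,0),(1,6),(2,3),(2,11)], [(1,0),(2,0),(2,2),(3,11)],
   [(1,0),(2,0),(2,3),(3,5)], [(1,0),(2,0),(2,9),(3,8)], [(1,0),(2,0),(2,11),(3,2)],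
   [(1,0),(2,0),(3,6),(3,9)], [(1,0),(2,1),(2,4),(3,4)], [(1,0),(2,1),(2,10),(3,7)],
   [(1,0),(2,1),(3,0),(3,1)], [(1,0),(2,1),(3,5),(3,8)], [(1,0),(2,1),(3,9),(3,10)],
   [(1,0),(2,2),(2,5),(3,3)], [(1,0),(2,2),(2,10),(3,0)], [(1,0),(2,2),(2,11),(3,6)],
   [(1,0),(2,2),(3,4),(3,7)], [(1,0),(2,3),(2,6),(3,2)], [(1,0),(2,3),(3,3),(3,6)],
   [(1,0),(2,3),(3,7),(3,11)], [(1,0),(2,3),(3,8),(3,10)], [(1,0),(2,4),(2,6),(3,7)],
   [(1,0),(2,4),(2,7),(3,1)], [(1,0),(2,4),(2,8),(3,6)], [(1,0),(2,4),(3,2),(3,5)],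
   [(1,0),(2,5),(2,8),(3,0)], [(1,0),(2,5),(3,1),(3,4)], [(1,0),(2,5),(3,5),(3,9)],
   [(1,0),(2,5),(3,6),(3,8)], [(1,0),(2,6),(2,7),(3,4)], [(1,0),(2,6),(2,9),(3,11)],
   [(1,0),(2,6),(3,0),(3,3)], [(1,0),(2,7),(2,8),(3,3)], [(1,0),(2,7),(2,10),(3,10)],
   [(1,0),(2,7),(3,2),(3,11)], [(1,0),(2,8),(2,11),(3,9)], [(1,0),(2,8),(3,1),(3,10)],
   [(1,0),(2,9),(3,0),(3,9)], [(1,0),(2,9),(3,1),(3,2)], [(1,0),(2,9),(3,4),(3,5)],
   [(1,0),(2,10),(2,11),(3,3)], [(1,0),(2,10),(3,8),(3,11)], [(1,0),(2,11),(3,7),(3,10)],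
   [(2,0),(2,1),(3,1),(3,8)], [(2,0),(2,1),(3,2),(3,10)], [(2,0),(2,1),(3,3),(3,9)],
   [(2,0),(2,1),(3,6),(3,7)], [(2,0),(2,2),(3,0),(3,5)], [(2,0),(2,2),(3,1),(3,6)],
   [(2,0),(2,2),(3,2),(3,7)], [(2,0),(2,2),(3,4),(3,8)], [(2,0),(2,2),(3,9),(3,10)],
   [(2,0),(2,4),(3,0),(3,7)], [(2,0),(2,4),(3,1),(3,9)], [(2,0),(2,4),(3,3),(3,11)],
   [(2,0),(2,4),(3,4),(3,5)], [(2,0),(2,4),(3,6),(3,10)], [(2,0),(2,5),(3,0),(3,2)],
   [(2,0),(2,5),(3,1),(3,3)], [(2,0),(2,5),(3,4),(3,11)], [(2,0),(2,5),(3,5),(3,6)],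
   [(2,0),(2,5),(3,7),(3,9)], [(2,0),(2,5),(3,8),(3,10)]]"

definition short_orbits :: "(nat \<times> nat) list list" where
  "short_orbits = [
   [(1,0),(1,6),(2,0),(2,6)], [(1,0),(1,6),(2,1),(2,7)], [(1,0),(1,6),(3,0),(3,10)],
   [(1,0),(1,6),(3,1),(3,11)], [(1,0),(1,6),(3,2),(3,8)], [(1,0),(1,6),(3,3),(3,9)],
   [(1,0),(1,6),(3,4),(3,6)], [(1,0),(1,6),(3,5),(3,7)], [(2,0),(2,6),(3,0),(3,6)],
   [(2,0),(2,6),(3,1),(3,7)], [(2,0),(2,6),(3,2),(3,8)], [(2,0),(2,6),(3,3),(3,5)],
   [(2,0),(2,6),(3,4),(3,10)], [(2,0),(2,6),(3,9),(3,11)]]"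

definition blocks_38 :: "(nat \<times> nat) set set" where
  "blocks_38 = (\<lambda>(t,Q). shift t ` set Q) ` ({..<12} \<times> set long_orbits \<union> {..<6} \<times> set short_orbits)"

text \<open>Groups 1 and 2 have weight 1, so for \<open>i = 1\<close> and \<open>i = 2\<close>
  shifting by \<open>12 - snd x\<close> brings the point \<open>x\<close> to \<open>(i,0)\<close>.
  This yields all blocks through \<open>(i,0)\<close>.\<close>

definition blocks_through :: "nat \<Rightarrow> (nat \<times> nat) list list" where
  "blocks_through i = concat (map (\<lambda>Q. map (\<lambda>x. map (shift (12 - snd x)) Q) (filter (\<lambda>x. fst x = i) Q))
     (long_orbits @ short_orbits))"

definition covers_through :: "nat \<Rightarrow> (nat \<times> nat) list \<Rightarrow> (nat \<times> nat) list \<Rightarrow> bool" where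
  "covers_through i ys zs \<longleftrightarrow> list_all (pair_covered repeated (blocks_through i) zs (i,0)) ys"

text \<open>Every triple to be covered meets two groups, hence group 1 or group 2, and can be
  shifted so as to contain \<open>(1,0)\<close> or \<open>(2,0)\<close>. Triples that meet group 1
  are checked here, those over the stem and groups 2 and 3 in
  \<open>covers_through_2\<close>.\<close>

lemma covers_through_1: "covers_through 1 (List.product [2,3] [0..<12])
    ([(0,0),(0,1)] @ List.product [1,2,3] [0..<12])"
  by code_simp

lemma covers_through_2: "covers_through 2 (List.product [3] [0..<12])
    ([(0,0),(0,1)] @ List.product [2,3] [0..<12])"
  by code_simp

lemma length_orbits: "length long_orbits = 146" "length short_orbits = 14"
  by code_simp+

lemma length_block: "\<forall>Q\<in>set (long_orbits @ short_orbits). length Q = 4"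
  by code_simp

lemma short_orbits_shift: "\<forall>Q\<in>set short_orbits. list_all (\<lambda>x. x \<in> set Q) (map (shift 6) Q)"
  by code_simp

lemma orbits_level: "\<forall>Q\<in>set (long_orbits @ short_orbits). \<forall>u\<in>set Q. \<forall>v\<in>set Q.
    fst u \<noteq> 0 \<longrightarrow> fst v = fst u \<longrightarrow> snd v = (snd u + 6) mod 12 \<longrightarrow>
    (\<forall>x\<in>set Q. \<forall>y\<in>set Q. x = u \<or> x = v \<or> y = u \<or> y = v \<or> fst x = fst y)"
  by code_simp

lemma orbits_points: "\<forall>Q\<in>set (long_orbits @ short_orbits). \<forall>u\<in>set Q. snd u < 12"
  by code_simp

lemma fst_shift [simp]: "fst (shift t x) = fst x"
  by (simp add: shift_def)

lemma shift_shift: "shift t (shift u x) = shift (t + u) x"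
  by (simp add: shift_def mod_simps algebra_simps)

lemma shift_mod: "shift (t mod 12) x = shift t x"
proof -
  have "(a + t mod 12 * w) mod 12 = (a + t * w) mod 12" for a w :: nat
    by (metis mod_add_right_eq mod_mult_left_eq)
  then show ?thesis by (simp add: shift_def)
qed

lemma shift_0: "snd x < 12 \<Longrightarrow> shift 0 x = x"
  by (cases x) (simp add: shift_def)

lemma shift_inverse:
  assumes "snd x < 12" "a \<le> 12"
  shows "shift a (shift (12 - a) x) = x"
  using assms shift_mod[of 12 x] shift_0[of x] by (simp add: shift_shift)

text \<open>The shift amount matters modulo 12 for a long orbit and modulo 6 for a short
  one.\<close>

lemma shift_in_blocks_38:
  assumes "Q \<in> set (long_orbits @ short_orbits)"
  shows "shift t ` set Q \<in> blocks_38"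
proof (cases "Q \<in> set long_orbits")
  case True
  have "shift t ` set Q = shift (t mod 12) ` set Q" by (simp add: shift_mod)
  then show ?thesis unfolding blocks_38_def using True by (intro image_eqI[of _ _ "(t mod 12, Q)"]) auto
next
  case False
  then have Q: "Q \<in> set short_orbits" using assms by simp
  have sub: "shift 6 ` set Q \<subseteq> set Q" using short_orbits_shift Q by (auto simp: list_all_iff)
  have lt: "snd x < 12" if "x \<in> set Q" for x using orbits_points assms that by blast
  have "set Q \<subseteq> shift 6 ` set Q"
  proof
    fix x assume x: "x \<in> set Q"
    have "x = shift 6 (shift 6 x)" using shift_inverse[of x 6] lt[OF x] by simp
    then show "x \<in> shift 6 ` set Q" using sub x by blast
  qed
  then have eq: "shift 6 ` set Q = set Q" using sub by blast
  have "shift (6 * n + u) ` set Q = shift u ` set Q" for n u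
  proof (induction n)
    case (Suc n)
    have "shift (6 * Suc n + u) ` set Q = shift (6 * n + u) ` shift 6 ` set Q"
      unfolding image_image shift_shift by (simp add: algebra_simps)
    then show ?case using Suc eq by simp
  qed simp
  from this[of "t div 6" "t mod 6"] have "shift t ` set Q = shift (t mod 6) ` set Q" by simp
  then show ?thesis unfolding blocks_38_def using Q by (intro image_eqI[of _ _ "(t mod 6, Q)"]) auto
qed

lemma blocks_38E:
  assumes "U \<in> blocks_38"
  obtains t Q where "Q \<in> set (long_orbits @ short_orbits)" "U = shift t ` set Q"
  using assms unfolding blocks_38_def by auto

lemma set_product_range: "set (List.product xs [0..<12]) = set xs \<times> {..<12}"
  by (simp add: atLeast0LessThan)

text \<open>Shift the triple until its point of group \<open>i\<close> is \<open>(i,0)\<close>, take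
  a block from the finite check, and shift back.\<close>

lemma cover_through:
  assumes cov: "covers_through i ys zs" and y: "shift (12 - a) y \<in> set ys" and z: "shift (12 - a) z \<in> set zs"
    and a: "a < 12" and i: "i = 1 \<or> i = 2" and lt: "snd y < 12" "snd z < 12" and ne: "z \<noteq> y" "z \<noteq> (i,a)" "y \<noteq> (i,a)"
  shows "\<exists>U\<in>blocks_38. {(i,a),y,z} \<subseteq> U"
proof -
  let ?s = "shift (12 - a)"
  have inv: "shift a (?s x) = x" if "snd x < 12" for x using shift_inverse[OF that] a by simp
  have xa: "?s (i,a) = (i,0)" using i a by (auto simp: shift_def)
  have "?s z \<noteq> ?s y" using inv lt ne(1) by metis
  moreover have "?s z \<noteq> (i,0)" using inv[OF lt(2)] inv[of "(i,a)"] xa ne(2) a by auto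
  moreover have "?s y \<noteq> (i,0)" using inv[OF lt(1)] inv[of "(i,a)"] xa ne(3) a by auto
  ultimately have nr: "\<not> repeated (i,0) (?s y) (?s z)" by (auto simp: repeated_def)
  have pc: "pair_covered repeated (blocks_through i) zs (i,0) (?s y)"
    using cov y by (auto simp: covers_through_def list_all_iff)
  from pair_coveredD[OF pc z nr] obtain Q where Q: "Q \<in> set (blocks_through i)" "?s y \<in> set Q" "?s z \<in> set Q"
    by blast
  then obtain R x where R: "R \<in> set (long_orbits @ short_orbits)" "x \<in> set R" "fst x = i" "Q = map (shift (12 - snd x)) R"
    unfolding blocks_through_def by auto
  have "snd x < 12" using orbits_points R by blast
  then have "shift (12 - snd x) x = (i,0)" using R(3) i by (auto simp: shift_def)
  then have "(i,0) \<in> set Q" using R(2,4) by force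
  then have sub: "{(i,0), ?s y, ?s z} \<subseteq> set Q" using Q by simp
  have "{(i,a),y,z} = shift a ` {(i,0), ?s y, ?s z}"
    using inv[OF lt(1)] inv[OF lt(2)] inv[of "(i,a)"] xa a by simp
  also have "\<dots> \<subseteq> shift a ` set Q" using sub by blast
  also have "\<dots> = shift (a + (12 - snd x)) ` set R" unfolding R(4) by (simp add: image_image shift_shift)
  finally show ?thesis using shift_in_blocks_38[OF R(1)] by blast
qed

lemma exact_cover_38: "exact_cover blocks_38 (ctriples {1..3} 12 2)"
proof (rule exact_cover_ctriples_if_card)
  show "finite blocks_38" by (simp add: blocks_38_def)
  fix U assume "U \<in> blocks_38"
  then obtain t Q where Q: "Q \<in> set (long_orbits @ short_orbits)" "U = shift t ` set Q" by (rule blocks_38E)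
  have "card U \<le> card (set Q)" unfolding Q(2) by (rule card_image_le) simp
  also have "\<dots> \<le> 4" using length_block Q(1) card_length[of Q] by auto
  finally show "finite U \<and> card U \<le> 4" using Q(2) by simp
next
  have "card blocks_38 \<le> card ({..<12::nat} \<times> set long_orbits \<union> {..<6} \<times> set short_orbits)"
    unfolding blocks_38_def by (rule card_image_le) simp
  also have "\<dots> \<le> card ({..<12::nat} \<times> set long_orbits) + card ({..<6::nat} \<times> set short_orbits)" by (rule card_Un_le)
  also have "\<dots> \<le> 12 * 146 + 6 * 14"
    using card_length[of long_orbits] card_length[of short_orbits] by (simp add: card_cartesian_product length_orbits)
  finally have "4 * card blocks_38 \<le> 7344" by simp
  moreover have "int (card (ctriples {1..3} 12 2)) = 7344" unfolding card_ctriples_3 by simp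
  ultimately show "4 * card blocks_38 \<le> card (ctriples {1..3} 12 2)" by linarith
next
  fix T assume T: "T \<in> ctriples {1..3} 12 2"
  have sh: "snd (shift t x) < 12" for t x by (simp add: shift_def)
  have sh0: "shift t (0,l) = (0,l)" if "l < 2" for t l using that by (simp add: shift_def)
  have cov: "\<exists>U\<in>blocks_38. {(i,a),(j,b),(m,c)} \<subseteq> U"
    if cd: "i < j" "i \<in> {1,2,3}" "j \<in> {1,2,3}" "a < 12" "b < 12" "m = 0 \<and> c < 2 \<or> m \<in> {1,2,3} \<and> c < 12" "m = 0 \<or> i \<le> m"
      "(m,c) \<noteq> (i,a)" "(m,c) \<noteq> (j,b)" for i j m a b c
  proof -
    let ?s = "shift (12 - a)"
    have y: "?s (j,b) \<in> {j} \<times> {..<12}" using sh[of "12 - a" "(j,b)"] by (simp add: mem_Times_iff)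
    have z: "?s (m,c) \<in> {(0,0),(0,1)} \<union> {m} \<times> {..<12} \<and> (m = 0 \<longrightarrow> ?s (m,c) \<in> {(0,0),(0,1)})"
      using cd(6) sh0[of c "12 - a"] sh[of "12 - a" "(m,c)"] by (auto simp: mem_Times_iff less_2_cases_iff)
    have lt: "snd (j,b) < 12" "snd (m,c) < 12" using cd by auto
    consider "i = 1" "j \<in> {2,3}" | "i = 2" "j = 3" using cd(1-3) by auto
    then show ?thesis
    proof cases
      case 1
      have "?s (j,b) \<in> set (List.product [2,3] [0..<12])"
        using y 1 unfolding set_product_range by auto
      moreover have "?s (m,c) \<in> set ([(0,0),(0,1)] @ List.product [1,2,3] [0..<12])"
        using z cd(6) unfolding set_append set_product_range by auto
      ultimately show ?thesis unfolding 1(1)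
        by (rule cover_through[OF covers_through_1 _ _ cd(4) _ lt]) (use cd 1 in auto)
    next
      case 2
      have "?s (j,b) \<in> set (List.product [3] [0..<12])"
        using y 2 unfolding set_product_range by auto
      moreover have "?s (m,c) \<in> set ([(0,0),(0,1)] @ List.product [2,3] [0..<12])"
        using z cd(6,7) 2 unfolding set_append set_product_range by auto
      ultimately show ?thesis unfolding 2(1)
        by (rule cover_through[OF covers_through_2 _ _ cd(4) _ lt]) (use cd 2 in auto)
    qed
  qed
  have I: "i \<in> {1,2,3}" if "i \<in> {1..3}" for i :: nat using that by auto
  have nz: "0 \<notin> {1..3::nat}" by simp
  show "\<exists>U\<in>blocks_38. T \<subseteq> U" using T nz
  proof (cases rule: ctriples_cases)
    case (stem l i j a b)
    have "T = {(i,a),(j,b),(0,l)}" using stem(1) by blast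
    then show ?thesis using cov[of i j a b 0 l] stem I[of i] I[of j] by auto
  next
    case (two i j a a' b)
    show ?thesis
    proof (cases "i < j")
      case True
      have "T = {(i,a),(j,b),(i,a')}" using two(1) by blast
      then show ?thesis using cov[of i j a b i a'] two I[of i] I[of j] True by auto
    next
      case False
      have "T = {(j,b),(i,a),(i,a')}" using two(1) by blast
      then show ?thesis using cov[of j i b a i a'] two I[of i] I[of j] False by auto
    qed
  next
    case (three i j k a b c)
    then show ?thesis using cov[of i j a b k c] I[of i] I[of j] I[of k] by auto
  qed
qed

text \<open>Arranges that the points \<open>j\<close> and \<open>j + 6\<close> share a
  level.\<close>

definition half_turn :: "nat \<Rightarrow> nat" where
  "half_turn n = n div 2 + 6 * (n mod 2)"

lemma bij_half_turn: "bij_betw half_turn {0..<12} {0..<12}"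
proof -
  have "inj_on half_turn {0..<12}"
  proof (rule inj_on_inverseI[where g = "\<lambda>h. 2 * (h mod 6) + h div 6"])
    fix x :: nat assume "x \<in> {0..<12}"
    then have "x div 2 < 6" by auto
    then show "2 * (half_turn x mod 6) + half_turn x div 6 = x" by (simp add: half_turn_def)
  qed
  moreover have "half_turn ` {0..<12} \<subseteq> {0..<12}" by (auto simp: half_turn_def)
  ultimately show ?thesis by (simp add: bij_betw_def endo_inj_surj)
qed

text \<open>A shift moves all points of a group by the same amount, so distance 6 can be examined on
  the orbit representatives.\<close>

lemma level_strong_38: "level_strong half_turn 12 blocks_38"
  unfolding level_strong_def
proof (intro allI impI)
  fix i j x y assume i: "i \<noteq> 0" and j: "j < 12 div 2" and U: "{(i, half_turn (2*j)), (i, half_turn (2*j+1)), x, y} \<in> blocks_38"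
  have e: "half_turn (2*j) = j" "half_turn (2*j+1) = j + 6" using j by (auto simp: half_turn_def)
  have U': "{(i,j),(i,j+6),x,y} \<in> blocks_38" using U by (simp only: e)
  have ne: "x \<noteq> (i,j)" "x \<noteq> (i,j+6)" "y \<noteq> (i,j)" "y \<noteq> (i,j+6)"
    using card_4_distinct[of "(i,j)" "(i,j+6)" x y] exact_cover_38 U' unfolding exact_cover_def by auto
  obtain t Q where Q: "Q \<in> set (long_orbits @ short_orbits)" "{(i,j),(i,j+6),x,y} = shift t ` set Q"
    using U' by (rule blocks_38E)
  have "(i,j) \<in> shift t ` set Q" "(i,j+6) \<in> shift t ` set Q" "x \<in> shift t ` set Q" "y \<in> shift t ` set Q"
    unfolding Q(2)[symmetric] by simp_all
  then obtain u v x' y' where q: "u \<in> set Q" "v \<in> set Q" "x' \<in> set Q" "y' \<in> set Q"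
    "(i,j) = shift t u" "(i,j+6) = shift t v" "x = shift t x'" "y = shift t y'" by blast
  have f: "fst u = i" "fst v = i" using q(5,6) by (metis fst_conv fst_shift)+
  define w where "w = t * (if i = 0 then 0 else if i = 3 then 10 else 1)"
  have "j = (snd u + w) mod 12" "j + 6 = (snd v + w) mod 12" using q(5,6) f by (auto simp: shift_def w_def)
  then have "(snd v + w) mod 12 = ((snd u + w) mod 12 + 6) mod 12" using j by simp
  also have "\<dots> = (snd u + 6 + w) mod 12" unfolding mod_add_left_eq by (simp only: ac_simps)
  finally have "(int (snd v) + int w) mod 12 = (int (snd u + 6) + int w) mod 12"
    by (metis of_nat_add of_nat_numeral zmod_int)
  then have "int (snd v) mod 12 = int (snd u + 6) mod 12" by (simp add: mod_eq_dvd_iff)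
  then have "snd v mod 12 = ((snd u + 6) mod 12) mod 12"
    by (metis mod_mod_trivial of_nat_eq_iff of_nat_numeral zmod_int)
  then have "snd v = (snd u + 6) mod 12" using orbits_points Q(1) q(2) by (metis mod_less mod_mod_trivial)
  then have "x' = u \<or> x' = v \<or> y' = u \<or> y' = v \<or> fst x' = fst y'"
    using orbits_level Q(1) q(1-4) f i by metis
  then show "fst x = fst y" using q ne by auto
qed

text \<open>
  Invariant under a shift of order 7; the union of any two of the levels \<open>{2 * i, 2 * i + 1}\<close> is a block.
\<close>

definition blocks_14 :: "nat list list" where
  "blocks_14 = concat (map (\<lambda>t. map (map (\<lambda>x. 2 * ((x div 2 + t) mod 7) + x mod 2))
     [[0,2,4,10], [0,2,5,7], [0,2,6,9], [0,2,11,13], [0,3,4,11], [0,3,6,13], [0,3,7,9], [0,4,9,13], [0,5,6,11], [1,3,5,9]])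
     [0,1,2,3,4,5,6]) @
   concat (map (\<lambda>j. map (\<lambda>i. [2*i, 2*i+1, 2*j, 2*j+1]) [0..<j]) [0,1,2,3,4,5,6])"

lemma blocks_14_cover: "list_all (point_covered repeated blocks_14 [0..<14]) [0..<14]"
  by code_simp

lemma blocks_14_length: "length blocks_14 = 91" "\<forall>Q\<in>set blocks_14. length Q = 4"
  by code_simp+

text \<open>Each of the cyclically shifted blocks meets four different levels. Only the unions of
  two levels contain a whole level, and the other one lies entirely on one side of it.\<close>

lemma blocks_14_level: "\<forall>Q\<in>set blocks_14. \<forall>x\<in>set Q. \<forall>y\<in>set Q. even x \<longrightarrow> y = x + 1 \<longrightarrow>
    (\<forall>a\<in>set Q. a \<le> x + 1) \<or> (\<forall>a\<in>set Q. x \<le> a)"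
  by code_simp

text \<open>The rule \<open>12n - 10\<close> fills its groups of 12 points and stem of 2 with this
  system.\<close>

lemma steppable_14: "steppable 14"
proof -
  let ?S = "set ` set blocks_14"
  have ec: "exact_cover ?S (triples {0..<14})"
  proof (rule exact_cover_if_card)
    fix Q assume "Q \<in> ?S"
    then obtain l where l: "l \<in> set blocks_14" "Q = set l" by auto
    then have "card Q \<le> 4" using blocks_14_length(2) card_length[of l] by auto
    then show "finite Q \<and> card Q \<le> 4" using l by simp
  next
    fix T assume "T \<in> triples {0..<14::nat}"
    then have T: "T \<subseteq> {0..<14}" "card T = 3" by (auto simp: triples_def)
    then obtain x y z where xyz: "T = {x,y,z}" "x \<noteq> y" "y \<noteq> z" "x \<noteq> z" by (metis card_3_iff)
    then have "x \<in> {0..<14}" "y \<in> {0..<14}" "z \<in> {0..<14}" using T by auto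
    then have "\<exists>Q\<in>set blocks_14. x \<in> set Q \<and> y \<in> set Q \<and> z \<in> set Q"
      using point_coveredD[of repeated blocks_14 "[0..<14]" x y z] blocks_14_cover xyz(2-4)
      by (auto simp: list_all_iff repeated_def)
    then show "card T = 3 \<and> (\<exists>Q\<in>?S. T \<subseteq> Q)" using T xyz by auto
  next
    have "card ?S \<le> length blocks_14" using card_image_le[of "set blocks_14" set] card_length[of blocks_14] by simp
    moreover have "int (card (triples {0..<14::nat})) = 364"
      using int_choose_3[of 14] by (simp add: card_triples)
    ultimately show "4 * card ?S \<le> card (triples {0..<14::nat})" using blocks_14_length(1) by linarith
  qed simp
  have "stepped 14 ?S id" unfolding stepped_def
  proof (intro allI impI)
    fix t a b :: nat assume Q: "{id (2*t), id (2*t+1), id a, id b} \<in> ?S"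
    then obtain l where l: "l \<in> set blocks_14" "{2*t, 2*t+1, a, b} = set l" by auto
    have d: "a \<noteq> 2*t" "a \<noteq> 2*t+1" "b \<noteq> 2*t" "b \<noteq> 2*t+1"
      using card_4_distinct[of "2*t" "2*t+1" a b] ec Q unfolding exact_cover_def by auto
    have "(\<forall>a\<in>set l. a \<le> 2*t + 1) \<or> (\<forall>a\<in>set l. 2*t \<le> a)"
      using bspec[OF bspec[OF bspec[OF blocks_14_level l(1)], of "2*t"], of "2*t+1"] l(2) by auto
    then show "a < 2*t \<and> b < 2*t \<or> 2*t+1 < a \<and> 2*t+1 < b" using d unfolding l(2)[symmetric] by auto
  qed
  then show ?thesis using ec unfolding steppable_def by blast
qed

section \<open>The recursion\<close>

lemma steppable_2: "steppable 2"
proof -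
  have "triples {0..<2::nat} = {}"
  proof -
    have "card T \<noteq> 3" if "T \<subseteq> {0..<2::nat}" for T
      using card_mono[OF _ that] by simp
    then show ?thesis unfolding triples_def by blast
  qed
  then have "exact_cover {} (triples {0..<2::nat})" by (simp add: exact_cover_def)
  then show ?thesis unfolding steppable_def by (auto simp: stepped_def)
qed

lemma exact_cover_4: "exact_cover {{0..<4}} (triples {0..<4::nat})"
proof -
  have "T \<subseteq> {0..<4::nat} \<Longrightarrow> \<exists>!Q. Q \<in> {{0..<4}} \<and> T \<subseteq> Q" for T by blast
  then show ?thesis by (auto simp: exact_cover_def triples_def)
qed

lemma steppable_4: "steppable 4"
proof -
  have "stepped 4 {{0..<4}} id" unfolding stepped_def
  proof (intro allI impI)
    fix t a b :: nat assume t: "t < 4 div 2" and Q: "{id (2*t), id (2*t+1), id a, id b} \<in> {{0..<4}}"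
    have "card {2*t, 2*t+1, a, b} = 4" using Q by simp
    from card_4_distinct[OF this] have d: "a \<noteq> 2*t" "a \<noteq> 2*t+1" "b \<noteq> 2*t" "b \<noteq> 2*t+1" by auto
    have "{2*t, 2*t+1, a, b} = {0..<4}" using Q by simp
    then have "a < 4" "b < 4" by auto
    moreover have "t = 0 \<or> t = 1" using t by auto
    ultimately show "a < 2*t \<and> b < 2*t \<or> 2*t+1 < a \<and> 2*t+1 < b" using d by auto
  qed
  then show ?thesis using exact_cover_4 unfolding steppable_def by blast
qed

lemma steppable_spread:
  assumes C: "exact_cover C (ctriples {1..3} g s)" and p: "bij_betw p {0..<g} {0..<g}" "level_strong p g C"
    and g: "g > 0" "even g" and s: "s = 2 \<or> s = 4"
    and A: "exact_cover A (triples {0..<n})" and n: "n \<ge> 2" and gs: "steppable (g + s)"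
  shows "steppable (s + (n - 1) * g)"
proof -
  obtain A' where A': "exact_cover A' (triples {0..<g+s})" "stepped (g+s) A' id"
    using gs unfolding steppable_def by blast
  have I: "{1..<n} = {1..n-1}" using n by auto
  have ok: "level_ok p g (spread A g C)"
    using level_ok_spread[OF A C g(1) p(1)] p(2) unfolding level_strong_def by blast
  \<comment> \<open>A stem of two points contains no triple. A stem of four points is a block by
    \<open>first_block\<close>, hence the only block through any of its triples.\<close>
  have closed: "Q \<subseteq> {0..<s}" if Q: "Q \<in> A'" "T \<in> triples Q" "T \<subseteq> {0..<s}" for Q T
  proof -
    have c: "card T = 3" "T \<subseteq> Q" using Q by (auto simp: triples_def)
    have "card T \<le> s" using card_mono[OF _ Q(3)] by simp
    then have s4: "s = 4" using s c by auto
    have "{0..<4} \<in> A'" by (rule first_block[OF A']) (use s4 in simp)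
    moreover have "T \<in> triples {0..<g+s}" using Q A'(1) unfolding exact_cover_def by blast
    ultimately have "Q = {0..<4}" using A'(1) Q c s4 unfolding exact_cover_def by blast
    then show ?thesis using s4 by simp
  qed
  show ?thesis
    by (rule steppable_filled[OF exact_cover_spread[OF A C g(1), unfolded I] _ g _ p(1) A' closed ok])
      (use n s in auto)
qed

text \<open>The case \<open>p = 0\<close> of \<open>tripling\<close> with groups of two points, each
  of them a single level.\<close>

lemma steppable_double: "steppable n \<Longrightarrow> n \<ge> 2 \<Longrightarrow> steppable (2 * n)"
proof -
  assume n: "steppable n" "n \<ge> 2"
  obtain C q where C: "exact_cover C (ctriples {1..3} 2 2)" "bij_betw q {0..<2} {0..<2}" "level_strong q 2 C"
    using tripling[of 2 0 2] by auto
  obtain A where A: "exact_cover A (triples {0..<n})" using n unfolding steppable_def by blast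
  have "steppable (2 + (n - 1) * 2)" using steppable_spread[OF C _ _ _ A n(2)] steppable_4 by simp
  moreover have "2 + (n - 1) * 2 = 2 * n" using n by simp
  ultimately show ?thesis by simp
qed

text \<open>Spreading over the single block on four points leaves three groups. With
  \<open>n = g + s\<close> the order is \<open>3n - 4\<close> for \<open>s = 2\<close> and
  \<open>3n - 8\<close> for \<open>s = 4\<close>.\<close>

lemma steppable_triple:
  assumes "steppable (g + s)" "g = 6*p + s" "s = 2 \<or> s = 4"
  shows "steppable (s + 3 * g)"
proof -
  obtain C q where C: "exact_cover C (ctriples {1..3} g s)" "bij_betw q {0..<g} {0..<g}" "level_strong q g C"
    using tripling[OF assms(2)] assms(3) by auto
  have "steppable (s + (4 - 1) * g)"
    by (rule steppable_spread[OF C _ _ assms(3) exact_cover_4 _ assms(1)]) (use assms in auto)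
  then show ?thesis by simp
qed

lemma steppable_quadruple:
  assumes "steppable (g + 2)" "even g" "g > 0"
  shows "steppable (2 + 4 * g)"
proof -
  obtain k where k: "g = 2*k" using assms(2) by (rule evenE)
  obtain C where C: "exact_cover C (ctriples {1..4} g 2)" "level_ok id g C"
    using quadrupling[OF k] assms(3) k by auto
  obtain A where A: "exact_cover A (triples {0..<g+2})" "stepped (g+2) A id"
    using assms(1) unfolding steppable_def by blast
  have closed: "Q \<subseteq> {0..<2}" if Q: "T \<in> triples Q" "T \<subseteq> {0..<2::nat}" for Q T
    using card_mono[OF _ Q(2)] Q(1) by (simp add: triples_def)
  have "bij_betw id {0..<g} {0..<g}" by simp
  then show ?thesis
    by (intro steppable_filled[OF C(1) _ assms(3,2) _ _ A _ C(2)]) (use closed in auto)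
qed

lemma steppable_dozen:
  assumes "steppable n" "n \<ge> 2"
  shows "steppable (2 + (n - 1) * 12)"
proof -
  obtain A where "exact_cover A (triples {0..<n})" using assms unfolding steppable_def by blast
  then show ?thesis
    using steppable_spread[OF exact_cover_38 bij_half_turn level_strong_38] steppable_14 assms by simp
qed

section \<open>Groups of three points: the order 3n - 2\<close>

text \<open>A candelabra system with stem 1, invariant under rotating the three groups cyclically.
  The 6 in the first family stands for 0 modulo 3 and keeps the subtraction from being
  truncated.\<close>

definition blocks_10 :: "(nat \<times> nat) list list" where
  "blocks_10 =
     concat (map (\<lambda>a. map (\<lambda>b. [(0,0),(1,a),(2,b),(3,(6-a-b) mod 3)]) [0,1,2]) [0,1,2]) @
     concat (map (\<lambda>a. map (\<lambda>(i,j,k). [(i,a),(j,a),(k,(a+1) mod 3),(k,(a+2) mod 3)]) [(1,2,3),(2,3,1),(3,1,2)]) [0,1,2]) @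
     concat (map (\<lambda>a. map (\<lambda>(i,j). [(i,a),(j,a),(i,(a+1) mod 3),(j,(a+1) mod 3)]) [(1,2),(2,3),(3,1)]) [0,1,2])"

definition in_one_group :: "nat \<times> nat \<Rightarrow> nat \<times> nat \<Rightarrow> nat \<times> nat \<Rightarrow> bool" where
  "in_one_group x y z \<longleftrightarrow> repeated x y z \<or>
     list_ex (\<lambda>i. fst x \<in> {0,i} \<and> fst y \<in> {0,i} \<and> fst z \<in> {0,i}) [1,2,3]"

lemma blocks_10_cover:
  "list_all (point_covered in_one_group blocks_10 ((0,0) # List.product [1,2,3] [0..<3])) ((0,0) # List.product [1,2,3] [0..<3])"
  by code_simp

lemma blocks_10_length: "length blocks_10 = 27" "\<forall>Q\<in>set blocks_10. length Q = 4"
  by code_simp+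

text \<open>Two points with equal coordinates in different groups are a potential level. The rest of
  the block avoids both groups, or is another such pair in the same two groups.\<close>

lemma blocks_10_level: "\<forall>Q\<in>set blocks_10. \<forall>u\<in>set Q. \<forall>v\<in>set Q.
    fst u \<noteq> 0 \<longrightarrow> fst v \<noteq> 0 \<longrightarrow> fst u \<noteq> fst v \<longrightarrow> snd u = snd v \<longrightarrow>
    (\<forall>x\<in>set Q. \<forall>y\<in>set Q. x = u \<or> x = v \<or> y = u \<or> y = v \<or> x = y \<or>
      (fst x \<notin> {fst u, fst v} \<and> fst y \<notin> {fst u, fst v}) \<or>
      (fst x \<in> {fst u, fst v} \<and> fst y \<in> {fst u, fst v} \<and> snd x = snd y))"
  by code_simp

lemma exact_cover_10: "exact_cover (set ` set blocks_10) (ctriples {1..3} 3 1)"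
proof (rule exact_cover_ctriples_if_card)
  fix Q assume "Q \<in> set ` set blocks_10"
  then obtain l where l: "l \<in> set blocks_10" "Q = set l" by auto
  then have "card Q \<le> 4" using blocks_10_length(2) card_length[of l] by auto
  then show "finite Q \<and> card Q \<le> 4" using l by simp
next
  have "card (set ` set blocks_10) \<le> length blocks_10"
    using card_image_le[of "set blocks_10" set] card_length[of blocks_10] by simp
  moreover have "int (card (ctriples {1..3} 3 1)) = 108" unfolding card_ctriples_3 by simp
  ultimately show "4 * card (set ` set blocks_10) \<le> card (ctriples {1..3} 3 1)"
    using blocks_10_length(1) by linarith
next
  fix T assume "T \<in> ctriples {1..3} 3 1"
  then have T: "T \<subseteq> pts {1..3} 3 1" "card T = 3" "\<And>i. \<not> T \<subseteq> pts {i} 3 1"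
    by (auto simp: ctriples_def triples_def)
  obtain x y z where xyz: "T = {x,y,z}" "x \<noteq> y" "y \<noteq> z" "x \<noteq> z" using T(2) by (metis card_3_iff)
  let ?P = "(0,0) # List.product [1,2,3] [0..<3] :: (nat \<times> nat) list"
  have "{1..3} = {1,2,3::nat}" by auto
  then have "pts {1..3} 3 1 = set ?P" unfolding pts_def by auto
  then have m: "x \<in> set ?P" "y \<in> set ?P" "z \<in> set ?P" using T(1) xyz(1) by auto
  have ng: "\<not> (fst x \<in> {0,i} \<and> fst y \<in> {0,i} \<and> fst z \<in> {0,i})" for i
  proof
    assume i: "fst x \<in> {0,i} \<and> fst y \<in> {0,i} \<and> fst z \<in> {0,i}"
    have "w \<in> pts {i} 3 1" if "w \<in> pts {1..3} 3 1" "fst w \<in> {0,i}" for w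
      using that by (auto simp: pts_def)
    then have "T \<subseteq> pts {i} 3 1" using i T(1) xyz(1) by blast
    then show False using T(3) by blast
  qed
  have "\<not> in_one_group x y z"
    unfolding in_one_group_def repeated_def list_ex_iff using ng xyz(2-4) by blast
  moreover have "point_covered in_one_group blocks_10 ?P x" using blocks_10_cover m(1) unfolding list_all_iff by blast
  ultimately have "\<exists>Q\<in>set blocks_10. x \<in> set Q \<and> y \<in> set Q \<and> z \<in> set Q"
    using point_coveredD[OF _ m(2,3)] by blast
  then show "\<exists>Q\<in>set ` set blocks_10. T \<subseteq> Q" using xyz(1) by auto
qed simp

text \<open>
  Groups of three points have no levels of their own: the levels consist of equal coordinates in the
  groups \<open>2 * h\<close> and \<open>2 * h + 1\<close>, while group 1 is paired up with the stem point.
\<close>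

definition triad_order :: "nat \<Rightarrow> nat \<times> nat" where
  "triad_order a = (if a = 0 then (0,0) else if a < 4 then (1, a - 1)
     else (2 * ((a + 2) div 6) + a mod 2, (a + 2) mod 6 div 2))"

text \<open>From position 4 on, six consecutive positions hold the groups \<open>2*h\<close> and
  \<open>2*h+1\<close>. Adding 2 aligns these runs with multiples of 6, starting at
  \<open>h = 1\<close>; \<open>e\<close> selects the group and \<open>i\<close> is the
  coordinate.\<close>

lemma triad_order_formE:
  assumes "a \<ge> 4"
  obtains h i e where "h \<ge> 1" "i < 3" "e < 2" "a + 2 = 6*h + 2*i + e" "triad_order a = (2*h+e, i)"
proof
  show "(a + 2) div 6 \<ge> 1" "(a + 2) mod 6 div 2 < 3" "a mod 2 < 2" using assms by auto
  show "a + 2 = 6 * ((a + 2) div 6) + 2 * ((a + 2) mod 6 div 2) + a mod 2" by presburger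
  show "triad_order a = (2 * ((a + 2) div 6) + a mod 2, (a + 2) mod 6 div 2)"
    using assms by (simp add: triad_order_def)
qed

lemma triad_order_form:
  assumes "h \<ge> 1" "i < 3" "e < 2" "a + 2 = 6*h + 2*i + e"
  shows "triad_order a = (2*h+e, i)"
proof -
  have "a \<ge> 4" using assms by linarith
  moreover have "(a + 2) div 6 = h" "(a + 2) mod 6 = 2*i + e"
  proof -
    have x: "(6*h + x) div 6 = h" "(6*h + x) mod 6 = x" if "x < 6" for x using that by auto
    have "2*i + e < 6" using assms(2,3) by linarith
    from x[OF this] show "(a + 2) div 6 = h" "(a + 2) mod 6 = 2*i + e"
      unfolding assms(4) by (simp_all only: add.assoc)
  qed
  moreover have "(2*i + e) div 2 = i" using assms(3) by simp
  moreover have "a mod 2 = e" using assms(3,4) by presburger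
  ultimately show ?thesis by (simp add: triad_order_def)
qed

lemma triad_order_small: "a < 4 \<Longrightarrow> fst (triad_order a) \<le> 1"
  by (simp add: triad_order_def)

lemma triad_order_large: "a \<ge> 4 \<Longrightarrow> fst (triad_order a) \<ge> 2"
  by (erule triad_order_formE) simp

lemma triad_order_inj: "triad_order a = triad_order b \<Longrightarrow> a = b"
proof -
  assume eq: "triad_order a = triad_order b"
  then have "a < 4 \<longleftrightarrow> b < 4"
    using triad_order_small triad_order_large by (metis not_less numeral_2_eq_2 One_nat_def Suc_n_not_le_n le_trans)
  then consider "a < 4" "b < 4" | "a \<ge> 4" "b \<ge> 4" by linarith
  then show "a = b"
  proof cases
    case 1 then show ?thesis using eq by (auto simp: triad_order_def split: if_splits)
  next
    case 2
    obtain h i e where a: "i < 3" "e < 2" "a + 2 = 6*h + 2*i + e" "triad_order a = (2*h+e, i)" using 2(1) by (rule triad_order_formE)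
    obtain h' i' e' where b: "i' < 3" "e' < 2" "b + 2 = 6*h' + 2*i' + e'" "triad_order b = (2*h'+e', i')" using 2(2) by (rule triad_order_formE)
    have "2*h+e = 2*h'+e'" "i = i'" using eq a b by auto
    moreover from this have "h = h'" "e = e'" using a(2) b(2) by presburger+
    ultimately show ?thesis using a b by linarith
  qed
qed

lemma triad_order_bij:
  assumes "even n" "n \<ge> 2"
  shows "bij_betw triad_order {0..<3*n-2} (pts {1..<n} 3 1)"
proof -
  have inj: "inj_on triad_order {0..<3*n-2}" using triad_order_inj by (auto simp: inj_on_def)
  have "triad_order a \<in> pts {1..<n} 3 1" if "a < 3*n-2" for a
  proof (cases "a < 4")
    case True
    then show ?thesis using assms(2) by (auto simp: triad_order_def pts_def)
  next
    case False
    then have "a \<ge> 4" by simp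
    then obtain h i e where a: "h \<ge> 1" "i < 3" "e < 2" "a + 2 = 6*h + 2*i + e" "triad_order a = (2*h+e, i)" by (rule triad_order_formE)
    obtain m where m: "n = 2*m" using assms(1) by (rule evenE)
    have "6*h < 6*m" using a(4) that m by linarith
    then have "h < m" by simp
    then have "2*h+e < n" using a(3) m by linarith
    then show ?thesis using a by (auto simp: pts_def)
  qed
  then have sub: "triad_order ` {0..<3*n-2} \<subseteq> pts {1..<n} 3 1" by auto
  have "card (triad_order ` {0..<3*n-2}) = 3*n-2" using card_image[OF inj] by simp
  also have "\<dots> = card (pts {1..<n} 3 1)" using assms(2) by (subst card_pts) auto
  finally have "triad_order ` {0..<3*n-2} = pts {1..<n} 3 1"
    using card_subset_eq[OF _ sub] by (simp add: finite_pts)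
  then show ?thesis using inj by (simp add: bij_betw_def)
qed

text \<open>Positions 0 to 3 hold the stem and group 1; since \<open>n\<close> is even, the other
  groups pair up. A later level projects onto the level \<open>{2*h, 2*h+1}\<close> of
  \<open>A\<close>. If the underlying block \<open>X\<close> avoids 0, its step property carries
  over. If it contains 0, its fourth point must lie below the level like 0 itself, and
  \<open>blocks_10_level\<close> settles the rest.\<close>

lemma steppable_triad:
  assumes "steppable n" "even n" "n \<ge> 2"
  shows "steppable (3 * n - 2)"
proof -
  obtain A where A: "exact_cover A (triples {0..<n})" "stepped n A id"
    using assms(1) unfolding steppable_def by blast
  let ?C = "spread A 3 (set ` set blocks_10)" and ?L = triad_order
  let ?F = "filled {1..<n} id 1 ?C {{0..<4}}"
  have C: "exact_cover ?C (ctriples {1..<n} 3 1)" by (rule exact_cover_spread[OF A(1) exact_cover_10]) simp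
  have bij: "bij_betw ?L {0..<3*n-2} (pts {1..<n} 3 1)" using triad_order_bij assms by blast
  have A4: "exact_cover {{0..<4}} (triples {0..<3+1::nat})" using exact_cover_4 by simp
  have closed: "Q \<subseteq> {0..<1}" if Q: "T \<in> triples Q" "T \<subseteq> {0..<1::nat}" for Q T
    using card_mono[OF _ Q(2)] Q(1) by (simp add: triples_def)
  have bid: "bij_betw id {0..<3} {0..<3::nat}" by simp
  have F: "exact_cover ?F (triples (pts {1..<n} 3 1))"
    by (rule exact_cover_filled[OF C _ _ A4 bid closed]) (use assms(3) in auto)
  have AX: "card X = 4" "X \<subseteq> {0..<n}" if "X \<in> A" for X
    using A(1) exact_cover_subset[OF A(1) _ that] that by (auto simp: exact_cover_def triples_def)
  have "stepped (3*n-2) ?F ?L" unfolding stepped_def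
  proof (intro allI impI)
    fix t a b assume t: "t < (3*n-2) div 2" and a: "a < 3*n-2" and b: "b < 3*n-2"
      and Q: "{?L (2*t), ?L (2*t+1), ?L a, ?L b} \<in> ?F"
    have "card {?L (2*t), ?L (2*t+1), ?L a, ?L b} = 4" using F Q unfolding exact_cover_def by blast
    note d = card_4_distinct[OF this]
    then have ne: "a \<noteq> 2*t" "a \<noteq> 2*t+1" "b \<noteq> 2*t" "b \<noteq> 2*t+1" "a \<noteq> b" by auto
    consider (C) "{?L (2*t), ?L (2*t+1), ?L a, ?L b} \<in> ?C" |
      (E) x where "{?L (2*t), ?L (2*t+1), ?L a, ?L b} = embed id 1 x ` {0..<4}"
      using Q unfolding filled_def by blast
    note cs = this
    consider "t = 0" | "t = 1" | "t \<ge> 2" by linarith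
    then show "a < 2*t \<and> b < 2*t \<or> 2*t+1 < a \<and> 2*t+1 < b"
    proof cases
      \<comment> \<open>Nothing lies below the lowest level.\<close>
      case 1 then show ?thesis using ne by auto
    next
      case t1: 2
      have L23: "?L (2*t) = (1,1)" "?L (2*t+1) = (1,2)" using t1 by (auto simp: triad_order_def)
      have in1: "?L c \<in> pts {1} 3 1" if "c < 4" for c
        using that by (auto simp: triad_order_def pts_def)
      from cs show ?thesis
      proof cases
        case C2: C
        \<comment> \<open>Besides two points of group 1, a block of the candelabra system has no
          point in that group or the stem, and all other groups come later.\<close>
        have ge: "c \<ge> 4" if "{(1,1),(1,2),?L c,?L c'} \<in> ?C" "card {(1,1),(1,2),?L c} = 3" for c c'
        proof (rule ccontr)
          assume "\<not> c \<ge> 4"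
          then have "?L c \<in> pts {1} 3 1" using in1 by simp
          then show False using candelabra_not_in_group[OF C that, of 1] by (simp add: pts_def)
        qed
        have "{(1,1),(1,2),?L a,?L b} \<in> ?C" "{(1,1),(1,2),?L b,?L a} \<in> ?C"
          using C2 unfolding L23 by (simp_all add: insert_commute)
        moreover have "card {(1,1),(1,2),?L a} = 3" "card {(1,1),(1,2),?L b} = 3" using d unfolding L23 by auto
        ultimately have "a \<ge> 4" "b \<ge> 4" using ge by blast+
        then show ?thesis using t1 by simp
      next
        case (E x)
        have fE: "fst y \<in> {0,x}" if "y \<in> embed id 1 x ` {0..<4}" for y using that by (auto simp: embed_def)
        have "fst y \<in> {0,x}" if "y \<in> {?L (2*t), ?L (2*t+1), ?L a, ?L b}" for y using fE that unfolding E .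
        then have "fst (?L (2*t)) \<in> {0,x}" "fst (?L a) \<in> {0,x}" "fst (?L b) \<in> {0,x}" by blast+
        then have "fst (?L a) \<le> 1" "fst (?L b) \<le> 1" unfolding L23 by auto
        then have "a < 4" "b < 4" using triad_order_large[of a] triad_order_large[of b] by linarith+
        then show ?thesis using ne t1 by auto
      qed
    next
      case t2: 3
      define h where "h = (t+1) div 3"
      define i where "i = (t+1) mod 3"
      have hi: "h \<ge> 1" "i < 3" "t + 1 = 3*h + i" using t2 by (auto simp: h_def i_def)
      have L1: "?L (2*t) = (2*h+0, i)" by (rule triad_order_form) (use hi in auto)
      have L2: "?L (2*t+1) = (2*h+1, i)" by (rule triad_order_form) (use hi in auto)
      have lower: "c < 2*t" if "fst (?L c) < 2*h" for c
      proof (cases "c < 4")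
        case False
        then have "c \<ge> 4" by simp
        then obtain h' i' e' where c: "i' < 3" "e' < 2" "c + 2 = 6*h' + 2*i' + e'" "?L c = (2*h'+e', i')" by (rule triad_order_formE)
        then have "h' < h" using that by simp
        then show ?thesis using c hi by linarith
      qed (use t2 in linarith)
      have upper: "c > 2*t+1" if "fst (?L c) > 2*h+1" for c
      proof -
        have "c \<ge> 4" using triad_order_small[of c] that by (meson leD leI le_add2 le_less_trans)
        then obtain h' i' e' where c: "i' < 3" "e' < 2" "c + 2 = 6*h' + 2*i' + e'" "?L c = (2*h'+e', i')" by (rule triad_order_formE)
        then have "h' > h" using that by simp
        then show ?thesis using c hi by linarith
      qed
      \<comment> \<open>Inside a pair of groups the position is governed by the coordinate first and
        by the group second.\<close>
      have same: "c + 2 = 6*h + 2 * snd (?L c) + (fst (?L c) - 2*h)" if "fst (?L c) \<in> {2*h, 2*h+1}" for c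
      proof -
        have "fst (?L c) > 1" using that hi by auto
        then have "c \<ge> 4" using triad_order_small[of c] by (meson leD leI)
        then obtain h' i' e' where c: "i' < 3" "e' < 2" "c + 2 = 6*h' + 2*i' + e'" "?L c = (2*h'+e', i')" by (rule triad_order_formE)
        then have "2*h'+e' = 2*h \<or> 2*h'+e' = 2*h+1" using that by auto
        then have "h' = h" using c(2) by presburger
        then show ?thesis using c by simp
      qed
      \<comment> \<open>A block filled in for one group does not contain points of both
        \<open>2*h\<close> and \<open>2*h+1\<close>.\<close>
      from cs have CC: "{?L (2*t), ?L (2*t+1), ?L a, ?L b} \<in> ?C"
      proof cases
        case (E x)
        have fE: "fst y \<in> {0,x}" if "y \<in> embed id 1 x ` {0..<4}" for y using that by (auto simp: embed_def)
        have "fst y \<in> {0,x}" if "y \<in> {?L (2*t), ?L (2*t+1), ?L a, ?L b}" for y using fE that unfolding E .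
        then have "fst (?L (2*t)) \<in> {0,x}" "fst (?L (2*t+1)) \<in> {0,x}" by blast+
        then show ?thesis unfolding L1 L2 using hi by auto
      qed
      then obtain X where X: "X \<in> A" "{?L (2*t), ?L (2*t+1), ?L a, ?L b} \<in>
          (if 0 \<in> X then (`) (map_prod ((!) (sorted_list_of_set X)) id) ` (set ` set blocks_10) else transversals X 3)"
        unfolding spread_def by (rule UN_E)
      have stepX: "z < 2*h \<and> w < 2*h \<or> z > 2*h+1 \<and> w > 2*h+1" if "X = {2*h, 2*h+1, z, w}" for z w
      proof -
        have "X \<subseteq> {0..<n}" using AX X by blast
        then have "2*h+1 < n" "z < n" "w < n" using that by auto
        moreover from this have "h < n div 2" by linarith
        ultimately show ?thesis using A(2)[unfolded stepped_def, rule_format, of h z w] X(1) that by simp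
      qed
      show ?thesis
      proof (cases "0 \<in> X")
        case False
        then have "{?L (2*t), ?L (2*t+1), ?L a, ?L b} \<in> transversals X 3" using X(2) by simp
        then obtain f where f: "{?L (2*t), ?L (2*t+1), ?L a, ?L b} = (\<lambda>x. (x, f x)) ` X" unfolding transversals_def by blast
        then have "fst ` {?L (2*t), ?L (2*t+1), ?L a, ?L b} = fst ` (\<lambda>x. (x, f x)) ` X" by simp
        then have "X = {2*h, 2*h+1, fst (?L a), fst (?L b)}" unfolding L1 L2 by (simp add: image_image)
        from stepX[OF this] show ?thesis using lower upper by blast
      next
        case True
        let ?e = "(!) (sorted_list_of_set X)"
        note e = nth_sorted_block[OF AX(1)[OF X(1)] True]
        obtain R where R: "R \<in> set blocks_10" "{?L (2*t), ?L (2*t+1), ?L a, ?L b} = map_prod ?e id ` set R"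
          using X(2) True by auto
        have Rp: "set R \<subseteq> insert 0 {1..3} \<times> UNIV"
          using exact_cover_subset[OF exact_cover_10, of "pts {1..3} 3 1" "set R"] R(1)
          by (auto simp: ctriples_def triples_def pts_def)
        have im: "?L (2*t) \<in> map_prod ?e id ` set R" "?L (2*t+1) \<in> map_prod ?e id ` set R"
          "?L a \<in> map_prod ?e id ` set R" "?L b \<in> map_prod ?e id ` set R"
          unfolding R(2)[symmetric] by simp_all
        obtain u where u: "?L (2*t) = map_prod ?e id u" "u \<in> set R" using im(1) by (rule imageE)
        obtain v where v: "?L (2*t+1) = map_prod ?e id v" "v \<in> set R" using im(2) by (rule imageE)
        obtain x where x: "?L a = map_prod ?e id x" "x \<in> set R" using im(3) by (rule imageE)
        obtain y where y: "?L b = map_prod ?e id y" "y \<in> set R" using im(4) by (rule imageE)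
        have fu: "?e (fst u) = 2*h" "?e (fst v) = 2*h+1" "snd u = i" "snd v = i"
          using u(1) v(1) unfolding L1 L2 by (auto simp: map_prod_def split: prod.splits)
        have fx: "fst (?L a) = ?e (fst x)" "snd (?L a) = snd x" "fst (?L b) = ?e (fst y)" "snd (?L b) = snd y"
          using x(1) y(1) by (auto simp: map_prod_def split: prod.splits)
        have uv: "fst u \<noteq> 0" "fst v \<noteq> 0" "fst u \<noteq> fst v" "snd u = snd v"
        proof -
          show "fst u \<noteq> 0" using fu(1) e(2) hi(1) by (intro notI) simp
          show "fst v \<noteq> 0" using fu(2) e(2) by (intro notI) simp
          show "fst u \<noteq> fst v" using fu(1,2) by (intro notI) simp
          show "snd u = snd v" using fu(3,4) by simp
        qed
        have ne': "x \<noteq> u" "x \<noteq> v" "y \<noteq> u" "y \<noteq> v" "x \<noteq> y" using d u v x y by metis+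
        have dom: "fst w \<in> insert 0 {1..3}" if "w \<in> set R" for w using Rp that by auto
        have einj: "?e (fst w) = ?e (fst w') \<Longrightarrow> fst w = fst w'" if "w \<in> set R" "w' \<in> set R" for w w'
          using inj_onD[OF e(1) _ dom[OF that(1)] dom[OF that(2)]] .
        have eX: "?e (fst w) \<in> X" if "w \<in> set R" for w
          using dom[OF that] e(2,3) True by (metis DiffD1 image_eqI insertE)
        \<comment> \<open>Groups of \<open>X\<close> outside the level have index 0 or the fourth
          point of \<open>X\<close>. The step property of \<open>A\<close> puts the latter below
          \<open>2*h\<close>, because 0 is there.\<close>
        have low: "?e (fst w) < 2*h" if w: "w \<in> set R" "fst w \<notin> {fst u, fst v}" for w
        proof -
          have ew: "?e (fst w) \<noteq> 2*h" "?e (fst w) \<noteq> 2*h+1" using einj[OF w(1) u(2)] einj[OF w(1) v(2)] w(2) fu by auto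
          have "2*h \<in> X" "2*h+1 \<in> X" using eX[OF u(2)] eX[OF v(2)] fu by auto
          then have sub: "{2*h, 2*h+1, 0} \<subseteq> X" using True by blast
          have "card (X - {2*h, 2*h+1, 0}) = 1" using AX(1)[OF X(1)] sub hi(1) by (subst card_Diff_subset) auto
          then obtain m where "X - {2*h, 2*h+1, 0} = {m}" by (metis card_1_singletonE)
          then have Xm: "X = {2*h, 2*h+1, 0, m}" using sub by blast
          from stepX[OF this] have "m < 2*h" by auto
          then show ?thesis using eX[OF w(1)] ew Xm hi(1) by auto
        qed
        from blocks_10_level R(1) u(2) v(2) x(2) y(2) uv ne'
        have "(fst x \<notin> {fst u, fst v} \<and> fst y \<notin> {fst u, fst v}) \<or>
          (fst x \<in> {fst u, fst v} \<and> fst y \<in> {fst u, fst v} \<and> snd x = snd y)" by blast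
        then show ?thesis
        proof
          assume "fst x \<notin> {fst u, fst v} \<and> fst y \<notin> {fst u, fst v}"
          then show ?thesis using low x(2) y(2) fx lower by metis
        next
          assume *: "fst x \<in> {fst u, fst v} \<and> fst y \<in> {fst u, fst v} \<and> snd x = snd y"
          then have fl: "fst (?L a) \<in> {2*h, 2*h+1}" "fst (?L b) \<in> {2*h, 2*h+1}" using fx fu by auto
          \<comment> \<open>The remaining two points form another level of the same pair of groups,
            so they are both below or both above.\<close>
          have "snd x \<noteq> i" using * ne'(1,2) fu by (metis insertE prod_eqI singletonD)
          then consider "snd x < i" | "snd x > i" by linarith
          then show ?thesis
          proof cases
            case 1
            then show ?thesis using same[OF fl(1)] same[OF fl(2)] fl fx * hi by auto
          next
            case 2
            then show ?thesis using same[OF fl(1)] same[OF fl(2)] fl fx * hi by auto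
          qed
        qed
      qed
    qed
  qed
  with bij F show ?thesis by (rule steppableI)
qed

section \<open>Induction over residues modulo 72\<close>

text \<open>Multiples of 4 are halved. What remains is 2 or 10 modulo 12. The rules with factor 3
  are sorted by residue modulo 36, those with factors 4 and 12 by residue modulo 24, whence
  72.\<close>

lemma steppable_if_mod_6:
  fixes q :: nat
  assumes "q \<ge> 2" "q mod 6 = 2 \<or> q mod 6 = 4"
  shows "steppable q"
  using assms
proof (induction q rule: less_induct)
  case (less q)
  have IH: "steppable m" if "m < q" "m \<ge> 2" "m mod 6 = 2 \<or> m mod 6 = 4" for m
    using less.IH[of m] that by blast
  have mod72: "q mod 6 = q mod 72 mod 6" "q mod 72 < 72" by (simp_all add: mod_mod_cancel)
  define k where "k = q div 72"
  define r where "r = q mod 72"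
  have q: "q = 72 * k + r" "r < 72" by (auto simp: k_def r_def)
  have r6: "r mod 6 = 2 \<or> r mod 6 = 4" using less.prems mod72 unfolding r_def by metis
  then consider (double) "r mod 4 = 0" | (triad) "r \<in> {10,22,46,58}" | (t2) "r \<in> {26,62}" | (t4) "r \<in> {34,70}"
    | (quad) "r \<in> {2,50}" | (dozen) "r \<in> {14,38}"
  proof -
    have "\<forall>r\<in>set [0..<72]. r mod 6 = 2 \<or> r mod 6 = 4 \<longrightarrow> r mod 4 = 0 \<or> r \<in> {10,22,46,58} \<or> r \<in> {26,62} \<or>
      r \<in> {34,70} \<or> r \<in> {2,50} \<or> r \<in> {14,38}" by code_simp
    then show ?thesis using q(2) r6 that by (metis atLeastLessThan_iff atLeastLessThan_upt zero_le)
  qed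
  then show ?case
  proof cases
    case double
    then have "q mod 4 = 0" using q by presburger
    then obtain n where n: "q = 2 * n" by (metis dvd_def even_numeral mod_0_imp_dvd dvd_trans)
    have "steppable n" using n less.prems \<open>q mod 4 = 0\<close> by (intro IH) presburger+
    moreover have "n \<ge> 2" using n less.prems \<open>q mod 4 = 0\<close> by presburger
    ultimately show ?thesis using steppable_double n by simp
  next
    case triad
    then obtain c where c: "r = 12 * c + 10" "c < 5" "c mod 3 \<noteq> 2" by auto
    \<comment> \<open>\<open>c mod 3\<close> is not 2, so \<open>n\<close> is not divisible by 3 and
      the induction hypothesis applies; the excluded residues 34 and 70 are handled by the rule
      \<open>3n - 8\<close>.\<close>
    define n where "n = 24 * k + 4 * c + 4"
    have "q = 3 * n - 2" using q c by (simp add: n_def)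
    moreover have "steppable n" using q c unfolding n_def by (intro IH) presburger+
    ultimately show ?thesis using steppable_triad[of n] by (simp add: n_def)
  next
    case t2
    then obtain c where c: "r = 36 * c + 26" "c < 2" by auto
    define g where "g = 24 * k + 12 * c + 8"
    have "q = 2 + 3 * g" using q c by (simp add: g_def)
    moreover have "steppable (g + 2)" using q c unfolding g_def by (intro IH) presburger+
    moreover have "g = 6 * (4 * k + 2 * c + 1) + 2" by (simp add: g_def)
    ultimately show ?thesis using steppable_triple[of g 2 "4 * k + 2 * c + 1"] by simp
  next
    case t4
    then obtain c where c: "r = 36 * c + 34" "c < 2" by auto
    define g where "g = 24 * k + 12 * c + 10"
    have "q = 4 + 3 * g" using q c by (simp add: g_def)
    moreover have "steppable (g + 4)" using q c unfolding g_def by (intro IH) presburger+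
    moreover have "g = 6 * (4 * k + 2 * c + 1) + 4" by (simp add: g_def)
    ultimately show ?thesis using steppable_triple[of g 4 "4 * k + 2 * c + 1"] by simp
  next
    case quad
    then obtain c where c: "r = 24 * c + 2" "c = 0 \<or> c = 2" by auto
    show ?thesis
    \<comment> \<open>For \<open>q = 2\<close> the groups would be empty and the rule would lead
      back to 2.\<close>
    proof (cases "q = 2")
      case True then show ?thesis using steppable_2 by simp
    next
      case False
      define g where "g = 18 * k + 6 * c"
      have qg: "q = 2 + 4 * g" using q c by (simp add: g_def)
      have "g > 0" using False qg by simp
      moreover have "steppable (g + 2)"
      proof (rule IH)
        show "(g + 2) mod 6 = 2 \<or> (g + 2) mod 6 = 4" unfolding g_def by presburger
      qed (use qg \<open>g > 0\<close> in simp_all)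
      moreover have "even g" by (auto simp: g_def)
      ultimately show ?thesis using steppable_quadruple[of g] qg by simp
    qed
  next
    case dozen
    then obtain c where c: "r = 24 * c + 14" "c < 2" by auto
    \<comment> \<open>Since \<open>c < 2\<close>, this is 2 or 4 modulo 6; residue 62 would give a
      multiple of 6 and is handled by the rule \<open>3n - 4\<close>.\<close>
    define n where "n = 6 * k + 2 * c + 2"
    have "q = 2 + (n - 1) * 12" using q c by (simp add: n_def)
    moreover have "steppable n" using q c unfolding n_def by (intro IH) presburger+
    ultimately show ?thesis using steppable_dozen[of n] by (simp add: n_def)
  qed
qed

theorem theorem3p3:
  fixes q :: nat
  assumes "q \<ge> 4" and "q mod 6 = 2 \<or> q mod 6 = 4"
  shows "\<exists>S L. is_SQS q S \<and> bij_betw L {0..<q} (B q) \<and> step_property q S L"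
proof -
  have "steppable q" using assms by (intro steppable_if_mod_6) auto
  then obtain S where S: "exact_cover S (triples {0..<q})" "stepped q S id" unfolding steppable_def by blast
  have "step_property q S id" using S(2) unfolding stepped_def step_property_def .
  moreover have "bij_betw id {0..<q} (B q)" by (simp add: B_def)
  ultimately show ?thesis using is_SQS_if_exact_cover[OF S(1)] by blast
qed

end
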